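(* Let $1\leq p<\infty$, $\alpha>0$, and let $\varphi$ be a measurable function on $(0,\infty)$. Then: (i) If $\int_0^\infty t^{\frac{1+\alpha}{p}-1}|\varphi(t)|\,dt<\infty$, then $\mathscr H_\varphi$ is bounded on $\mathcal A^p_\alpha(\mathbb C_+)$. Moreover, $$\left|\int_0^\infty t^{\frac{1+\alpha}{p}-1}\varphi(t)\,dt\right|\leq \|\mathscr H_\varphi\|_{\mathcal A^p_\alpha(\mathbb C_+)\to\mathcal A^p_\alpha(\mathbb C_+)}\leq \int_0^\infty t^{\frac{1+\alpha}{p}-1}|\varphi(t)|\,dt.$$ (ii) Conversely, if $\varphi\geq 0$ and $\mathscr H_\varphi$ is bounded on $\mathcal A^p_\alpha(\mathbb C_+)$, then $\int_0^\infty t^{\frac{1+\alpha}{p}-1}|\varphi(t)|\,dt<\infty$.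
   Context: $\mathbb C_+=\{x+iy\in\mathbb C: y>0\}$ is the upper half-plane. Functions on $(0,\infty)$ are complex-valued unless said to be nonnegative. For a measurable function $\varphi$ on $(0,\infty)$, the Hausdorff operator is defined for suitable holomorphic functions $f$ on $\mathbb C_+$ by $\mathscr H_\varphi f(z)=\int_0^\infty f\left(\frac zt\right)\frac{\varphi(t)}{t}\,dt$, $z\in\mathbb C_+$. For $0<p<\infty$ and $\alpha>0$, the weighted Bergman space $\mathcal A^p_\alpha(\mathbb C_+)$ is the set of all holomorphic functions $f$ on $\mathbb C_+$ with $\|f\|_{\mathcal A^p_\alpha(\mathbb C_+)}:=\left(\int_{\mathbb C_+}|f(x+iy)|^p\,y^{\alpha-1}\,dx\,dy\right)^{1/p}<\infty$. An operator is bounded on a normed space $X$ if it is well-defined on every $f\in X$ (here: the defining integral makes sense as a Lebesgue integral), maps $X$ into $X$, and has finite operator norm $\|\cdot\|_{X\to X}$. *)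

theory Defs
  imports "HOL-Complex_Analysis.Complex_Analysis"
begin

definition upper_half_plane :: "complex set" where
  "upper_half_plane = {z. Im z > 0}"

text \<open>
  Functions on the upper half-plane are total functions of type \<^typ>\<open>complex \<Rightarrow> complex\<close>; the
  definitions below never depend on the values outside \<^const>\<open>upper_half_plane\<close>. The measure
  \<^term>\<open>lborel :: complex measure\<close> is the area measure \<open>dx dy\<close>.
\<close>

definition bergman_space :: "real \<Rightarrow> real \<Rightarrow> (complex \<Rightarrow> complex) set" where
  "bergman_space p \<alpha> =
    {f. f holomorphic_on upper_half_plane \<and>
        set_integrable lborel upper_half_plane (\<lambda>z. cmod (f z) powr p * Im z powr (\<alpha> - 1))}"

definition bergman_norm :: "real \<Rightarrow> real \<Rightarrow> (complex \<Rightarrow> complex) \<Rightarrow> real" where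
  "bergman_norm p \<alpha> f =
    (LINT z:upper_half_plane|lborel. cmod (f z) powr p * Im z powr (\<alpha> - 1)) powr (1 / p)"

definition hausdorff_op :: "(real \<Rightarrow> complex) \<Rightarrow> (complex \<Rightarrow> complex) \<Rightarrow> complex \<Rightarrow> complex" where
  "hausdorff_op \<phi> f z =
    (LINT t:{0<..}|lebesgue. f (z / complex_of_real t) * (\<phi> t / complex_of_real t))"

text \<open>Existence of the defining integral, at every point of the half-plane, as a Lebesgue integral.\<close>

definition hausdorff_well_defined :: "(real \<Rightarrow> complex) \<Rightarrow> (complex \<Rightarrow> complex) \<Rightarrow> bool" where
  "hausdorff_well_defined \<phi> f \<longleftrightarrow>
    (\<forall>z\<in>upper_half_plane.
      set_integrable lebesgue {0<..} (\<lambda>t. f (z / complex_of_real t) * (\<phi> t / complex_of_real t)))"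

text \<open>
  The operator norm takes values in \<^typ>\<open>ennreal\<close>, so that it is \<open>\<infinity>\<close> for an unbounded operator.
  It is only meaningful when the operator maps the space into itself, because
  \<^const>\<open>bergman_norm\<close> is \<open>0\<close> (not \<open>\<infinity>\<close>) on functions whose integral diverges.
\<close>

definition hausdorff_norm :: "real \<Rightarrow> real \<Rightarrow> (real \<Rightarrow> complex) \<Rightarrow> ennreal" where
  "hausdorff_norm p \<alpha> \<phi> =
    (SUP f\<in>{f \<in> bergman_space p \<alpha>. bergman_norm p \<alpha> f \<le> 1}.
      ennreal (bergman_norm p \<alpha> (hausdorff_op \<phi> f)))"

definition hausdorff_bounded :: "real \<Rightarrow> real \<Rightarrow> (real \<Rightarrow> complex) \<Rightarrow> bool" where
  "hausdorff_bounded p \<alpha> \<phi> \<longleftrightarrow>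
    (\<forall>f\<in>bergman_space p \<alpha>. hausdorff_well_defined \<phi> f \<and> hausdorff_op \<phi> f \<in> bergman_space p \<alpha>) \<and>
    hausdorff_norm p \<alpha> \<phi> < \<infinity>"

end

theory Submission
  imports Defs
begin

text \<open>
  Let \<open>b = (1 + \<alpha>) / p\<close>. The dilations \<open>U\<^sub>t f(z) = t\<^sup>-\<^sup>b f(z / t)\<close> are isometries of the Bergman space and the
  operator is \<open>\<integral> U\<^sub>t \<psi>(t) dt\<close> with \<open>\<psi>(t) = t\<^sup>b\<^sup>-\<^sup>1 \<phi>(t)\<close>. Hence Jensen's inequality and Tonelli bound its norm by
  \<open>\<integral> |\<psi>|\<close>; the pointwise bound \<open>|f(z)| \<le> C (Im z)\<^sup>-\<^sup>b \<parallel>f\<parallel>\<close> makes the defining integral converge and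
  depend holomorphically on \<open>z\<close>. For the lower bound, the functions \<open>F(z) = (1 - \<i>z)\<^sup>-\<^sup>b\<^sup>-\<^sup>d\<close> satisfy
  \<open>\<parallel>U\<^sub>t F - F\<parallel> / \<parallel>F\<parallel> \<rightarrow> 0\<close> as \<open>d \<rightarrow> 0\<close>, so by dominated convergence the operator acts on them almost as
  multiplication by \<open>\<integral> \<psi>\<close>. If \<open>\<phi> \<ge> 0\<close>, then in a narrow sector around the imaginary axis
  the real part of \<open>U\<^sub>t F\<close> is at least half its modulus. Both \<open>\<parallel>F\<parallel>\<^sup>p\<close> and its part carried by the sector
  are of order \<open>1 / d\<close>, so with \<open>d = 1 / N\<close> the integral of \<open>\<psi>\<close> over \<open>[1 / N, N]\<close> is bounded
  by the operator norm, uniformly in \<open>N\<close>.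
\<close>

subsection \<open>Integral inequalities\<close>

text \<open>With exponent exactly b the test function misses the space only logarithmically: its
  mass diverges like the integral of dy / y, which is why adding d produces mass of order 1 / d.
  Subtracting t^d F from U_t F gains a full power of decay up to d, so this difference is dominated
  by the test function of exponent b + 1, whose mass does not depend on d; what remains is (t^d - 1)
  F, small relative to F. All estimates run on p-th powers of norms in \<open>ennreal\<close>, where
  divergence stays visible. The triangle inequality becomes (x + y)^p \<le> l^(1-p) x^p +
  (1-l)^(1-p) y^p with a free weight l; letting l tend to 1 after d has tended to 0 loses nothing in
  the constant. The choice d = 1 / N keeps t^d between 1/3 and 3 on [1 / N, N], because N^(1/N)
  \<le> e \<le> 3.\<close>

lemma powr_tangent_le:
  fixes x a p :: real
  assumes "1 \<le> p" "0 \<le> x" "0 < a"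
  shows "p * a powr (p - 1) * x \<le> x powr p + (p - 1) * a powr p"
proof (cases "x = 0")
  case True
  then show ?thesis using assms by simp
next
  case False
  with assms have x: "x > 0" by simp
  \<comment> \<open>Weighted AM-GM for (x / a)^p and 1 with weights 1 / p and 1 - 1 / p. It amounts
    to Bernoulli's inequality 1 + p (y - 1) \<le> y^p at y = x / a, which is then multiplied by
    a^p.\<close>
  have "(x powr p / a powr p) powr (1 / p) * 1 powr (1 - 1 / p)
      \<le> 1 / p * (x powr p / a powr p) + (1 - 1 / p) * 1"
    using assms x by (intro Youngs_inequality_0) auto
  then have "x / a \<le> 1 / p * (x powr p / a powr p) + (1 - 1 / p)"
    using assms x by (simp add: powr_powr flip: powr_divide)
  then have "p * (x / a) \<le> p * (1 / p * (x powr p / a powr p) + (1 - 1 / p))"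
    using assms by (intro mult_left_mono) auto
  then have "1 + p * (x / a - 1) \<le> x powr p / a powr p"
    using assms by (simp add: algebra_simps)
  then have "(1 + p * (x / a - 1)) * a powr p \<le> x powr p"
    using assms by (simp add: pos_le_divide_eq)
  moreover have "a powr p = a * a powr (p - 1)"
    using assms powr_mult_base[of a "p - 1"] by simp
  moreover have "(1 + p * (x / a - 1)) * (a * a powr (p - 1))
      = (a + p * (x - a)) * a powr (p - 1)"
    using assms by (simp add: field_simps)
  ultimately show ?thesis by (simp add: algebra_simps)
qed

text \<open>Boxes in the plane pull back to products of open intervals, and \<open>lborel\<close> is
  determined by its values on boxes.\<close>

lemma lborel_complex_eq_distr:
  "(lborel :: complex measure) = distr (lborel \<Otimes>\<^sub>M lborel) borel (\<lambda>(x, y). Complex x y)"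
proof (rule lborel_eqI)
  fix l u :: complex
  assume *: "\<And>b. b \<in> Basis \<Longrightarrow> l \<bullet> b \<le> u \<bullet> b"
  have **: "Re l \<le> Re u" "Im l \<le> Im u"
    using *[of 1] *[of \<i>] by (auto simp: Basis_complex_def inner_complex_def)
  have [measurable]: "(\<lambda>(x, y). Complex x y) \<in> borel_measurable (lborel \<Otimes>\<^sub>M lborel)"
    unfolding Complex_eq by measurable
  have "(\<lambda>(x, y). Complex x y) -` box l u \<inter> space (lborel \<Otimes>\<^sub>M lborel)
      = {Re l<..<Re u} \<times> {Im l<..<Im u}"
    by (auto simp: in_box_complex_iff space_pair_measure)
  then have "emeasure (distr (lborel \<Otimes>\<^sub>M lborel) borel (\<lambda>(x, y). Complex x y)) (box l u)
      = ennreal (Re u - Re l) * ennreal (Im u - Im l)"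
    using ** by (simp add: emeasure_distr lborel.emeasure_pair_measure_Times)
  then show "emeasure (distr (lborel \<Otimes>\<^sub>M lborel) borel (\<lambda>(x, y). Complex x y)) (box l u)
      = (\<Prod>b\<in>Basis. (u - l) \<bullet> b)"
    using ** by (simp add: Basis_complex_def inner_complex_def ennreal_mult)
qed simp

text \<open>The imaginary part is the outer variable because the Bergman weight depends on it alone;
  horizontal integrals are estimated first.\<close>

lemma nn_integral_lborel_complex:
  assumes [measurable]: "f \<in> borel_measurable borel"
  shows "(\<integral>\<^sup>+z. f z \<partial>lborel) = (\<integral>\<^sup>+y. \<integral>\<^sup>+x. f (Complex x y) \<partial>lborel \<partial>lborel)"
proof -
  have [measurable]: "(\<lambda>(x, y). Complex x y) \<in> borel_measurable (lborel \<Otimes>\<^sub>M lborel)"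
    unfolding Complex_eq by measurable
  have "(\<lambda>(x, y). f (Complex x y)) \<in> borel_measurable (lborel \<Otimes>\<^sub>M lborel)"
    using measurable_compose[OF _ assms, of "(\<lambda>(x, y). Complex x y)"]
    by (simp add: case_prod_unfold)
  note lborel_pair.nn_integral_snd[OF this]
  then show ?thesis
    by (subst lborel_complex_eq_distr, subst nn_integral_distr) (simp_all add: case_prod_unfold)
qed

text \<open>\<phi> is only Lebesgue measurable, so the t-integral lives on the completed measure,
  and Tonelli is applied there.\<close>

lemma lebesgue_sigma_finite: "sigma_finite_measure (lebesgue :: 'a::euclidean_space measure)"
proof
  obtain A :: "'a set set" where "countable A" "A \<subseteq> sets lborel" "\<Union>A = space lborel"
      "\<forall>a\<in>A. emeasure lborel a \<noteq> \<infinity>"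
    using lborel.sigma_finite_countable by blast
  then show "\<exists>A::'a set set. countable A \<and> A \<subseteq> sets lebesgue \<and> \<Union>A = space lebesgue \<and>
      (\<forall>a\<in>A. emeasure lebesgue a \<noteq> \<infinity>)"
    by (intro exI[of _ A]) (auto simp: subset_iff)
qed

text \<open>Let K be the total weight, m the integral of g w, and a = m / K the weighted mean.
  Integrating \<open>powr_tangent_le\<close> at a gives a^p K \<le> integral of g^p w, and
  multiplying by K^(p-1) turns the left side into m^p.\<close>

lemma ennreal_jensen_powr:
  fixes g w :: "'a \<Rightarrow> real"
  assumes p: "1 \<le> p" and [measurable]: "g \<in> borel_measurable M"
    and w: "integrable M w" and g0: "\<And>x. 0 \<le> g x" and w0: "\<And>x. 0 \<le> w x"
  shows "ennreal ((\<integral>x. g x * w x \<partial>M) powr p)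
    \<le> ennreal ((\<integral>x. w x \<partial>M) powr (p - 1)) * (\<integral>\<^sup>+x. ennreal (g x powr p * w x) \<partial>M)"
proof -
  define K where "K = (\<integral>x. w x \<partial>M)"
  define m where "m = (\<integral>x. g x * w x \<partial>M)"
  have [measurable]: "w \<in> borel_measurable M" using w by auto
  have K0: "K \<ge> 0" unfolding K_def using w0 by simp
  have m0: "m \<ge> 0" unfolding m_def using w0 g0 by simp
  show ?thesis
  \<comment> \<open>This case also covers a non-integrable product, whose Bochner integral is 0 by
    convention. Conversely, m \<noteq> 0 forces integrability.\<close>
  proof (cases "m = 0")
    case True
    then show ?thesis by (simp add: m_def)
  next
    case m: False
    then have int: "integrable M (\<lambda>x. g x * w x)"
      unfolding m_def using not_integrable_integral_eq by blast
    have K: "K > 0"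
    proof (rule ccontr)
      assume "\<not> K > 0"
      with K0 have "K = 0" by simp
      then have "AE x in M. w x = 0"
        using integral_nonneg_eq_0_iff_AE[OF w] w0 by (simp add: K_def)
      then have "m = (\<integral>x. 0 \<partial>M)" unfolding m_def by (intro integral_cong_AE) auto
      with m show False by simp
    qed
    define a where "a = m / K"
    have a: "a > 0" using m m0 K by (simp add: a_def)
    have mK: "m = a * K" using K by (simp add: a_def)
    show ?thesis
    proof (cases "(\<integral>\<^sup>+x. ennreal (g x powr p * w x) \<partial>M) = \<infinity>")
      case True
      then show ?thesis using K by (simp add: ennreal_mult_top flip: K_def)
    next
      case False
      then have int2: "integrable M (\<lambda>x. g x powr p * w x)"
        using w0 by (intro integrableI_nonneg) (auto simp: less_top)
      have "p * a powr (p - 1) * m = (\<integral>x. p * a powr (p - 1) * (g x * w x) \<partial>M)"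
        by (simp add: m_def)
      also have "\<dots> \<le> (\<integral>x. g x powr p * w x + (p - 1) * a powr p * w x \<partial>M)"
      proof (intro integral_mono)
        fix x
        show "p * a powr (p - 1) * (g x * w x) \<le> g x powr p * w x + (p - 1) * a powr p * w x"
          using mult_right_mono[OF powr_tangent_le[OF p g0[of x] a] w0[of x]]
          by (simp add: algebra_simps)
      qed (use int int2 w in auto)
      also have "\<dots> = (\<integral>x. g x powr p * w x \<partial>M) + (p - 1) * a powr p * K"
        using int2 w by (simp add: K_def)
      finally have "a powr p * K \<le> (\<integral>x. g x powr p * w x \<partial>M)"
        using a powr_mult_base[of a "p - 1"] by (simp add: mK algebra_simps)
      then have "K powr (p - 1) * (a powr p * K) \<le> K powr (p - 1) * (\<integral>x. g x powr p * w x \<partial>M)"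
        by (intro mult_left_mono) auto
      moreover have "K powr (p - 1) * (a powr p * K) = m powr p"
        using K a by (simp add: mK powr_mult powr_diff)
      ultimately have "ennreal (m powr p) \<le> ennreal (K powr (p - 1) * (\<integral>x. g x powr p * w x \<partial>M))"
        by (intro ennreal_leI) simp
      also have "\<dots> = ennreal (K powr (p - 1)) * (\<integral>\<^sup>+x. ennreal (g x powr p * w x) \<partial>M)"
        using int2 w0 by (subst nn_integral_eq_integral) (auto simp: ennreal_mult)
      finally show ?thesis by (simp add: m_def K_def)
    qed
  qed
qed

text \<open>Jensen in t with weight \<open>cmod (\<psi> t)\<close> for each fixed z, then Tonelli.
  If the z-mass of the kernel is the same number m for all t, the right side is K^(p-1) K m = K^p m
  with K the integral of \<open>cmod (\<psi> t)\<close>, so for a family of isometries the constant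
  is that of Minkowski's inequality.\<close>

lemma minkowski_kernel_bound:
  fixes k :: "'a \<Rightarrow> 'b \<Rightarrow> complex" and \<psi> :: "'b \<Rightarrow> complex"
  assumes "sigma_finite_measure M" "sigma_finite_measure L" and p: "1 \<le> p"
    and [measurable]: "(\<lambda>(z, t). k z t) \<in> borel_measurable (M \<Otimes>\<^sub>M L)"
    and \<psi>: "integrable L \<psi>"
  shows "(\<integral>\<^sup>+z. ennreal (cmod (\<integral>t. k z t * \<psi> t \<partial>L) powr p) \<partial>M)
    \<le> ennreal ((\<integral>t. cmod (\<psi> t) \<partial>L) powr (p - 1)) *
       (\<integral>\<^sup>+t. ennreal (cmod (\<psi> t)) * (\<integral>\<^sup>+z. ennreal (cmod (k z t) powr p) \<partial>M) \<partial>L)"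
proof -
  interpret M: sigma_finite_measure M by fact
  interpret L: sigma_finite_measure L by fact
  interpret pair_sigma_finite M L ..
  have [measurable]: "\<psi> \<in> borel_measurable L" using \<psi> by auto
  have "(\<integral>\<^sup>+z. ennreal (cmod (\<integral>t. k z t * \<psi> t \<partial>L) powr p) \<partial>M)
    \<le> (\<integral>\<^sup>+z. ennreal ((\<integral>t. cmod (\<psi> t) \<partial>L) powr (p - 1)) *
        (\<integral>\<^sup>+t. ennreal (cmod (k z t) powr p * cmod (\<psi> t)) \<partial>L) \<partial>M)"
  proof (rule nn_integral_mono)
    fix z assume [measurable]: "z \<in> space M"
    have "cmod (\<integral>t. k z t * \<psi> t \<partial>L) \<le> (\<integral>t. cmod (k z t) * cmod (\<psi> t) \<partial>L)"
      using integral_norm_bound[of L "\<lambda>t. k z t * \<psi> t"] by (simp add: norm_mult)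
    then have "ennreal (cmod (\<integral>t. k z t * \<psi> t \<partial>L) powr p)
        \<le> ennreal ((\<integral>t. cmod (k z t) * cmod (\<psi> t) \<partial>L) powr p)"
      using p by (intro ennreal_leI powr_mono2) auto
    also have "\<dots> \<le> ennreal ((\<integral>t. cmod (\<psi> t) \<partial>L) powr (p - 1)) *
        (\<integral>\<^sup>+t. ennreal (cmod (k z t) powr p * cmod (\<psi> t)) \<partial>L)"
      using p \<psi> by (intro ennreal_jensen_powr) auto
    finally show "ennreal (cmod (\<integral>t. k z t * \<psi> t \<partial>L) powr p) \<le> \<dots>" .
  qed
  also have "\<dots> = ennreal ((\<integral>t. cmod (\<psi> t) \<partial>L) powr (p - 1)) *
      (\<integral>\<^sup>+z. \<integral>\<^sup>+t. ennreal (cmod (k z t) powr p * cmod (\<psi> t)) \<partial>L \<partial>M)"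
    by (rule nn_integral_cmult) measurable
  also have "(\<integral>\<^sup>+z. \<integral>\<^sup>+t. ennreal (cmod (k z t) powr p * cmod (\<psi> t)) \<partial>L \<partial>M)
      = (\<integral>\<^sup>+t. \<integral>\<^sup>+z. ennreal (cmod (k z t) powr p * cmod (\<psi> t)) \<partial>M \<partial>L)"
    by (rule Fubini'[symmetric]) measurable
  also have "\<dots> = (\<integral>\<^sup>+t. ennreal (cmod (\<psi> t)) * (\<integral>\<^sup>+z. ennreal (cmod (k z t) powr p) \<partial>M) \<partial>L)"
  proof (rule nn_integral_cong)
    fix t assume [measurable]: "t \<in> space L"
    have "(\<integral>\<^sup>+z. ennreal (cmod (k z t) powr p * cmod (\<psi> t)) \<partial>M)
        = (\<integral>\<^sup>+z. ennreal (cmod (\<psi> t)) * ennreal (cmod (k z t) powr p) \<partial>M)"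
      by (simp add: ennreal_mult mult.commute)
    also have "\<dots> = ennreal (cmod (\<psi> t)) * (\<integral>\<^sup>+z. ennreal (cmod (k z t) powr p) \<partial>M)"
      by (rule nn_integral_cmult) measurable
    finally show "(\<integral>\<^sup>+z. ennreal (cmod (k z t) powr p * cmod (\<psi> t)) \<partial>M) = \<dots>" .
  qed
  finally show ?thesis .
qed

subsection \<open>Point evaluation by area integrals\<close>

text \<open>The majorant is integrated over the whole line, so that a later affine substitution
  involves no limits of integration.\<close>

lemma linepath_integral_bound:
  assumes cont: "continuous_on (closed_segment a b) h"
    and le: "\<And>x. x \<in> {0..1} \<Longrightarrow> cmod (h (linepath a b x)) \<le> K x"
    and [measurable]: "K \<in> borel_measurable borel"
  shows "ennreal (cmod (contour_integral (linepath a b) h))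
    \<le> ennreal (cmod (b - a)) * (\<integral>\<^sup>+x. ennreal (K x) \<partial>lborel)"
proof -
  have c: "continuous_on {0..1} (\<lambda>x. h (linepath a b x))"
    by (rule continuous_on_compose2[OF cont])
       (auto intro!: continuous_intros linepath_in_path simp del: linepath_def)
  have "cmod (contour_integral (linepath a b) h)
      = cmod (integral {0..1} (\<lambda>x. h (linepath a b x) * (b - a)))"
    by (simp add: contour_integral_integral)
  also have "\<dots> \<le> integral {0..1} (\<lambda>x. cmod (h (linepath a b x)) * cmod (b - a))"
    by (intro integral_norm_bound_integral integrable_continuous_interval continuous_intros c)
       (auto simp: norm_mult)
  also have "\<dots> = cmod (b - a) * integral {0..1} (\<lambda>x. cmod (h (linepath a b x)))"
    by simp
  finally have 1: "ennreal (cmod (contour_integral (linepath a b) h))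
      \<le> ennreal (cmod (b - a)) * ennreal (integral {0..1} (\<lambda>x. cmod (h (linepath a b x))))"
    by (subst ennreal_mult'[symmetric]) (auto intro!: ennreal_leI)
  have "((\<lambda>x. cmod (h (linepath a b x))) has_integral
      integral {0..1} (\<lambda>x. cmod (h (linepath a b x)))) {0..1}"
    by (intro integrable_integral integrable_continuous_interval continuous_intros c)
  from nn_integral_has_integral_lebesgue'[OF _ this]
  have "ennreal (integral {0..1} (\<lambda>x. cmod (h (linepath a b x))))
      = (\<integral>\<^sup>+x. ennreal (cmod (h (linepath a b x))) * indicator {0..1} x \<partial>lborel)"
    by simp
  also have "\<dots> \<le> (\<integral>\<^sup>+x. ennreal (K x) \<partial>lborel)"
    by (intro nn_integral_mono) (auto simp: indicator_def intro!: ennreal_leI le)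
  finally show ?thesis
    using 1 by (meson mult_left_mono order_trans zero_le)
qed

text \<open>
  Cauchy's formula on the boundary of the square of half-side \<open>s\<close>, integrated over \<open>s \<in> {1..2}\<close>: each of the
  four sides sweeps out a part of the big square, so only Fubini and no polar coordinates are needed.
\<close>

lemma holomorphic_bound_square_integral:
  fixes g :: "complex \<Rightarrow> complex"
  defines "Q \<equiv> cbox (Complex (-2) (-2)) (Complex 2 2)"
  assumes hol: "g holomorphic_on Q"
  shows "ennreal (cmod (g 0)) \<le> (\<integral>\<^sup>+z. ennreal (indicator Q z * cmod (g z)) \<partial>lborel)"
proof -
  define H where "H = (\<lambda>z. indicator Q z * cmod (g z))"
  have contg: "continuous_on Q g" using hol by (rule holomorphic_on_imp_continuous_on)
  have [measurable]: "H \<in> borel_measurable borel"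
    using borel_measurable_continuous_on_indicator[of Q "\<lambda>z. cmod (g z)"]
      continuous_on_norm[OF contg] by (simp add: H_def Q_def)
  have Hm: "(\<lambda>u. H (Complex u c)) \<in> borel_measurable borel"
    "(\<lambda>u. H (Complex c u)) \<in> borel_measurable borel" for c
    unfolding Complex_eq by measurable
  \<comment> \<open>\<open>G\<close> is \<open>H\<close> along the line that carries the side, and
    \<open>t + c * x\<close> is the running coordinate on it. The length 2 s of the side is the
    Jacobian \<open>\<bar>c\<bar>\<close>, and 1 / s \<le> 1 bounds the Cauchy kernel because the
    side stays at distance at least s from 0.\<close>
  have side: "ennreal (cmod (contour_integral (linepath a b) (\<lambda>w. g w / w))) \<le> (\<integral>\<^sup>+u. ennreal (G u) \<partial>lborel)"
    if s: "s \<in> {1..2}" and sub: "closed_segment a b \<subseteq> Q"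
      and ge: "\<And>w. w \<in> closed_segment a b \<Longrightarrow> s \<le> cmod w"
      and len: "cmod (b - a) = 2 * s" and t: "\<bar>c\<bar> = 2 * s"
      and G: "\<And>x. G (t + c * x) = H (linepath a b x)"
      and [measurable]: "G \<in> borel_measurable borel" for a b G s t c
  proof -
    have "ennreal (cmod (contour_integral (linepath a b) (\<lambda>w. g w / w)))
        \<le> ennreal (cmod (b - a)) * (\<integral>\<^sup>+x. ennreal (G (t + c * x) / s) \<partial>lborel)"
    proof (rule linepath_integral_bound)
      show "continuous_on (closed_segment a b) (\<lambda>w. g w / w)"
        using ge s by (intro continuous_intros continuous_on_subset[OF contg sub]) force
    next
      fix x :: real assume x: "x \<in> {0..1}"
      then have m: "linepath a b x \<in> closed_segment a b" by (rule linepath_in_path)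
      show "cmod (g (linepath a b x) / linepath a b x) \<le> G (t + c * x) / s"
        using m sub s ge[OF m] unfolding G H_def
        by (auto simp: norm_divide indicator_def intro!: divide_left_mono mult_pos_pos)
    qed measurable
    also have "(\<integral>\<^sup>+x. ennreal (G (t + c * x) / s) \<partial>lborel)
        = ennreal (1 / s) * (\<integral>\<^sup>+x. ennreal (G (t + c * x)) \<partial>lborel)"
      using s by (subst nn_integral_cmult[symmetric])
        (auto intro!: nn_integral_cong simp flip: ennreal_mult')
    also have "ennreal (cmod (b - a)) * (ennreal (1 / s) * (\<integral>\<^sup>+x. ennreal (G (t + c * x)) \<partial>lborel))
        = ennreal (1 / s) * (ennreal \<bar>c\<bar> * (\<integral>\<^sup>+x. ennreal (G (t + c * x)) \<partial>lborel))"
      by (simp add: len t ac_simps)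
    also have "\<dots> = ennreal (1 / s) * (\<integral>\<^sup>+u. ennreal (G u) \<partial>lborel)"
      using s t by (subst nn_integral_real_affine[where c=c and t=t and f="\<lambda>u. ennreal (G u)"]) auto
    also have "\<dots> \<le> 1 * (\<integral>\<^sup>+u. ennreal (G u) \<partial>lborel)"
      using s by (intro mult_right_mono) auto
    finally show ?thesis by simp
  qed
  define V where "V = (\<lambda>s. (\<integral>\<^sup>+u. ennreal (H (Complex u (-s))) \<partial>lborel) + (\<integral>\<^sup>+u. ennreal (H (Complex s u)) \<partial>lborel)
    + (\<integral>\<^sup>+u. ennreal (H (Complex u s)) \<partial>lborel) + (\<integral>\<^sup>+u. ennreal (H (Complex (-s) u)) \<partial>lborel))"
  have V: "ennreal (4 * cmod (g 0)) \<le> V s" if s: "s \<in> {1..2}" for s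
  proof -
    define a1 a2 a3 a4 where a: "a1 = Complex (-s) (-s)" "a2 = Complex s (-s)"
      "a3 = Complex s s" "a4 = Complex (-s) s"
    let ?h = "\<lambda>w. g w / w"
    have "((\<lambda>w. g w / (w - 0)) has_contour_integral
        (2 * pi * \<i> * winding_number (rectpath a1 a3) 0 * g 0)) (rectpath a1 a3)"
    proof (rule Cauchy_integral_formula_convex_simple[OF _ hol])
      show "convex Q" by (simp add: Q_def convex_box)
      show "0 \<in> interior Q" by (simp add: Q_def in_box_complex_iff)
      show "path_image (rectpath a1 a3) \<subseteq> Q - {0}"
        using s by (subst path_image_rectpath) (auto simp: a Q_def in_cbox_complex_iff complex_eq_iff)
    qed (auto simp: a)
    moreover have "winding_number (rectpath a1 a3) 0 = 1"
      using s by (intro winding_number_rectpath) (auto simp: a in_box_complex_iff)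
    ultimately have I: "(?h has_contour_integral (2 * pi * \<i> * g 0)) (rectpath a1 a3)" by simp
    have segs: "closed_segment a1 a2 \<subseteq> Q" "closed_segment a2 a3 \<subseteq> Q"
        "closed_segment a3 a4 \<subseteq> Q" "closed_segment a4 a1 \<subseteq> Q"
      using s by (intro closed_segment_subset; auto simp: Q_def convex_box a in_cbox_complex_iff)+
    have far: "s \<le> cmod w" if "w \<in> closed_segment a1 a2 \<union> closed_segment a2 a3 \<union>
        closed_segment a3 a4 \<union> closed_segment a4 a1" for w
    proof -
      have "\<bar>Re w\<bar> = s \<or> \<bar>Im w\<bar> = s"
        using that s by (auto simp: a closed_segment_same_Re closed_segment_same_Im)
      then show ?thesis using abs_Re_le_cmod[of w] abs_Im_le_cmod[of w] by auto
    qed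
    have cint: "?h contour_integrable_on linepath a1 a2" "?h contour_integrable_on linepath a2 a3"
        "?h contour_integrable_on linepath a3 a4" "?h contour_integrable_on linepath a4 a1"
      using far s segs
      by (intro contour_integrable_continuous_linepath continuous_intros
            continuous_on_subset[OF contg]; force)+
    have "2 * pi * \<i> * g 0 = contour_integral (rectpath a1 a3) ?h"
      using I by (simp add: contour_integral_unique)
    also have "rectpath a1 a3 = linepath a1 a2 +++ linepath a2 a3 +++ linepath a3 a4 +++ linepath a4 a1"
      by (simp add: rectpath_def Let_def a)
    also have "contour_integral \<dots> ?h = contour_integral (linepath a1 a2) ?h
        + (contour_integral (linepath a2 a3) ?h
        + (contour_integral (linepath a3 a4) ?h + contour_integral (linepath a4 a1) ?h))"
      using cint by (simp add: contour_integrable_joinI valid_path_join)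
    finally have eq: "2 * pi * \<i> * g 0 = \<dots>" .
    \<comment> \<open>2 pi is lowered to 4 in order to cancel the four equal area integrals that the
      four sides will contribute.\<close>
    have "4 * cmod (g 0) \<le> 2 * pi * cmod (g 0)"
      using pi_ge_two by (intro mult_right_mono) auto
    also have "\<dots> = cmod (2 * pi * \<i> * g 0)" by (simp add: norm_mult)
    also have "\<dots> \<le> cmod (contour_integral (linepath a1 a2) ?h) + (cmod (contour_integral (linepath a2 a3) ?h)
        + (cmod (contour_integral (linepath a3 a4) ?h) + cmod (contour_integral (linepath a4 a1) ?h)))"
      unfolding eq by (intro order_trans[OF norm_triangle_ineq] add_mono order_refl)
    finally have "ennreal (4 * cmod (g 0)) \<le> ennreal \<dots>" by (rule ennreal_leI)
    also have "\<dots> = ennreal (cmod (contour_integral (linepath a1 a2) ?h)) + (ennreal (cmod (contour_integral (linepath a2 a3) ?h))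
        + (ennreal (cmod (contour_integral (linepath a3 a4) ?h)) + ennreal (cmod (contour_integral (linepath a4 a1) ?h))))"
      by simp
    also have "\<dots> \<le> (\<integral>\<^sup>+u. ennreal (H (Complex u (-s))) \<partial>lborel) + ((\<integral>\<^sup>+u. ennreal (H (Complex s u)) \<partial>lborel)
    + ((\<integral>\<^sup>+u. ennreal (H (Complex u s)) \<partial>lborel) + (\<integral>\<^sup>+u. ennreal (H (Complex (-s) u)) \<partial>lborel)))"
    proof (intro add_mono)
      have sq: "sqrt (4 * s\<^sup>2) = s * 2" using s by (simp add: real_sqrt_mult)
      show "ennreal (cmod (contour_integral (linepath a1 a2) ?h)) \<le> (\<integral>\<^sup>+u. ennreal (H (Complex u (-s))) \<partial>lborel)"
        using s segs far sq
        by (intro side[where s=s and t="-s" and c="2 * s"] Hm)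
           (auto simp: a linepath_def complex_eq_iff cmod_def algebra_simps intro!: arg_cong[where f=H])
      show "ennreal (cmod (contour_integral (linepath a2 a3) ?h)) \<le> (\<integral>\<^sup>+u. ennreal (H (Complex s u)) \<partial>lborel)"
        using s segs far sq
        by (intro side[where s=s and t="-s" and c="2 * s"] Hm)
           (auto simp: a linepath_def complex_eq_iff cmod_def algebra_simps intro!: arg_cong[where f=H])
      show "ennreal (cmod (contour_integral (linepath a3 a4) ?h)) \<le> (\<integral>\<^sup>+u. ennreal (H (Complex u s)) \<partial>lborel)"
        using s segs far sq
        by (intro side[where s=s and t="s" and c="-2 * s"] Hm)
           (auto simp: a linepath_def complex_eq_iff cmod_def algebra_simps intro!: arg_cong[where f=H])
      show "ennreal (cmod (contour_integral (linepath a4 a1) ?h)) \<le> (\<integral>\<^sup>+u. ennreal (H (Complex (-s) u)) \<partial>lborel)"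
        using s segs far sq
        by (intro side[where s=s and t="s" and c="-2 * s"] Hm)
           (auto simp: a linepath_def complex_eq_iff cmod_def algebra_simps intro!: arg_cong[where f=H])
    qed
    finally show ?thesis by (simp add: V_def add.assoc)
  qed
  have HC[measurable]: "(\<lambda>(x, y). ennreal (H (Complex x y))) \<in> borel_measurable (lborel \<Otimes>\<^sub>M lborel)"
    unfolding Complex_eq by measurable
  define J where "J = (\<integral>\<^sup>+z. ennreal (H z) \<partial>lborel)"
  have J1: "J = (\<integral>\<^sup>+y. \<integral>\<^sup>+x. ennreal (H (Complex x y)) \<partial>lborel \<partial>lborel)"
    unfolding J_def by (rule nn_integral_lborel_complex) measurable
  also have "\<dots> = (\<integral>\<^sup>+x. \<integral>\<^sup>+y. ennreal (H (Complex x y)) \<partial>lborel \<partial>lborel)"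
    by (rule lborel_pair.Fubini'[OF HC])
  finally have J2: "J = (\<integral>\<^sup>+x. \<integral>\<^sup>+y. ennreal (H (Complex x y)) \<partial>lborel \<partial>lborel)" .
  have m[measurable]: "(\<lambda>s. \<integral>\<^sup>+u. ennreal (H (Complex u s)) \<partial>lborel) \<in> borel_measurable borel"
      "(\<lambda>s. \<integral>\<^sup>+u. ennreal (H (Complex s u)) \<partial>lborel) \<in> borel_measurable borel"
    unfolding Complex_eq by measurable
  have m': "(\<lambda>s. \<integral>\<^sup>+u. ennreal (H (Complex u (-s))) \<partial>lborel) \<in> borel_measurable borel"
      "(\<lambda>s. \<integral>\<^sup>+u. ennreal (H (Complex (-s) u)) \<partial>lborel) \<in> borel_measurable borel"
    unfolding Complex_eq by measurable
  have J3: "(\<integral>\<^sup>+s. \<integral>\<^sup>+x. ennreal (H (Complex x (-s))) \<partial>lborel \<partial>lborel) = J"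
    unfolding J1 by (subst (2) nn_integral_real_affine[where c="-1" and t=0]) auto
  have J4: "(\<integral>\<^sup>+s. \<integral>\<^sup>+x. ennreal (H (Complex (-s) x)) \<partial>lborel \<partial>lborel) = J"
    unfolding J2 by (subst (2) nn_integral_real_affine[where c="-1" and t=0]) auto
  have "ennreal (4 * cmod (g 0)) = (\<integral>\<^sup>+s. ennreal (4 * cmod (g 0)) * indicator {1..2::real} s \<partial>lborel)"
    by (simp add: nn_integral_cmult_indicator)
  \<comment> \<open>Extending s from {1..2} to the whole line lets each side sweep the entire plane,
    so that each of the four terms of \<open>V\<close> integrates to \<open>J\<close>.\<close>
  also have "\<dots> \<le> (\<integral>\<^sup>+s. V s \<partial>lborel)"
    using V by (intro nn_integral_mono) (auto simp: indicator_def)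
  also have "\<dots> = J + J + J + J"
    unfolding V_def using m m' by (simp add: nn_integral_add J3 J4 flip: J1 J2)
  also have "\<dots> = (1 + 1 + 1 + 1) * J" by (simp only: distrib_right mult_1)
  also have "\<dots> = 4 * J" by simp
  finally have "4 * ennreal (cmod (g 0)) \<le> 4 * J" by (simp add: ennreal_mult)
  then show ?thesis unfolding J_def H_def
    by (subst (asm) ennreal_mult_le_mult_iff) auto
qed

subsection \<open>Weighted Bergman spaces\<close>

text \<open>A density on the whole plane that vanishes off the half-plane keeps the Borel
  sigma-algebra, so no restricted measure space enters the measurability proofs.\<close>

definition bergman_measure :: "real \<Rightarrow> complex measure" where
  "bergman_measure \<alpha> = density lborel (\<lambda>z. ennreal (indicator upper_half_plane z * Im z powr (\<alpha> - 1)))"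

text \<open>
  The \<open>p\<close>-th power of the Bergman norm; unlike \<^const>\<open>bergman_norm\<close> it is \<open>\<infinity>\<close> on functions outside
  the Bergman space.
\<close>

definition bergman_mass :: "real \<Rightarrow> real \<Rightarrow> (complex \<Rightarrow> complex) \<Rightarrow> ennreal" where
  "bergman_mass p \<alpha> f =
    (\<integral>\<^sup>+z. ennreal (indicator upper_half_plane z * (cmod (f z) powr p * Im z powr (\<alpha> - 1))) \<partial>lborel)"

text \<open>
  A function holomorphic on the half-plane may fail to be measurable outside of it, so it is cut off
  there before Fubini is applied.
\<close>

definition upper_part :: "(complex \<Rightarrow> complex) \<Rightarrow> complex \<Rightarrow> complex" where
  "upper_part f z = indicator upper_half_plane z *\<^sub>R f z"

lemma upper_part_eq [simp]: "z \<in> upper_half_plane \<Longrightarrow> upper_part f z = f z"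
  by (simp add: upper_part_def)

lemma mem_upper_half_plane: "z \<in> upper_half_plane \<longleftrightarrow> 0 < Im z"
  by (simp add: upper_half_plane_def)

lemma open_upper_half_plane [simp, intro]: "open upper_half_plane"
  unfolding upper_half_plane_def by (intro open_Collect_less continuous_intros)

lemma sets_upper_half_plane [measurable, simp]: "upper_half_plane \<in> sets borel"
  by simp

lemma borel_measurable_upper_part:
  assumes "f holomorphic_on upper_half_plane"
  shows "upper_part f \<in> borel_measurable borel"
  unfolding upper_part_def[abs_def]
  by (intro borel_measurable_continuous_on_indicator holomorphic_on_imp_continuous_on assms) simp

lemma bergman_mass_cong:
  assumes "\<And>z. z \<in> upper_half_plane \<Longrightarrow> f z = g z"
  shows "bergman_mass p \<alpha> f = bergman_mass p \<alpha> g"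
  unfolding bergman_mass_def by (intro nn_integral_cong) (auto simp: indicator_def assms)

lemma borel_measurable_bergman_integrand:
  assumes "f holomorphic_on upper_half_plane"
  shows "(\<lambda>z. indicator upper_half_plane z * (cmod (f z) powr p * Im z powr (\<alpha> - 1)))
    \<in> borel_measurable borel"
proof -
  note [measurable] = borel_measurable_upper_part[OF assms]
  have "(\<lambda>z. indicator upper_half_plane z * (cmod (upper_part f z) powr p * Im z powr (\<alpha> - 1)))
    \<in> borel_measurable borel" by measurable
  also have "(\<lambda>z. indicator upper_half_plane z * (cmod (upper_part f z) powr p * Im z powr (\<alpha> - 1)))
    = (\<lambda>z. indicator upper_half_plane z * (cmod (f z) powr p * Im z powr (\<alpha> - 1)))"
    by (auto simp: indicator_def fun_eq_iff)
  finally show ?thesis .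
qed

lemma sigma_finite_bergman_measure: "sigma_finite_measure (bergman_measure \<alpha>)"
  unfolding bergman_measure_def by (subst sigma_finite_measure.sigma_finite_iff_density_finite[OF sigma_finite_lborel]) auto

lemma sets_bergman_measure [measurable_cong, simp]: "sets (bergman_measure \<alpha>) = sets borel"
  by (simp add: bergman_measure_def)

lemma nn_integral_bergman_measure:
  assumes [measurable]: "f \<in> borel_measurable borel"
  shows "(\<integral>\<^sup>+z. ennreal (cmod (f z) powr p) \<partial>bergman_measure \<alpha>) = bergman_mass p \<alpha> f"
  unfolding bergman_mass_def bergman_measure_def
  by (subst nn_integral_density) (auto intro!: nn_integral_cong simp: indicator_def mult.commute simp flip: ennreal_mult')

lemma bergman_space_iff:
  "f \<in> bergman_space p \<alpha> \<longleftrightarrow> f holomorphic_on upper_half_plane \<and> bergman_mass p \<alpha> f < \<infinity>"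
proof (cases "f holomorphic_on upper_half_plane")
  case True
  have "set_integrable lborel upper_half_plane (\<lambda>z. cmod (f z) powr p * Im z powr (\<alpha> - 1))
      \<longleftrightarrow> bergman_mass p \<alpha> f < \<infinity>"
    unfolding set_integrable_def bergman_mass_def
    using borel_measurable_bergman_integrand[OF True, of p \<alpha>]
    by (subst integrable_iff_bounded) simp
  then show ?thesis using True by (simp add: bergman_space_def)
qed (simp add: bergman_space_def)

lemma bergman_norm_nonneg [simp]: "0 \<le> bergman_norm p \<alpha> f"
  by (simp add: bergman_norm_def)

lemma bergman_mass_eq_norm:
  assumes "f \<in> bergman_space p \<alpha>" "0 < p"
  shows "bergman_mass p \<alpha> f = ennreal (bergman_norm p \<alpha> f powr p)"
proof -
  let ?I = "LINT z:upper_half_plane|lborel. cmod (f z) powr p * Im z powr (\<alpha> - 1)"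
  have "bergman_mass p \<alpha> f = ennreal ?I"
    using assms(1) unfolding bergman_mass_def bergman_space_def set_lebesgue_integral_def set_integrable_def
    by (subst nn_integral_eq_integral) auto
  moreover have "?I \<ge> 0"
    by (simp add: set_lebesgue_integral_def)
  ultimately show ?thesis
    using assms(2) by (simp add: bergman_norm_def powr_powr)
qed

lemma nn_integral_lborel_affine:
  fixes f :: "'a::euclidean_space \<Rightarrow> ennreal"
  assumes [measurable]: "f \<in> borel_measurable borel" and c: "c \<noteq> 0"
  shows "(\<integral>\<^sup>+x. f x \<partial>lborel) = ennreal (\<bar>c\<bar> ^ DIM('a)) * (\<integral>\<^sup>+x. f (t + c *\<^sub>R x) \<partial>lborel)"
  by (subst lborel_affine[OF c, of t])
     (simp add: nn_integral_density nn_integral_distr nn_integral_cmult ennreal_power)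

text \<open>The area element contributes y^2 and the weight y^(\<alpha>-1). With y = Im z this
  carries estimates from \<i> to z; with x = 0 and y = 1 / t it shows that the normalised dilations
  are isometries.\<close>

lemma bergman_mass_affine:
  assumes hol: "f holomorphic_on upper_half_plane" and y: "0 < y"
  shows "bergman_mass p \<alpha> f =
    ennreal (y powr (1 + \<alpha>)) * bergman_mass p \<alpha> (\<lambda>w. f (of_real x + of_real y * w))"
proof -
  define h where "h = (\<lambda>z. indicator upper_half_plane z * (cmod (f z) powr p * Im z powr (\<alpha> - 1)))"
  let ?g = "\<lambda>w. f (of_real x + of_real y * w)"
  let ?k = "\<lambda>z. indicator upper_half_plane z * (cmod (?g z) powr p * Im z powr (\<alpha> - 1))"
  have [measurable]: "h \<in> borel_measurable borel"
    unfolding h_def by (rule borel_measurable_bergman_integrand[OF hol])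
  have "?g holomorphic_on upper_half_plane"
    using y by (intro holomorphic_on_compose_gen[OF _ hol, unfolded o_def] holomorphic_intros)
      (auto simp: mem_upper_half_plane)
  then have km: "?k \<in> borel_measurable borel"
    by (rule borel_measurable_bergman_integrand)
  have eq: "h (of_real x + y *\<^sub>R w) = y powr (\<alpha> - 1) * ?k w" for w
    using y by (auto simp: h_def indicator_def mem_upper_half_plane powr_mult scaleR_conv_of_real
        zero_less_mult_iff)
  have mass: "bergman_mass p \<alpha> f = (\<integral>\<^sup>+z. ennreal (h z) \<partial>lborel)"
    by (simp add: bergman_mass_def h_def)
  have "bergman_mass p \<alpha> f = ennreal (y\<^sup>2) * (\<integral>\<^sup>+w. ennreal (h (of_real x + y *\<^sub>R w)) \<partial>lborel)"
    unfolding mass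
    using y by (subst nn_integral_lborel_affine[where c=y and t="of_real x"]) auto
  also have "(\<integral>\<^sup>+w. ennreal (h (of_real x + y *\<^sub>R w)) \<partial>lborel)
      = ennreal (y powr (\<alpha> - 1)) * bergman_mass p \<alpha> ?g"
    unfolding eq bergman_mass_def using measurable_compose[OF km measurable_ennreal]
    by (simp add: ennreal_mult'[of "y powr (\<alpha> - 1)"] nn_integral_cmult)
  also have "ennreal (y\<^sup>2) * (ennreal (y powr (\<alpha> - 1)) * bergman_mass p \<alpha> ?g)
      = ennreal (y\<^sup>2 * y powr (\<alpha> - 1)) * bergman_mass p \<alpha> ?g"
    by (simp add: ennreal_mult' mult.assoc)
  also have "y\<^sup>2 * y powr (\<alpha> - 1) = y powr (1 + \<alpha>)"
    using y by (simp add: powr_add powr_diff power2_eq_square)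
  finally show ?thesis .
qed

section \<open>Scaling and a weighted triangle inequality for the mass\<close>

lemma bergman_mass_cmult:
  assumes "f holomorphic_on upper_half_plane"
  shows "bergman_mass p \<alpha> (\<lambda>z. c * f z) = ennreal (cmod c powr p) * bergman_mass p \<alpha> f"
  unfolding bergman_mass_def
  using borel_measurable_bergman_integrand[OF assms, of p \<alpha>]
  by (subst nn_integral_cmult[symmetric])
     (auto simp: norm_mult powr_mult mult_ac simp flip: ennreal_mult' intro!: nn_integral_cong)

text \<open>Convexity of the p-th power: s = x + y is the mean of x / l and y / (1 - l) with weights
  l and 1 - l. The tangent inequality at s is applied to both points and averaged.\<close>

lemma powr_add_le_weighted:
  fixes x y l p :: real
  assumes "1 \<le> p" "0 \<le> x" "0 \<le> y" "0 < l" "l < 1"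
  shows "(x + y) powr p \<le> l powr (1 - p) * x powr p + (1 - l) powr (1 - p) * y powr p"
proof (cases "x + y = 0")
  case True
  then show ?thesis using assms by simp
next
  case False
  define s where "s = x + y"
  have s: "s > 0" using False assms by (simp add: s_def)
  define A B where "A = p * s powr (p - 1)" and "B = (p - 1) * s powr p"
  have h: "A * (x / l) \<le> (x / l) powr p + B" "A * (y / (1 - l)) \<le> (y / (1 - l)) powr p + B"
    using assms s powr_tangent_le[of p "x / l" s] powr_tangent_le[of p "y / (1 - l)" s]
    by (auto simp: A_def B_def)
  have "A * x \<le> l * (x / l) powr p + l * B"
    using mult_left_mono[OF h(1), of l] assms by (simp add: distrib_left)
  moreover have "A * y \<le> (1 - l) * (y / (1 - l)) powr p + (1 - l) * B"
    using mult_left_mono[OF h(2), of "1 - l"] assms by (simp add: distrib_left)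
  ultimately have "A * (x + y) \<le> l * (x / l) powr p + (1 - l) * (y / (1 - l)) powr p + B"
    by (simp add: algebra_simps)
  then have "p * (s powr (p - 1) * (x + y)) \<le> l * (x / l) powr p + (1 - l) * (y / (1 - l)) powr p
      + (p - 1) * s powr p"
    by (simp add: A_def B_def mult.assoc)
  moreover have "s powr (p - 1) * (x + y) = s powr p"
    using powr_mult_base[of s "p - 1"] s by (simp add: s_def mult.commute)
  ultimately have *: "s powr p \<le> l * (x / l) powr p + (1 - l) * (y / (1 - l)) powr p"
    by (simp add: left_diff_distrib)
  have **: "l * (x / l) powr p = l powr (1 - p) * x powr p"
      "(1 - l) * (y / (1 - l)) powr p = (1 - l) powr (1 - p) * y powr p"
    using assms by (auto simp: powr_divide powr_diff)
  show ?thesis using * unfolding ** s_def .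
qed

text \<open>The value l = 1/2 serves for crude bounds; letting l tend to 1 leaves the first term
  with coefficient 1, which the sharp lower bound for the operator norm requires.\<close>

lemma bergman_mass_add_le:
  assumes p: "1 \<le> p" and l: "0 < l" "l < 1"
    and f: "f holomorphic_on upper_half_plane" and g: "g holomorphic_on upper_half_plane"
  shows "bergman_mass p \<alpha> (\<lambda>z. f z + g z)
    \<le> ennreal (l powr (1 - p)) * bergman_mass p \<alpha> f + ennreal ((1 - l) powr (1 - p)) * bergman_mass p \<alpha> g"
proof -
  let ?h = "\<lambda>f z. indicator upper_half_plane z * (cmod (f z) powr p * Im z powr (\<alpha> - 1))"
  note [measurable] = borel_measurable_bergman_integrand[OF f] borel_measurable_bergman_integrand[OF g]
  have "bergman_mass p \<alpha> (\<lambda>z. f z + g z)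
    \<le> (\<integral>\<^sup>+z. ennreal (l powr (1 - p)) * ennreal (?h f z) + ennreal ((1 - l) powr (1 - p)) * ennreal (?h g z) \<partial>lborel)"
    unfolding bergman_mass_def
  proof (rule nn_integral_mono)
    fix z :: complex
    have "cmod (f z + g z) powr p \<le> (cmod (f z) + cmod (g z)) powr p"
      using p by (intro powr_mono2 norm_triangle_ineq) auto
    also have "\<dots> \<le> l powr (1 - p) * cmod (f z) powr p + (1 - l) powr (1 - p) * cmod (g z) powr p"
      using p l by (intro powr_add_le_weighted) auto
    finally have "cmod (f z + g z) powr p \<le> l powr (1 - p) * cmod (f z) powr p + (1 - l) powr (1 - p) * cmod (g z) powr p" .
    note * = this
    have "?h (\<lambda>z. f z + g z) z \<le> l powr (1 - p) * ?h f z + (1 - l) powr (1 - p) * ?h g z"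
      using mult_right_mono[OF *, of "indicator upper_half_plane z * Im z powr (\<alpha> - 1)"]
      by (simp add: algebra_simps)
    then show "ennreal (?h (\<lambda>z. f z + g z) z)
      \<le> ennreal (l powr (1 - p)) * ennreal (?h f z) + ennreal ((1 - l) powr (1 - p)) * ennreal (?h g z)"
      by (simp flip: ennreal_mult ennreal_plus add: ennreal_leI)
  qed
  also have "\<dots> = ennreal (l powr (1 - p)) * bergman_mass p \<alpha> f + ennreal ((1 - l) powr (1 - p)) * bergman_mass p \<alpha> g"
    unfolding bergman_mass_def by (subst nn_integral_add) (auto simp: nn_integral_cmult)
  finally show ?thesis .
qed

text \<open>\<open>holomorphic_bound_square_integral\<close> on a small square around \<i>, Jensen
  to pass to the p-th power, and a positive lower bound of the weight on that square.\<close>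

lemma bergman_point_bound_i:
  assumes p: "1 \<le> p"
  obtains C where "0 < C"
    "\<And>f. f holomorphic_on upper_half_plane \<Longrightarrow> ennreal (cmod (f \<i>) powr p) \<le> ennreal C * bergman_mass p \<alpha> f"
proof -
  \<comment> \<open>The weight is increasing or decreasing according to the sign of \<alpha> - 1, so
    its minimum over heights in [1/2, 3/2] is attained at one of the endpoints.\<close>
  define c where "c = min ((1/2) powr (\<alpha> - 1)) ((3/2) powr (\<alpha> - 1) :: real)"
  have c: "c > 0" by (simp add: c_def)
  have cle: "c \<le> v powr (\<alpha> - 1)" if "v \<in> {1/2..3/2}" for v :: real
  proof (cases "\<alpha> \<ge> 1")
    case True
    then have "(1/2) powr (\<alpha> - 1) \<le> v powr (\<alpha> - 1)" using that by (intro powr_mono2) auto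
    then show ?thesis by (simp add: c_def)
  next
    case False
    then have "(3/2) powr (\<alpha> - 1) \<le> v powr (\<alpha> - 1)" using that by (intro powr_mono2') auto
    then show ?thesis by (simp add: c_def)
  qed
  define Q where "Q = cbox (Complex (-2) (-2)) (Complex 2 2)"
  have emQ: "emeasure lborel Q = 16"
    unfolding Q_def by (subst emeasure_lborel_cbox_eq) (auto simp: Basis_complex_def inner_complex_def)
  \<comment> \<open>\<open>Q\<close> has area 16, which gives 16^(p-1) in Jensen's inequality.
    Shrunk by 1/4 and moved to \<i> it keeps heights in [1/2, 3/2]; this scaling has Jacobian 1/16,
    whence the other factor 16, and 1 / c removes the weight.\<close>
  have main: "ennreal (cmod (f \<i>) powr p) \<le> ennreal (16 powr (p - 1) * (16 / c)) * bergman_mass p \<alpha> f"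
    if hol: "f holomorphic_on upper_half_plane" for f
  proof -
    define g where "g = (\<lambda>w. f (\<i> + (1/4) *\<^sub>R w))"
    have ran: "\<i> + (1/4) *\<^sub>R w \<in> upper_half_plane" "Im (\<i> + (1/4) *\<^sub>R w) \<in> {1/2..3/2}" if "w \<in> Q" for w
      using that by (auto simp: Q_def mem_upper_half_plane in_cbox_complex_iff)
    have holg: "g holomorphic_on Q"
      unfolding g_def scaleR_conv_of_real
      by (intro holomorphic_on_compose_gen[OF _ hol, unfolded o_def] holomorphic_intros)
         (use ran in \<open>auto simp: scaleR_conv_of_real\<close>)
    have contg: "continuous_on Q g" using holg by (rule holomorphic_on_imp_continuous_on)
    define G where "G = (\<lambda>z. indicator Q z * cmod (g z))"
    have [measurable]: "G \<in> borel_measurable borel"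
      using borel_measurable_continuous_on_indicator[of Q "\<lambda>z. cmod (g z)"]
        continuous_on_norm[OF contg] by (simp add: G_def Q_def)
    have G0: "0 \<le> G z" for z by (simp add: G_def)
    have intG: "integrable lborel G"
      using borel_integrable_compact[of Q "\<lambda>z. cmod (g z)"] continuous_on_norm[OF contg]
      by (simp add: G_def Q_def if_distrib indicator_def mult_ac)
    have intQ: "integrable lborel (indicator Q :: complex \<Rightarrow> real)"
      using emQ by (intro integrable_real_indicator) (auto simp: Q_def)
    have LQ: "(\<integral>z. indicator Q z \<partial>lborel) = (16::real)"
      using emQ by (simp add: measure_def)
    have "ennreal (cmod (g 0)) \<le> (\<integral>\<^sup>+z. ennreal (G z) \<partial>lborel)"
      using holomorphic_bound_square_integral[of g] holg by (simp add: G_def Q_def)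
    also have "\<dots> = ennreal (\<integral>z. G z \<partial>lborel)"
      using intG by (intro nn_integral_eq_integral) (auto simp: G_def)
    finally have "cmod (g 0) \<le> (\<integral>z. G z \<partial>lborel)"
      by (subst (asm) ennreal_le_iff) (auto simp: G_def)
    also have "(\<integral>z. G z \<partial>lborel) = (\<integral>z. G z * indicator Q z \<partial>lborel)"
      by (intro Bochner_Integration.integral_cong) (auto simp: G_def indicator_def)
    finally have "ennreal (cmod (f \<i>) powr p) \<le> ennreal ((\<integral>z. G z * indicator Q z \<partial>lborel) powr p)"
      using p by (intro ennreal_leI powr_mono2) (auto simp: g_def)
    also have "\<dots> \<le> ennreal (16 powr (p - 1)) * (\<integral>\<^sup>+z. ennreal (G z powr p * indicator Q z) \<partial>lborel)"
      using ennreal_jensen_powr[OF p _ intQ, of G, unfolded LQ] by (simp add: G0)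
    also have "\<dots> \<le> ennreal (16 powr (p - 1)) * (ennreal (16 / c) * bergman_mass p \<alpha> f)"
    proof (rule mult_left_mono)
      show "(\<integral>\<^sup>+z. ennreal (G z powr p * indicator Q z) \<partial>lborel) \<le> ennreal (16 / c) * bergman_mass p \<alpha> f"
    proof -
      define h where "h = (\<lambda>z. indicator upper_half_plane z * (cmod (f z) powr p * Im z powr (\<alpha> - 1)))"
      have [measurable]: "h \<in> borel_measurable borel"
        unfolding h_def by (rule borel_measurable_bergman_integrand[OF hol])
      have "(\<integral>\<^sup>+z. ennreal (G z powr p * indicator Q z) \<partial>lborel)
          \<le> (\<integral>\<^sup>+z. ennreal (1 / c) * ennreal (h (\<i> + (1/4) *\<^sub>R z)) \<partial>lborel)"
      proof (rule nn_integral_mono)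
        fix w :: complex
        have "G w powr p * indicator Q w \<le> 1 / c * h (\<i> + (1/4) *\<^sub>R w)"
        proof (cases "w \<in> Q")
          case True
          have "cmod (f (\<i> + (1/4) *\<^sub>R w)) powr p * c
              \<le> cmod (f (\<i> + (1/4) *\<^sub>R w)) powr p * Im (\<i> + (1/4) *\<^sub>R w) powr (\<alpha> - 1)"
            by (intro mult_left_mono cle ran True) auto
          then show ?thesis using True c ran(1)[OF True]
            by (simp add: G_def g_def h_def field_simps)
        next
          case False
          then show ?thesis using c by (auto simp: h_def)
        qed
        then show "ennreal (G w powr p * indicator Q w) \<le> ennreal (1 / c) * ennreal (h (\<i> + (1/4) *\<^sub>R w))"
          using c by (subst ennreal_mult'[symmetric]) (auto intro!: ennreal_leI)
      qed
      also have "\<dots> = ennreal (1 / c) * (\<integral>\<^sup>+z. ennreal (h (\<i> + (1/4) *\<^sub>R z)) \<partial>lborel)"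
        by (rule nn_integral_cmult) measurable
      also have "(\<integral>\<^sup>+z. ennreal (h (\<i> + (1/4) *\<^sub>R z)) \<partial>lborel)
          = ennreal 16 * (ennreal (1/16) * (\<integral>\<^sup>+z. ennreal (h (\<i> + (1/4) *\<^sub>R z)) \<partial>lborel))"
        by (subst mult.assoc[symmetric], subst ennreal_mult[symmetric]) auto
      also have "ennreal (1/16) * (\<integral>\<^sup>+z. ennreal (h (\<i> + (1/4) *\<^sub>R z)) \<partial>lborel) = (\<integral>\<^sup>+z. ennreal (h z) \<partial>lborel)"
        by (subst (2) nn_integral_lborel_affine[where c="1/4" and t="\<i>"]) (auto simp: power2_eq_square)
      also have "\<dots> = bergman_mass p \<alpha> f" by (simp add: bergman_mass_def h_def)
      finally have "(\<integral>\<^sup>+z. ennreal (G z powr p * indicator Q z) \<partial>lborel)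
          \<le> ennreal (1 / c) * ennreal 16 * bergman_mass p \<alpha> f"
        by (simp only: mult.assoc)
      also have "ennreal (1 / c) * ennreal 16 = ennreal (16 / c)"
        using c by (subst ennreal_mult[symmetric]) auto
      finally show ?thesis .
    qed
    qed simp
    finally show ?thesis
      by (subst ennreal_mult', simp, simp only: mult.assoc)
  qed
  show thesis by (rule that[OF _ main]) (use c in auto)
qed

text \<open>The map taking w to Re z + Im z * w preserves the half-plane and sends \<i> to z.
  \<open>bergman_mass_affine\<close> then yields the power of Im z after a p-th root.\<close>

lemma bergman_point_bound:
  assumes p: "1 \<le> p"
  obtains C where "0 < C"
    "\<And>f z. f \<in> bergman_space p \<alpha> \<Longrightarrow> z \<in> upper_half_plane \<Longrightarrow>
      cmod (f z) \<le> C * Im z powr (- ((1 + \<alpha>) / p)) * bergman_norm p \<alpha> f"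
proof -
  obtain C where C: "0 < C" and bd: "\<And>f. f holomorphic_on upper_half_plane \<Longrightarrow>
      ennreal (cmod (f \<i>) powr p) \<le> ennreal C * bergman_mass p \<alpha> f"
    using bergman_point_bound_i[OF p] by blast
  have "cmod (f z) \<le> C powr (1/p) * Im z powr (- ((1 + \<alpha>) / p)) * bergman_norm p \<alpha> f"
    if f: "f \<in> bergman_space p \<alpha>" and z: "z \<in> upper_half_plane" for f z
  proof -
    let ?y = "Im z" and ?N = "bergman_norm p \<alpha> f"
    let ?g = "\<lambda>w. f (of_real (Re z) + of_real ?y * w)"
    have y: "?y > 0" using z by (simp add: mem_upper_half_plane)
    have hol: "f holomorphic_on upper_half_plane" using f by (simp add: bergman_space_iff)
    have "?g holomorphic_on upper_half_plane"
      using y by (intro holomorphic_on_compose_gen[OF _ hol, unfolded o_def] holomorphic_intros)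
        (auto simp: mem_upper_half_plane)
    from bd[OF this] have "ennreal (cmod (f z) powr p) \<le> ennreal C * bergman_mass p \<alpha> ?g"
      by (simp add: complex_eq[symmetric] mult.commute)
    also have "bergman_mass p \<alpha> ?g = ennreal (?y powr (- (1 + \<alpha>))) * bergman_mass p \<alpha> f"
      by (subst bergman_mass_affine[OF hol y, where x = "Re z"], subst mult.assoc[symmetric],
          subst ennreal_mult[symmetric]) (use y in \<open>auto simp flip: powr_add\<close>)
    also have "bergman_mass p \<alpha> f = ennreal (?N powr p)"
      using f p by (intro bergman_mass_eq_norm) auto
    finally have "ennreal (cmod (f z) powr p) \<le> ennreal (C * (?y powr (- (1 + \<alpha>)) * ?N powr p))"
      using C by (simp add: ennreal_mult)
    then have "cmod (f z) powr p \<le> C * (?y powr (- (1 + \<alpha>)) * ?N powr p)"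
      using C by (subst (asm) ennreal_le_iff) auto
    then have "(cmod (f z) powr p) powr (1/p) \<le> (C * (?y powr (- (1 + \<alpha>)) * ?N powr p)) powr (1/p)"
      using p by (intro powr_mono2) auto
    also have "(cmod (f z) powr p) powr (1/p) = cmod (f z)"
      using p by (simp add: powr_powr)
    also have "(C * (?y powr (- (1 + \<alpha>)) * ?N powr p)) powr (1/p)
        = C powr (1/p) * ?y powr (- ((1 + \<alpha>) / p)) * ?N"
      using p C by (simp add: powr_mult powr_powr minus_divide_left)
    finally show ?thesis .
  qed
  then show thesis using C by (intro that[of "C powr (1/p)"]) auto
qed

subsection \<open>Holomorphic dependence of Lebesgue integrals\<close>

text \<open>Local domination of g itself suffices: Cauchy's inequality turns it into a bound 3 h / r
  for the z-derivative on the half-size ball, hence for the difference quotients, and dominated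
  convergence applies to these.\<close>

lemma holomorphic_on_lebesgue_integral:
  fixes g :: "complex \<Rightarrow> 'b \<Rightarrow> complex"
  assumes S: "open S"
    and hol: "\<And>t. t \<in> space M \<Longrightarrow> (\<lambda>z. g z t) holomorphic_on S"
    and meas: "\<And>z. z \<in> S \<Longrightarrow> g z \<in> borel_measurable M"
    and dom: "\<And>z. z \<in> S \<Longrightarrow> \<exists>r>0. \<exists>h. ball z r \<subseteq> S \<and> integrable M h \<and>
      (\<forall>w\<in>ball z r. \<forall>t\<in>space M. cmod (g w t) \<le> h t)"
  shows "(\<lambda>z. \<integral>t. g z t \<partial>M) holomorphic_on S"
proof -
  let ?F = "\<lambda>z. \<integral>t. g z t \<partial>M"
  have "\<exists>D. (?F has_field_derivative D) (at z0)" if z0: "z0 \<in> S" for z0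
  proof -
    obtain r h where r: "r > 0" "ball z0 r \<subseteq> S" and h: "integrable M h"
      and le: "\<And>w t. w \<in> ball z0 r \<Longrightarrow> t \<in> space M \<Longrightarrow> cmod (g w t) \<le> h t"
      using dom[OF z0] by blast
    have int: "integrable M (g w)" if "w \<in> ball z0 r" for w
    proof (rule Bochner_Integration.integrable_bound[OF h])
      show "g w \<in> borel_measurable M" using that r by (intro meas) auto
      show "AE t in M. norm (g w t) \<le> norm (h t)"
        using le[OF that] by (intro AE_I2) (metis abs_ge_self order_trans real_norm_def)
    qed
    define d where "d = (\<lambda>t. deriv (\<lambda>z. g z t) z0)"
    have der: "((\<lambda>z. g z t) has_field_derivative deriv (\<lambda>z. g z t) w) (at w)"
      if "t \<in> space M" "w \<in> S" for t w
      using holomorphic_derivI[OF hol[OF that(1)] S that(2)] .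
    have dbd: "cmod (deriv (\<lambda>z. g z t) w) \<le> h t / (r/3)" if t: "t \<in> space M" and w: "w \<in> ball z0 (r/2)" for t w
    proof -
      \<comment> \<open>A Cauchy disc of radius r/3 around a point of the half-size ball stays
        inside the large one, as r/2 + r/3 < r.\<close>
      have sub: "cball w (r/3) \<subseteq> ball z0 r"
      proof
        fix v assume "v \<in> cball w (r/3)"
        then show "v \<in> ball z0 r" using w dist_triangle[of z0 v w] r(1) unfolding mem_ball mem_cball by linarith
      qed
      have h1: "(\<lambda>z. g z t) holomorphic_on cball w (r/3)"
        by (rule holomorphic_on_subset[OF hol[OF t] subset_trans[OF sub r(2)]])
      have "cmod ((deriv ^^ 1) (\<lambda>z. g z t) w) \<le> fact 1 * h t / (r/3) ^ 1"
      proof (rule Cauchy_inequality)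
        show "(\<lambda>z. g z t) holomorphic_on ball w (r/3)"
          by (rule holomorphic_on_subset[OF h1 ball_subset_cball])
        show "continuous_on (cball w (r/3)) (\<lambda>z. g z t)"
          using h1 by (rule holomorphic_on_imp_continuous_on)
        show "cmod (g v t) \<le> h t" if "cmod (w - v) = r/3" for v
        proof (rule le[OF _ t])
          have "v \<in> cball w (r/3)" using that by (simp add: dist_norm)
          then show "v \<in> ball z0 r" using sub by (rule set_rev_mp)
        qed
        show "0 < r/3" using r(1) by simp
      qed
      then show ?thesis by simp
    qed
    have quot: "cmod ((g w t - g z0 t) / (w - z0)) \<le> h t / (r/3)"
      if t: "t \<in> space M" and w: "w \<in> ball z0 (r/2)" "w \<noteq> z0" for t w
    proof -
      have "cmod (g w t - g z0 t) \<le> h t / (r/3) * cmod (w - z0)"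
      proof (rule field_differentiable_bound[where S="ball z0 (r/2)" and f'="deriv (\<lambda>z. g z t)"])
        show "((\<lambda>z. g z t) has_field_derivative deriv (\<lambda>z. g z t) z) (at z within ball z0 (r/2))"
          if "z \<in> ball z0 (r/2)" for z
        proof (rule has_field_derivative_at_within[OF der[OF t]])
          have "z \<in> ball z0 r" using that r(1) by simp
          then show "z \<in> S" using r(2) by (rule set_rev_mp)
        qed
              show "cmod (deriv (\<lambda>z. g z t) z) \<le> h t / (r/3)" if "z \<in> ball z0 (r/2)" for z
          by (rule dbd[OF t that])
        show "convex (ball z0 (r/2))" by (rule convex_ball)
        show "w \<in> ball z0 (r/2)" by (rule w(1))
        show "z0 \<in> ball z0 (r/2)" using r(1) by simp
      qed
      then show ?thesis using w by (simp add: norm_divide pos_divide_le_eq)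
    qed
    have "((\<lambda>w. (?F w - ?F z0) / (w - z0)) \<longlongrightarrow> (\<integral>t. d t \<partial>M)) (at z0)"
      unfolding tendsto_at_iff_sequentially
    proof (intro allI impI)
      fix X :: "nat \<Rightarrow> complex"
      assume X: "\<forall>i. X i \<in> UNIV - {z0}" "X \<longlonglongrightarrow> z0"
      have "eventually (\<lambda>i. X i \<in> ball z0 (r/2)) sequentially"
        using tendstoD[OF X(2), of "r/2"] r(1) by (simp add: dist_commute)
      then obtain N where N: "\<And>i. i \<ge> N \<Longrightarrow> X i \<in> ball z0 (r/2)"
        by (auto simp: eventually_sequentially)
      \<comment> \<open>Dropping the first N terms puts the whole sequence into the ball where the
        majorant holds.\<close>
      define Y where "Y = (\<lambda>i. X (i + N))"
      have Y1: "Y i \<in> ball z0 (r/2)" and Y3: "Y i \<noteq> z0" for i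
        using N[of "i + N"] X(1) by (simp_all add: Y_def)
      have Y2: "Y i \<in> ball z0 r" for i using Y1[of i] r(1) by simp
      have z0r: "z0 \<in> ball z0 r" using r(1) by simp
      have Yl: "Y \<longlonglongrightarrow> z0" unfolding Y_def using X(2) by (rule LIMSEQ_ignore_initial_segment)
      let ?q = "\<lambda>i t. (g (Y i) t - g z0 t) / (Y i - z0)"
      have qm: "?q i \<in> borel_measurable M" for i
        using int[OF Y2] int[OF z0r] by (intro borel_measurable_divide borel_measurable_diff) auto
      have ql: "(\<lambda>i. ?q i t) \<longlonglongrightarrow> d t" if t: "t \<in> space M" for t
      proof -
        have "((\<lambda>w. (g w t - g z0 t) / (w - z0)) \<longlongrightarrow> d t) (at z0)"
          using der[OF t z0] by (simp only: d_def has_field_derivative_iff)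
        moreover have "filterlim Y (at z0) sequentially"
          using Y3 by (intro filterlim_atI[OF Yl]) simp
        ultimately show ?thesis by (rule filterlim_compose)
      qed
      \<comment> \<open>The derivative is measurable in t as a pointwise limit of the quotients
        along \<open>Y\<close>.\<close>
      have dm: "d \<in> borel_measurable M"
        by (rule borel_measurable_LIMSEQ_metric[OF qm ql])
      have "(\<lambda>i. \<integral>t. ?q i t \<partial>M) \<longlonglongrightarrow> (\<integral>t. d t \<partial>M)"
        by (rule integral_dominated_convergence[OF dm qm, where w="\<lambda>t. h t / (r/3)"])
           (use h quot[OF _ Y1 Y3] ql in \<open>auto intro!: AE_I2\<close>)
      moreover have eq: "(\<integral>t. ?q i t \<partial>M) = (?F (Y i) - ?F z0) / (Y i - z0)" for i
        using int[OF Y2] int[OF z0r] by simp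
      ultimately have "(\<lambda>i. (?F (Y i) - ?F z0) / (Y i - z0)) \<longlonglongrightarrow> (\<integral>t. d t \<partial>M)"
        by (simp only: eq)
      then have "(\<lambda>i. (?F (X i) - ?F z0) / (X i - z0)) \<longlonglongrightarrow> (\<integral>t. d t \<partial>M)"
        unfolding Y_def by (rule LIMSEQ_offset)
      then show "((\<lambda>w. (?F w - ?F z0) / (w - z0)) \<circ> X) \<longlonglongrightarrow> (\<integral>t. d t \<partial>M)"
        by (simp add: o_def)
    qed
    then have "(?F has_field_derivative (\<integral>t. d t \<partial>M)) (at z0)"
      by (simp only: has_field_derivative_iff)
    then show ?thesis ..
  qed
  then show ?thesis
    unfolding holomorphic_on_open[OF S] by blast
qed

subsection \<open>The Hausdorff operator as an average of isometries\<close>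

text \<open>
  With \<open>b = (1 + \<alpha>) / p\<close> the operator is an average, with density \<open>t powr (b - 1) * \<phi> t\<close>, of the dilations
  \<open>f \<mapsto> t powr (- b) * f (z / t)\<close>, which are isometries of the Bergman space.
\<close>

definition hausdorff_density :: "real \<Rightarrow> (real \<Rightarrow> complex) \<Rightarrow> real \<Rightarrow> complex" where
  "hausdorff_density b \<phi> t = indicator {0<..} t *\<^sub>R (of_real (t powr (b - 1)) * \<phi> t)"

definition dilate :: "real \<Rightarrow> real \<Rightarrow> (complex \<Rightarrow> complex) \<Rightarrow> complex \<Rightarrow> complex" where
  "dilate b t f z = of_real (t powr (- b)) * f (z / of_real t)"

lemma divide_of_real_upper_half_plane:
  "z \<in> upper_half_plane \<Longrightarrow> 0 < t \<Longrightarrow> z / of_real t \<in> upper_half_plane"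
  by (simp add: mem_upper_half_plane)

text \<open>The powers t^(-b) and t^(b-1) multiply to 1 / t. For t \<le> 0 both sides vanish, and
  for t > 0 the point z / t lies in the half-plane, where \<open>upper_part\<close> changes
  nothing.\<close>

lemma hausdorff_integrand_eq:
  assumes "z \<in> upper_half_plane"
  shows "indicator {0<..} t *\<^sub>R (f (z / of_real t) * (\<phi> t / of_real t))
    = dilate b t (upper_part f) z * hausdorff_density b \<phi> t"
proof (cases "t > 0")
  case True
  have "t powr (- b) * t powr (b - 1) = t powr (- b + (b - 1))"
    by (simp only: powr_add)
  also have "\<dots> = 1 / t" using True by (simp add: powr_minus_divide)
  finally have "t powr (- b) * t powr (b - 1) = 1 / t" .
  then have "complex_of_real (t powr (- b)) * of_real (t powr (b - 1)) = 1 / of_real t"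
    by (metis of_real_1 of_real_divide of_real_mult)
  then show ?thesis
    using True divide_of_real_upper_half_plane[OF assms True]
    by (simp add: dilate_def hausdorff_density_def field_simps)
qed (simp add: hausdorff_density_def)

lemma hausdorff_op_eq:
  assumes "z \<in> upper_half_plane"
  shows "hausdorff_op \<phi> f z
    = (\<integral>t. dilate b t (upper_part f) z * hausdorff_density b \<phi> t \<partial>lebesgue)"
  unfolding hausdorff_op_def set_lebesgue_integral_def
  by (simp only: hausdorff_integrand_eq[OF assms, of _ f \<phi> b])

lemma hausdorff_well_defined_iff:
  "hausdorff_well_defined \<phi> f \<longleftrightarrow> (\<forall>z\<in>upper_half_plane.
    integrable lebesgue (\<lambda>t. dilate b t (upper_part f) z * hausdorff_density b \<phi> t))"
  unfolding hausdorff_well_defined_def set_integrable_def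
  by (intro ball_cong refl) (simp only: hausdorff_integrand_eq[of _ _ f \<phi> b])

lemma borel_measurable_hausdorff_density:
  assumes "\<phi> \<in> borel_measurable (lebesgue_on {0<..})"
  shows "hausdorff_density b \<phi> \<in> borel_measurable lebesgue"
proof -
  have "(\<lambda>t. indicator {0<..} t *\<^sub>R \<phi> t) \<in> borel_measurable lebesgue"
    using assms by (simp add: borel_measurable_restrict_space_iff)
  moreover have "(\<lambda>t. complex_of_real (t powr (b - 1))) \<in> borel_measurable lebesgue"
    by (rule measurable_completion) measurable
  ultimately have "(\<lambda>t. of_real (t powr (b - 1)) * (indicator {0<..} t *\<^sub>R \<phi> t)) \<in> borel_measurable lebesgue"
    by (intro borel_measurable_times)
  then show ?thesis by (simp add: hausdorff_density_def[abs_def])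
qed

lemma cmod_hausdorff_density:
  "cmod (hausdorff_density b \<phi> t) = indicator {0<..} t *\<^sub>R (t powr (b - 1) * cmod (\<phi> t))"
  by (simp add: hausdorff_density_def norm_mult)

lemma integrable_hausdorff_density_iff:
  assumes "\<phi> \<in> borel_measurable (lebesgue_on {0<..})"
  shows "integrable lebesgue (hausdorff_density b \<phi>)
    \<longleftrightarrow> set_integrable lebesgue {0<..} (\<lambda>t. t powr (b - 1) * cmod (\<phi> t))"
  unfolding set_integrable_def cmod_hausdorff_density[symmetric]
  using borel_measurable_hausdorff_density[OF assms] by (simp add: integrable_norm_iff)

lemma borel_measurable_dilate_pair:
  assumes "f \<in> borel_measurable borel"
  shows "(\<lambda>(z, t). dilate b t f z) \<in> borel_measurable (bergman_measure \<alpha> \<Otimes>\<^sub>M lebesgue)"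
proof -
  note [measurable] = assms
  have [measurable]: "(\<lambda>t::real. t) \<in> borel_measurable lebesgue"
    by (rule measurable_completion) simp
  show ?thesis unfolding dilate_def by measurable
qed

text \<open>This fixes the value of b: (t^(-b))^p equals (1 / t)^(1+\<alpha>), which is the factor
  that \<open>bergman_mass_affine\<close> produces for y = 1 / t.\<close>

lemma bergman_mass_dilate:
  assumes hol: "f holomorphic_on upper_half_plane" and t: "0 < t" and p: "0 < p"
  shows "bergman_mass p \<alpha> (dilate ((1 + \<alpha>) / p) t f) = bergman_mass p \<alpha> f"
proof -
  let ?g = "\<lambda>z. f (z / of_real t)"
  have hg: "?g holomorphic_on upper_half_plane"
    using t by (intro holomorphic_on_compose_gen[OF _ hol, unfolded o_def] holomorphic_intros)
      (auto simp: divide_of_real_upper_half_plane)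
  have "bergman_mass p \<alpha> (dilate ((1 + \<alpha>) / p) t f)
      = ennreal ((t powr (- ((1 + \<alpha>) / p))) powr p) * bergman_mass p \<alpha> ?g"
    unfolding dilate_def using bergman_mass_cmult[OF hg] by simp
  also have "(t powr (- ((1 + \<alpha>) / p))) powr p = (1 / t) powr (1 + \<alpha>)"
    using t p by (simp add: powr_powr powr_divide powr_minus_divide)
  also have "ennreal ((1 / t) powr (1 + \<alpha>)) * bergman_mass p \<alpha> ?g = bergman_mass p \<alpha> f"
    using bergman_mass_affine[OF hol, of "1 / t" p \<alpha> 0] t by simp
  finally show ?thesis .
qed

section \<open>Boundedness and the upper norm estimate for an integrable density\<close>

context
  fixes p \<alpha> b :: real and \<phi> :: "real \<Rightarrow> complex"
  assumes p: "1 \<le> p" and \<alpha>: "0 < \<alpha>" and b: "b = (1 + \<alpha>) / p"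
    and int: "integrable lebesgue (hausdorff_density b \<phi>)"
begin

text \<open>The factor t^(-b) cancels the t in Im (z / t)^(-b), so the bound is uniform in t.
  Integrability of the density alone then gives convergence of the defining integral and a majorant
  that is locally uniform in z.\<close>

lemma dilate_bound:
  obtains C where "0 < C"
    "\<And>f z t. f \<in> bergman_space p \<alpha> \<Longrightarrow> z \<in> upper_half_plane \<Longrightarrow> 0 < t \<Longrightarrow>
      cmod (dilate b t (upper_part f) z) \<le> C * Im z powr (- b) * bergman_norm p \<alpha> f"
proof -
  obtain C where C: "0 < C" and le: "\<And>f z. f \<in> bergman_space p \<alpha> \<Longrightarrow> z \<in> upper_half_plane \<Longrightarrow>
      cmod (f z) \<le> C * Im z powr (- b) * bergman_norm p \<alpha> f"
    by (rule bergman_point_bound[OF p, of \<alpha>, folded b]) (rule that)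
  have "cmod (dilate b t (upper_part f) z) \<le> C * Im z powr (- b) * bergman_norm p \<alpha> f"
    if f: "f \<in> bergman_space p \<alpha>" and z: "z \<in> upper_half_plane" and t: "0 < t" for f z t
  proof -
    note zt = divide_of_real_upper_half_plane[OF z t]
    have "cmod (dilate b t (upper_part f) z) = t powr (- b) * cmod (f (z / of_real t))"
      using zt by (simp add: dilate_def norm_mult)
    also have "\<dots> \<le> t powr (- b) * (C * Im (z / of_real t) powr (- b) * bergman_norm p \<alpha> f)"
      by (intro mult_left_mono le f zt) auto
    also have "\<dots> = C * (t powr (- b) * Im (z / of_real t) powr (- b)) * bergman_norm p \<alpha> f"
      by simp
    also have "t powr (- b) * Im (z / of_real t) powr (- b) = Im z powr (- b)"
      using t z by (simp add: mem_upper_half_plane flip: powr_mult)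
    finally show ?thesis .
  qed
  with C show thesis by (rule that)
qed

lemma integrable_dilate:
  assumes f: "f \<in> bergman_space p \<alpha>" and z: "z \<in> upper_half_plane"
  shows "integrable lebesgue (\<lambda>t. dilate b t (upper_part f) z * hausdorff_density b \<phi> t)"
proof -
  obtain C where C: "0 < C" and le: "\<And>f z t. f \<in> bergman_space p \<alpha> \<Longrightarrow> z \<in> upper_half_plane \<Longrightarrow> 0 < t \<Longrightarrow>
      cmod (dilate b t (upper_part f) z) \<le> C * Im z powr (- b) * bergman_norm p \<alpha> f"
    by (rule dilate_bound) (rule that)
  let ?D = "C * Im z powr (- b) * bergman_norm p \<alpha> f"
  have [measurable]: "upper_part f \<in> borel_measurable borel"
    using f by (intro borel_measurable_upper_part) (simp add: bergman_space_iff)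
  have [measurable]: "(\<lambda>t::real. t) \<in> borel_measurable lebesgue"
    by (rule measurable_completion) simp
  have [measurable]: "hausdorff_density b \<phi> \<in> borel_measurable lebesgue" using int by auto
  show ?thesis
  proof (rule Bochner_Integration.integrable_bound[where f="\<lambda>t. ?D *\<^sub>R hausdorff_density b \<phi> t"])
    show "(\<lambda>t. dilate b t (upper_part f) z * hausdorff_density b \<phi> t) \<in> borel_measurable lebesgue"
      unfolding dilate_def by measurable
    have "cmod (dilate b t (upper_part f) z * hausdorff_density b \<phi> t)
        \<le> cmod (?D *\<^sub>R hausdorff_density b \<phi> t)" for t
    proof (cases "t > 0")
      case True
      have "cmod (dilate b t (upper_part f) z) * cmod (hausdorff_density b \<phi> t)
          \<le> ?D * cmod (hausdorff_density b \<phi> t)"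
        by (intro mult_right_mono le f z True) auto
      then show ?thesis using C by (simp add: norm_mult)
    qed (simp add: hausdorff_density_def)
    then show "AE t in lebesgue. cmod (dilate b t (upper_part f) z * hausdorff_density b \<phi> t)
        \<le> cmod (?D *\<^sub>R hausdorff_density b \<phi> t)" by simp
  qed (use int in simp)
qed

lemma holomorphic_hausdorff_op:
  assumes f: "f \<in> bergman_space p \<alpha>"
  shows "hausdorff_op \<phi> f holomorphic_on upper_half_plane"
proof -
  obtain C where C: "0 < C" and le: "\<And>f z t. f \<in> bergman_space p \<alpha> \<Longrightarrow> z \<in> upper_half_plane \<Longrightarrow> 0 < t \<Longrightarrow>
      cmod (dilate b t (upper_part f) z) \<le> C * Im z powr (- b) * bergman_norm p \<alpha> f"
    by (rule dilate_bound) (rule that)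
  have hol: "f holomorphic_on upper_half_plane" using f by (simp add: bergman_space_iff)
  have b0: "b > 0" using p \<alpha> b by simp
  have "(\<lambda>z. \<integral>t. dilate b t (upper_part f) z * hausdorff_density b \<phi> t \<partial>lebesgue)
      holomorphic_on upper_half_plane"
  proof (rule holomorphic_on_lebesgue_integral)
    fix t :: real
    show "(\<lambda>z. dilate b t (upper_part f) z * hausdorff_density b \<phi> t) holomorphic_on upper_half_plane"
    proof (cases "t > 0")
      case True
      have "(\<lambda>z. of_real (t powr (- b)) * f (z / of_real t) * hausdorff_density b \<phi> t)
          holomorphic_on upper_half_plane"
        using True
        by (intro holomorphic_on_compose_gen[OF _ hol, unfolded o_def] holomorphic_intros)
           (auto simp: divide_of_real_upper_half_plane)
      then show ?thesis
        by (rule holomorphic_transform)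
           (use True in \<open>simp add: dilate_def divide_of_real_upper_half_plane\<close>)
    qed (simp add: hausdorff_density_def)
  next
    fix z assume "z \<in> upper_half_plane"
    then show "(\<lambda>t. dilate b t (upper_part f) z * hausdorff_density b \<phi> t) \<in> borel_measurable lebesgue"
      by (intro borel_measurable_integrable integrable_dilate f)
  next
    fix z assume z: "z \<in> upper_half_plane"
    \<comment> \<open>Half the height keeps Im w \<ge> r on the ball, so the negative power of Im w
      is bounded there by that of r.\<close>
    define r where "r = Im z / 2"
    have r: "r > 0" using z by (simp add: r_def mem_upper_half_plane)
    have im: "r \<le> Im w" if "w \<in> ball z r" for w
      using abs_Im_le_cmod[of "z - w"] that by (auto simp: dist_norm r_def)
    let ?D = "C * r powr (- b) * bergman_norm p \<alpha> f"
    have bd: "cmod (dilate b t (upper_part f) w * hausdorff_density b \<phi> t)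
        \<le> ?D * cmod (hausdorff_density b \<phi> t)" if w: "w \<in> ball z r" for w t
    proof (cases "t > 0")
      case True
      have "w \<in> upper_half_plane" using im[OF w] r by (simp add: mem_upper_half_plane)
      then have "cmod (dilate b t (upper_part f) w) \<le> C * Im w powr (- b) * bergman_norm p \<alpha> f"
        by (intro le f True)
      also have "\<dots> \<le> ?D"
        using im[OF w] r C b0 by (intro mult_right_mono mult_left_mono powr_mono2') auto
      finally show ?thesis by (simp add: norm_mult mult_right_mono)
    qed (simp add: hausdorff_density_def)
    show "\<exists>r>0. \<exists>h. ball z r \<subseteq> upper_half_plane \<and> integrable lebesgue h \<and>
      (\<forall>w\<in>ball z r. \<forall>t\<in>space lebesgue. cmod (dilate b t (upper_part f) w * hausdorff_density b \<phi> t) \<le> h t)"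
    proof (intro exI conjI ballI)
      show "0 < r" by fact
      show "ball z r \<subseteq> upper_half_plane"
      proof
        fix w assume "w \<in> ball z r"
        from im[OF this] show "w \<in> upper_half_plane" using r by (simp add: mem_upper_half_plane)
      qed
      show "integrable lebesgue (\<lambda>t. ?D * cmod (hausdorff_density b \<phi> t))" using int by simp
    qed (rule bd)
  qed simp
  then show ?thesis
    by (rule holomorphic_transform) (simp add: hausdorff_op_eq[of _ _ _ b])
qed

text \<open>In \<open>minkowski_kernel_bound\<close> the inner mass is that of f for every t > 0,
  since the dilations are isometries; K^(p-1) and the remaining K combine to K^p.\<close>

lemma bergman_mass_hausdorff_op:
  assumes f: "f \<in> bergman_space p \<alpha>"
  shows "bergman_mass p \<alpha> (hausdorff_op \<phi> f)
    \<le> ennreal ((\<integral>t. cmod (hausdorff_density b \<phi> t) \<partial>lebesgue) powr p) * bergman_mass p \<alpha> f"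
proof -
  let ?K = "\<integral>t. cmod (hausdorff_density b \<phi> t) \<partial>lebesgue"
  let ?h = "\<lambda>z. \<integral>t. dilate b t (upper_part f) z * hausdorff_density b \<phi> t \<partial>lebesgue"
  have hol: "f holomorphic_on upper_half_plane" using f by (simp add: bergman_space_iff)
  have um: "upper_part f \<in> borel_measurable borel" by (rule borel_measurable_upper_part[OF hol])
  interpret L: sigma_finite_measure "lebesgue :: real measure" by (rule lebesgue_sigma_finite)
  have km: "(\<lambda>(z, t). dilate b t (upper_part f) z) \<in> borel_measurable (bergman_measure \<alpha> \<Otimes>\<^sub>M lebesgue)"
    by (rule borel_measurable_dilate_pair[OF um])
  have "hausdorff_density b \<phi> \<in> borel_measurable lebesgue" using int by auto
  then have "(\<lambda>(z, t). dilate b t (upper_part f) z * hausdorff_density b \<phi> t)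
      \<in> borel_measurable (bergman_measure \<alpha> \<Otimes>\<^sub>M lebesgue)"
    using borel_measurable_times[OF km measurable_compose[OF measurable_snd]]
    by (simp add: case_prod_unfold)
  then have "?h \<in> borel_measurable (bergman_measure \<alpha>)"
    by (rule L.borel_measurable_lebesgue_integral)
  then have hm: "?h \<in> borel_measurable borel"
    by (simp add: measurable_cong_sets[OF sets_bergman_measure refl])
  \<comment> \<open>The integral built from \<open>upper_part f\<close> is Borel measurable on the
    whole plane. It replaces the operator, with which it agrees on the half-plane, the only place
    the mass looks at.\<close>
  have "bergman_mass p \<alpha> (hausdorff_op \<phi> f) = bergman_mass p \<alpha> ?h"
    by (rule bergman_mass_cong) (rule hausdorff_op_eq)
  also have "\<dots> = (\<integral>\<^sup>+z. ennreal (cmod (?h z) powr p) \<partial>bergman_measure \<alpha>)"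
    by (rule nn_integral_bergman_measure[symmetric, OF hm])
  also have "\<dots> \<le> ennreal (?K powr (p - 1)) * (\<integral>\<^sup>+t. ennreal (cmod (hausdorff_density b \<phi> t)) *
      (\<integral>\<^sup>+z. ennreal (cmod (dilate b t (upper_part f) z) powr p) \<partial>bergman_measure \<alpha>) \<partial>lebesgue)"
    by (rule minkowski_kernel_bound[OF sigma_finite_bergman_measure lebesgue_sigma_finite p km int])
  also have "(\<integral>\<^sup>+t. ennreal (cmod (hausdorff_density b \<phi> t)) *
      (\<integral>\<^sup>+z. ennreal (cmod (dilate b t (upper_part f) z) powr p) \<partial>bergman_measure \<alpha>) \<partial>lebesgue)
      = (\<integral>\<^sup>+t. ennreal (cmod (hausdorff_density b \<phi> t)) * bergman_mass p \<alpha> f \<partial>lebesgue)"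
  proof (rule nn_integral_cong)
    fix t :: real
    show "ennreal (cmod (hausdorff_density b \<phi> t)) *
      (\<integral>\<^sup>+z. ennreal (cmod (dilate b t (upper_part f) z) powr p) \<partial>bergman_measure \<alpha>)
      = ennreal (cmod (hausdorff_density b \<phi> t)) * bergman_mass p \<alpha> f"
    proof (cases "t > 0")
      case True
      have "dilate b t (upper_part f) \<in> borel_measurable borel"
        using um unfolding dilate_def[abs_def] by measurable
      then have "(\<integral>\<^sup>+z. ennreal (cmod (dilate b t (upper_part f) z) powr p) \<partial>bergman_measure \<alpha>)
          = bergman_mass p \<alpha> (dilate b t (upper_part f))"
        by (rule nn_integral_bergman_measure)
      also have "\<dots> = bergman_mass p \<alpha> (dilate b t f)"
        using True by (intro bergman_mass_cong) (simp add: dilate_def divide_of_real_upper_half_plane)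
      also have "\<dots> = bergman_mass p \<alpha> f"
        unfolding b using p True by (intro bergman_mass_dilate hol) auto
      finally show ?thesis by simp
    qed (simp add: hausdorff_density_def)
  qed
  also have "\<dots> = ennreal ?K * bergman_mass p \<alpha> f"
    using int by (simp add: nn_integral_multc nn_integral_eq_integral)
  also have "ennreal (?K powr (p - 1)) * (ennreal ?K * bergman_mass p \<alpha> f)
      = ennreal (?K powr (p - 1) * ?K) * bergman_mass p \<alpha> f"
    by (subst ennreal_mult') (simp_all only: mult.assoc powr_ge_zero)
  also have "?K powr (p - 1) * ?K = ?K powr p"
    using powr_mult_base[of ?K "p - 1"] by (simp add: mult.commute)
  finally show ?thesis .
qed

lemma hausdorff_op_bergman_space:
  assumes f: "f \<in> bergman_space p \<alpha>"
  shows "hausdorff_op \<phi> f \<in> bergman_space p \<alpha>"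
proof -
  have "bergman_mass p \<alpha> (hausdorff_op \<phi> f) < \<infinity>"
    using bergman_mass_hausdorff_op[OF f] f
    by (intro le_less_trans[OF bergman_mass_hausdorff_op[OF f]])
       (simp add: bergman_space_iff ennreal_mult_less_top)
  then show ?thesis using holomorphic_hausdorff_op[OF f] by (simp add: bergman_space_iff)
qed

lemma hausdorff_norm_le:
  "hausdorff_norm p \<alpha> \<phi> \<le> ennreal (\<integral>t. cmod (hausdorff_density b \<phi> t) \<partial>lebesgue)"
  unfolding hausdorff_norm_def
proof (rule SUP_least)
  let ?K = "\<integral>t. cmod (hausdorff_density b \<phi> t) \<partial>lebesgue"
  fix f assume "f \<in> {f \<in> bergman_space p \<alpha>. bergman_norm p \<alpha> f \<le> 1}"
  then have f: "f \<in> bergman_space p \<alpha>" and n: "bergman_norm p \<alpha> f \<le> 1" by auto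
  let ?N = "bergman_norm p \<alpha> (hausdorff_op \<phi> f)"
  have "ennreal (?N powr p) \<le> ennreal (?K powr p * bergman_norm p \<alpha> f powr p)"
    using bergman_mass_hausdorff_op[OF f] bergman_mass_eq_norm[OF f]
      bergman_mass_eq_norm[OF hausdorff_op_bergman_space[OF f]] p
    by (simp add: ennreal_mult)
  then have "?N powr p \<le> ?K powr p * bergman_norm p \<alpha> f powr p" by simp
  also have "\<dots> \<le> ?K powr p * 1 powr p"
    using n p by (intro mult_left_mono powr_mono2) auto
  finally have "(?N powr p) powr (1 / p) \<le> (?K powr p) powr (1 / p)"
    using p by (intro powr_mono2[of "1 / p"]) auto
  moreover have "(?N powr p) powr (1 / p) = ?N" "(?K powr p) powr (1 / p) = ?K"
    using p by (simp_all add: powr_powr)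
  ultimately show "ennreal ?N \<le> ennreal ?K"
    by (intro ennreal_leI) (simp only:)
qed

lemma hausdorff_boundedI: "hausdorff_bounded p \<alpha> \<phi>"
proof -
  have "hausdorff_norm p \<alpha> \<phi> < \<infinity>"
    using hausdorff_norm_le by (rule le_less_trans) simp
  then show ?thesis
    unfolding hausdorff_bounded_def hausdorff_well_defined_iff[of _ _ b]
    using integrable_dilate hausdorff_op_bergman_space by blast
qed

end

subsection \<open>Test functions\<close>

text \<open>
  For \<open>g = (1 + \<alpha>) / p + d\<close> and \<open>d \<down> 0\<close> these functions are asymptotically invariant under the isometric
  dilations, and \<open>bergman_mass\<close> of them grows like \<open>1 / d\<close>.
\<close>

definition bergman_test :: "real \<Rightarrow> complex \<Rightarrow> complex" where
  "bergman_test g z = (1 - \<i> * z) powr of_real (- g)"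

lemma Re_test_base: "z \<in> upper_half_plane \<Longrightarrow> 0 < Re (1 - \<i> * z)"
  by (simp add: mem_upper_half_plane)

lemma test_base_ge_1:
  assumes "z \<in> upper_half_plane"
  shows "1 \<le> cmod (1 - \<i> * z)"
  using abs_Re_le_cmod[of "1 - \<i> * z"] assms by (simp add: mem_upper_half_plane)

lemma holomorphic_bergman_test: "bergman_test g holomorphic_on upper_half_plane"
  unfolding bergman_test_def[abs_def]
  by (intro holomorphic_intros) (auto dest: Re_test_base simp: complex_nonpos_Reals_iff)

lemma cmod_bergman_test: "cmod (bergman_test g z) = cmod (1 - \<i> * z) powr (- g)"
  unfolding bergman_test_def by (subst norm_powr_real_powr') auto

section \<open>Power integrals over the half-plane and over a truncated sector\<close>

lemma nn_integral_powr_Ici: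
  fixes e n :: real
  assumes "e > 0" "n > 0"
  shows "(\<integral>\<^sup>+y. ennreal (indicator {n..} y * y powr (- 1 - e)) \<partial>lborel) = ennreal (n powr (- e) / e)"
  using nn_integral_has_integral_lebesgue[OF _ has_integral_powr_to_inf[of "- 1 - e" n]] assms
  by simp

text \<open>The interval [-1, 1] contributes 2 and each tail 1 / a. The function
  \<open>max 1 \<bar>u\<bar>\<close> is a lower bound for the rescaled modulus in the horizontal
  integrals below.\<close>

lemma nn_integral_max_powr_le:
  fixes a :: real
  assumes a: "a > 0"
  shows "(\<integral>\<^sup>+u. ennreal (max 1 \<bar>u\<bar> powr (- 1 - a)) \<partial>lborel) \<le> ennreal (2 + 2 / a)"
proof -
  let ?h = "\<lambda>u::real. ennreal (indicator {1..} u * u powr (- 1 - a))"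
  have [measurable]: "?h \<in> borel_measurable borel" by measurable
  have "(\<integral>\<^sup>+u. ennreal (max 1 \<bar>u\<bar> powr (- 1 - a)) \<partial>lborel)
      \<le> (\<integral>\<^sup>+u. indicator {-1..1} u + (?h u + ?h (0 + (-1) * u)) \<partial>lborel)"
  proof (rule nn_integral_mono)
    fix u :: real
    consider "u \<in> {-1..1}" | "u > 1" | "u < -1" by fastforce
    then show "ennreal (max 1 \<bar>u\<bar> powr (- 1 - a)) \<le> indicator {-1..1} u + (?h u + ?h (0 + (-1) * u))"
      by cases (auto simp: max_def indicator_def)
  qed
  also have "\<dots> = (\<integral>\<^sup>+u. indicator {-1..1::real} u \<partial>lborel)
      + ((\<integral>\<^sup>+u. ?h u \<partial>lborel) + (\<integral>\<^sup>+u. ?h (0 + (-1) * u) \<partial>lborel))"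
    by (subst nn_integral_add, simp, simp, subst nn_integral_add) auto
  also have "(\<integral>\<^sup>+u. ?h (0 + (-1) * u) \<partial>lborel) = (\<integral>\<^sup>+u. ?h u \<partial>lborel)"
    using nn_integral_real_affine[of ?h "-1" 0] by simp
  also have "(\<integral>\<^sup>+u. ?h u \<partial>lborel) = ennreal (1 / a)"
    using nn_integral_powr_Ici[OF a, of 1] by simp
  also have "(\<integral>\<^sup>+u. indicator {-1..1::real} u \<partial>lborel) = ennreal 2"
    by simp
  also have "ennreal 2 + (ennreal (1 / a) + ennreal (1 / a)) = ennreal (2 + 2 / a)"
    using a by (subst ennreal_plus[symmetric], simp, simp)+
  finally show ?thesis .
qed

text \<open>Under x = (1 + y) u the modulus is at least (1 + y) max 1 |u|, so the horizontal
  integral leaves (1 + y)^(-\<alpha>-e) y^(\<alpha>-1) up to a constant. Below height 1 this is at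
  most y^(\<alpha>-1), with integral 1 / \<alpha>; above it is at most y^(-1-e), with integral 1 /
  e.\<close>

lemma nn_integral_test_upper:
  fixes \<alpha> e :: real
  assumes \<alpha>: "0 < \<alpha>" and e: "0 < e"
  shows "(\<integral>\<^sup>+z. ennreal (indicator upper_half_plane z *
      (cmod (1 - \<i> * z) powr (- (1 + \<alpha> + e)) * Im z powr (\<alpha> - 1))) \<partial>lborel)
    \<le> ennreal ((2 + 2 / \<alpha>) * (1 / \<alpha> + 1 / e))"
proof -
  let ?s = "1 + \<alpha> + e"
  let ?A = "2 + 2 / \<alpha>"
  let ?G = "\<lambda>z. ennreal (indicator upper_half_plane z *
      (cmod (1 - \<i> * z) powr (- ?s) * Im z powr (\<alpha> - 1)))"
  have [measurable]: "?G \<in> borel_measurable borel" by measurable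
  have inner: "(\<integral>\<^sup>+x. ?G (Complex x y) \<partial>lborel)
      \<le> ennreal ?A * (ennreal (indicator {0..1} y * y powr (\<alpha> - 1)) + ennreal (indicator {1..} y * y powr (- 1 - e)))"
    for y
  proof (cases "y > 0")
    case y: True
    have Cm[measurable]: "(\<lambda>x. Complex x y) \<in> borel_measurable borel"
      unfolding Complex_eq by measurable
    have scale: "(\<integral>\<^sup>+x. ?G (Complex x y) \<partial>lborel)
        = ennreal (1 + y) * (\<integral>\<^sup>+u. ?G (Complex (0 + (1 + y) * u) y) \<partial>lborel)"
      using y by (subst nn_integral_real_affine[where c="1 + y" and t=0]) auto
    have "(\<integral>\<^sup>+u. ?G (Complex (0 + (1 + y) * u) y) \<partial>lborel)
        \<le> (\<integral>\<^sup>+u. ennreal ((1 + y) powr (- ?s) * y powr (\<alpha> - 1)) * ennreal (max 1 \<bar>u\<bar> powr (- 1 - \<alpha>)) \<partial>lborel)"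
    proof (rule nn_integral_mono)
      fix u :: real
      let ?z = "Complex (0 + (1 + y) * u) y"
      have "(1 + y) * max 1 \<bar>u\<bar> \<le> cmod (1 - \<i> * ?z)"
        using abs_Re_le_cmod[of "1 - \<i> * ?z"] abs_Im_le_cmod[of "1 - \<i> * ?z"] y
        by (auto simp: max_def abs_mult)
      then have "cmod (1 - \<i> * ?z) powr (- ?s) \<le> ((1 + y) * max 1 \<bar>u\<bar>) powr (- ?s)"
        using y \<alpha> e by (intro powr_mono2') auto
      also have "\<dots> = (1 + y) powr (- ?s) * max 1 \<bar>u\<bar> powr (- ?s)"
        using y by (subst powr_mult) auto
      \<comment> \<open>Here e is dropped from the exponent of the horizontal factor only, which
        keeps the constant \<open>?A\<close> free of e. In the vertical factor it is what makes the
        integral converge.\<close>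
      also have "\<dots> \<le> (1 + y) powr (- ?s) * max 1 \<bar>u\<bar> powr (- 1 - \<alpha>)"
        using e by (intro mult_left_mono powr_mono) auto
      finally have "cmod (1 - \<i> * ?z) powr (- ?s) * y powr (\<alpha> - 1)
          \<le> (1 + y) powr (- ?s) * max 1 \<bar>u\<bar> powr (- 1 - \<alpha>) * y powr (\<alpha> - 1)"
        by (intro mult_right_mono) auto
      then have "indicator upper_half_plane ?z * (cmod (1 - \<i> * ?z) powr (- ?s) * Im ?z powr (\<alpha> - 1))
          \<le> (1 + y) powr (- ?s) * y powr (\<alpha> - 1) * max 1 \<bar>u\<bar> powr (- 1 - \<alpha>)"
        using y by (simp add: mem_upper_half_plane mult_ac)
      then show "?G ?z \<le> ennreal ((1 + y) powr (- ?s) * y powr (\<alpha> - 1)) * ennreal (max 1 \<bar>u\<bar> powr (- 1 - \<alpha>))"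
        by (subst ennreal_mult[symmetric]) (auto intro!: ennreal_leI)
    qed
    also have "\<dots> = ennreal ((1 + y) powr (- ?s) * y powr (\<alpha> - 1)) *
        (\<integral>\<^sup>+u. ennreal (max 1 \<bar>u\<bar> powr (- 1 - \<alpha>)) \<partial>lborel)"
      by (rule nn_integral_cmult) measurable
    also have "\<dots> \<le> ennreal ((1 + y) powr (- ?s) * y powr (\<alpha> - 1)) * ennreal ?A"
      by (intro mult_left_mono nn_integral_max_powr_le \<alpha>) simp
    finally have "(\<integral>\<^sup>+x. ?G (Complex x y) \<partial>lborel)
        \<le> ennreal (1 + y) * (ennreal ((1 + y) powr (- ?s) * y powr (\<alpha> - 1)) * ennreal ?A)"
      unfolding scale by (rule mult_left_mono) simp
    also have "\<dots> = ennreal ?A * ennreal ((1 + y) * ((1 + y) powr (- ?s) * y powr (\<alpha> - 1)))"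
      using y by (subst ennreal_mult) (auto simp: ac_simps)
    also have "(1 + y) * ((1 + y) powr (- ?s) * y powr (\<alpha> - 1)) = (1 + y) powr (- \<alpha> - e) * y powr (\<alpha> - 1)"
      using y powr_mult_base[of "1 + y" "- ?s"] by (simp add: mult.assoc[symmetric])
    finally have 1: "(\<integral>\<^sup>+x. ?G (Complex x y) \<partial>lborel)
        \<le> ennreal ?A * ennreal ((1 + y) powr (- \<alpha> - e) * y powr (\<alpha> - 1))" .
    have "ennreal ((1 + y) powr (- \<alpha> - e) * y powr (\<alpha> - 1)) \<le> ennreal (indicator {0..1} y * y powr (\<alpha> - 1) + indicator {1..} y * y powr (- 1 - e))"
    proof (rule ennreal_leI, cases "y \<le> 1")
      case True
      have "(1 + y) powr (- \<alpha> - e) \<le> (1 + y) powr 0"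
        using y \<alpha> e by (intro powr_mono) auto
      then have "(1 + y) powr (- \<alpha> - e) * y powr (\<alpha> - 1) \<le> 1 * y powr (\<alpha> - 1)"
        using y by (intro mult_right_mono) auto
      then show "(1 + y) powr (- \<alpha> - e) * y powr (\<alpha> - 1)
          \<le> indicator {0..1} y * y powr (\<alpha> - 1) + indicator {1..} y * y powr (- 1 - e)"
        using True y by (auto simp: indicator_def)
    next
      case False
      have "(1 + y) powr (- \<alpha> - e) \<le> y powr (- \<alpha> - e)"
        using y \<alpha> e by (intro powr_mono2') auto
      then have "(1 + y) powr (- \<alpha> - e) * y powr (\<alpha> - 1) \<le> y powr (- \<alpha> - e) * y powr (\<alpha> - 1)"
        by (intro mult_right_mono) auto
      also have "\<dots> = y powr (- 1 - e)"
        by (subst powr_add[symmetric]) (simp add: algebra_simps)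
      finally show "(1 + y) powr (- \<alpha> - e) * y powr (\<alpha> - 1)
          \<le> indicator {0..1} y * y powr (\<alpha> - 1) + indicator {1..} y * y powr (- 1 - e)"
        using False y by (auto simp: indicator_def)
    qed
    also have "ennreal (indicator {0..1} y * y powr (\<alpha> - 1) + indicator {1..} y * y powr (- 1 - e))
        = ennreal (indicator {0..1} y * y powr (\<alpha> - 1)) + ennreal (indicator {1..} y * y powr (- 1 - e))"
      by (rule ennreal_plus) auto
    finally show ?thesis by (intro order_trans[OF 1] mult_left_mono) simp_all
  qed (simp add: mem_upper_half_plane)
  have "(\<integral>\<^sup>+z. ?G z \<partial>lborel) = (\<integral>\<^sup>+y. \<integral>\<^sup>+x. ?G (Complex x y) \<partial>lborel \<partial>lborel)"
    by (rule nn_integral_lborel_complex) measurable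
  also have "\<dots> \<le> (\<integral>\<^sup>+y. ennreal ?A * (ennreal (indicator {0..1} y * y powr (\<alpha> - 1))
      + ennreal (indicator {1..} y * y powr (- 1 - e))) \<partial>lborel)"
    by (rule nn_integral_mono) (rule inner)
  also have "\<dots> = ennreal ?A * (\<integral>\<^sup>+y. ennreal (indicator {0..1} y * y powr (\<alpha> - 1))
      + ennreal (indicator {1..} y * y powr (- 1 - e)) \<partial>lborel)"
    by (rule nn_integral_cmult) measurable
  also have "(\<integral>\<^sup>+y. ennreal (indicator {0..1} y * y powr (\<alpha> - 1))
      + ennreal (indicator {1..} y * y powr (- 1 - e)) \<partial>lborel)
      = (\<integral>\<^sup>+y. ennreal (indicator {0..1} y * y powr (\<alpha> - 1)) \<partial>lborel)
      + (\<integral>\<^sup>+y. ennreal (indicator {1..} y * y powr (- 1 - e)) \<partial>lborel)"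
    by (rule nn_integral_add) measurable
  also have "(\<integral>\<^sup>+y. ennreal (indicator {1..} y * y powr (- 1 - e)) \<partial>lborel) = ennreal (1 / e)"
    using nn_integral_powr_Ici[OF e, of 1] by simp
  also have "(\<integral>\<^sup>+y. ennreal (indicator {0..1} y * y powr (\<alpha> - 1)) \<partial>lborel) = ennreal (1 / \<alpha>)"
    using nn_integral_has_integral_lebesgue[OF _ has_integral_powr_from_0[of "\<alpha> - 1" 1]] \<alpha> by simp
  also have "ennreal ?A * (ennreal (1 / \<alpha>) + ennreal (1 / e)) = ennreal (?A * (1 / \<alpha> + 1 / e))"
    using \<alpha> e by (simp add: ennreal_mult flip: ennreal_plus)
  finally show ?thesis .
qed

text \<open>In the sector |x| \<le> c y above height n, \<open>cmod z + n\<close> is at most |x| + y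
  + n \<le> 3 y, and the section at height y has length 2 c y; integrating y^(-1-e) from n gives the
  bound. With n = 1 the base dominates |1 - \<i> z|; with n = N it dominates |t - \<i> z| for all 0
  < t \<le> N.\<close>

lemma nn_integral_test_lower:
  fixes \<alpha> e c n :: real
  assumes \<alpha>: "0 < \<alpha>" and e: "0 < e" and c: "0 < c" "c \<le> 1" and n: "0 < n"
  shows "ennreal (2 * c * 3 powr (- (1 + \<alpha> + e)) * (n powr (- e) / e))
    \<le> (\<integral>\<^sup>+z. ennreal (indicator {z. n \<le> Im z \<and> \<bar>Re z\<bar> \<le> c * Im z} z *
        ((cmod z + n) powr (- (1 + \<alpha> + e)) * Im z powr (\<alpha> - 1))) \<partial>lborel)"
proof -
  let ?s = "1 + \<alpha> + e"
  let ?S = "{z. n \<le> Im z \<and> \<bar>Re z\<bar> \<le> c * Im z}"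
  let ?G = "\<lambda>z. ennreal (indicator ?S z * ((cmod z + n) powr (- ?s) * Im z powr (\<alpha> - 1)))"
  have [measurable]: "?S \<in> sets borel" by measurable
  have [measurable]: "?G \<in> borel_measurable borel" by measurable
  let ?k = "2 * c * 3 powr (- ?s)"
  have inner: "ennreal ?k * ennreal (indicator {n..} y * y powr (- 1 - e)) \<le> (\<integral>\<^sup>+x. ?G (Complex x y) \<partial>lborel)"
    for y
  proof (cases "y \<ge> n")
    case y: True
    with n have y0: "y > 0" by simp
    have "ennreal ?k * ennreal (indicator {n..} y * y powr (- 1 - e))
        = ennreal (3 powr (- ?s) * y powr (- 2 - e)) * ennreal (2 * c * y)"
    proof -
      have "y powr (- 1 - e) = y * y powr (- 2 - e)"
        using powr_mult_base[of y "- 2 - e"] y0 by simp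
      then show ?thesis using y y0 c by (simp flip: ennreal_mult add: mult_ac)
    qed
    also have "ennreal (2 * c * y) = (\<integral>\<^sup>+x. indicator {- c * y..c * y} x \<partial>lborel)"
      using c y0 by simp
    also have "ennreal (3 powr (- ?s) * y powr (- 2 - e)) * \<dots>
        = (\<integral>\<^sup>+x. ennreal (3 powr (- ?s) * y powr (- 2 - e)) * indicator {- c * y..c * y} x \<partial>lborel)"
      by (rule nn_integral_cmult[symmetric]) simp
    also have "\<dots> \<le> (\<integral>\<^sup>+x. ?G (Complex x y) \<partial>lborel)"
    proof (rule nn_integral_mono)
      fix x :: real
      show "ennreal (3 powr (- ?s) * y powr (- 2 - e)) * indicator {- c * y..c * y} x \<le> ?G (Complex x y)"
      proof (cases "x \<in> {- c * y..c * y}")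
        case True
        then have S: "Complex x y \<in> ?S" using y by auto
        have cy: "c * y \<le> 1 * y" using c y0 by (intro mult_right_mono) auto
        have "cmod (Complex x y) \<le> \<bar>x\<bar> + y" using cmod_le[of "Complex x y"] y0 by simp
        moreover have "\<bar>x\<bar> \<le> c * y" using True by auto
        ultimately have "cmod (Complex x y) + n \<le> 3 * y" using cy y by linarith
        then have "(3 * y) powr (- ?s) \<le> (cmod (Complex x y) + n) powr (- ?s)"
          using n \<alpha> e add_nonneg_pos[OF norm_ge_zero[of "Complex x y"] n] by (intro powr_mono2') simp_all
        then have "(3 * y) powr (- ?s) * y powr (\<alpha> - 1) \<le> (cmod (Complex x y) + n) powr (- ?s) * y powr (\<alpha> - 1)"
          by (intro mult_right_mono) auto
        moreover have "(3 * y) powr (- ?s) * y powr (\<alpha> - 1) = 3 powr (- ?s) * y powr (- 2 - e)"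
        proof -
          have "y powr (- ?s) * y powr (\<alpha> - 1) = y powr (- 2 - e)"
            by (subst powr_add[symmetric]) simp
          then show ?thesis using y0 by (simp add: powr_mult)
        qed
        ultimately show ?thesis using S True by (auto intro!: ennreal_leI)
      qed auto
    qed
    finally show ?thesis .
  qed simp
  have "ennreal (?k * (n powr (- e) / e)) = ennreal ?k * (\<integral>\<^sup>+y. ennreal (indicator {n..} y * y powr (- 1 - e)) \<partial>lborel)"
    using c e n by (subst nn_integral_powr_Ici[OF e n], subst ennreal_mult) auto
  also have "\<dots> = (\<integral>\<^sup>+y. ennreal ?k * ennreal (indicator {n..} y * y powr (- 1 - e)) \<partial>lborel)"
    by (rule nn_integral_cmult[symmetric]) measurable
  also have "\<dots> \<le> (\<integral>\<^sup>+y. \<integral>\<^sup>+x. ?G (Complex x y) \<partial>lborel \<partial>lborel)"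
    by (rule nn_integral_mono) (rule inner)
  also have "\<dots> = (\<integral>\<^sup>+z. ?G z \<partial>lborel)"
    by (rule nn_integral_lborel_complex[symmetric]) measurable
  finally show ?thesis .
qed

section \<open>Mass of the test functions\<close>

lemma bergman_mass_test:
  assumes "p > 0"
  shows "bergman_mass p \<alpha> (bergman_test ((1 + \<alpha>) / p + d)) =
    (\<integral>\<^sup>+z. ennreal (indicator upper_half_plane z *
      (cmod (1 - \<i> * z) powr (- (1 + \<alpha> + p * d)) * Im z powr (\<alpha> - 1))) \<partial>lborel)"
proof -
  have "- ((1 + \<alpha>) / p + d) * p = - (1 + \<alpha> + p * d)"
    using assms by (simp add: field_simps)
  then show ?thesis
    by (simp only: bergman_mass_def cmod_bergman_test powr_powr)
qed

lemma bergman_test_in_space: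
  assumes "1 \<le> p" "0 < \<alpha>" "0 < d"
  shows "bergman_test ((1 + \<alpha>) / p + d) \<in> bergman_space p \<alpha>"
proof -
  have "bergman_mass p \<alpha> (bergman_test ((1 + \<alpha>) / p + d)) < \<infinity>"
    using nn_integral_test_upper[of \<alpha> "p * d"] assms
    by (subst bergman_mass_test) (auto intro: le_less_trans)
  then show ?thesis by (simp add: bergman_space_iff holomorphic_bergman_test)
qed

text \<open>Here e = p d. Since d \<le> 1 and p \<ge> 1, the terms 1 / \<alpha> and 1 / (p d) are at
  most 1 / (\<alpha> d) and 1 / d, which leaves a single term of order 1 / d.\<close>

lemma bergman_mass_test_upper:
  assumes p: "1 \<le> p" and \<alpha>: "0 < \<alpha>" and d: "0 < d" "d \<le> 1"
  shows "bergman_mass p \<alpha> (bergman_test ((1 + \<alpha>) / p + d))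
    \<le> ennreal ((2 + 2 / \<alpha>) * (1 / \<alpha> + 1) / d)"
proof -
  have "1 / (p * d) \<le> 1 / d" "1 / \<alpha> \<le> 1 / \<alpha> / d"
    using p d \<alpha> by (auto simp: field_simps)
  then have "1 / \<alpha> + 1 / (p * d) \<le> 1 / \<alpha> / d + 1 / d" by simp
  also have "\<dots> = (1 / \<alpha> + 1) / d" by (simp add: add_divide_distrib)
  finally have "(2 + 2 / \<alpha>) * (1 / \<alpha> + 1 / (p * d)) \<le> (2 + 2 / \<alpha>) * ((1 / \<alpha> + 1) / d)"
    using \<alpha> by (intro mult_left_mono) auto
  then have le: "ennreal ((2 + 2 / \<alpha>) * (1 / \<alpha> + 1 / (p * d))) \<le> ennreal ((2 + 2 / \<alpha>) * (1 / \<alpha> + 1) / d)"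
    by (intro ennreal_leI) simp
  show ?thesis
    using nn_integral_test_upper[of \<alpha> "p * d"] p \<alpha> d
    by (subst bergman_mass_test) (auto intro: order_trans[OF _ le])
qed

text \<open>Only the sector with c = n = 1 is kept, and p d \<le> p makes the power of 3 independent
  of d.\<close>

lemma bergman_mass_test_lower:
  assumes p: "1 \<le> p" and \<alpha>: "0 < \<alpha>" and d: "0 < d" "d \<le> 1"
  shows "ennreal (2 * 3 powr (- (1 + \<alpha> + p)) / (p * d)) \<le> bergman_mass p \<alpha> (bergman_test ((1 + \<alpha>) / p + d))"
proof -
  let ?s = "1 + \<alpha> + p * d"
  let ?S = "{z. 1 \<le> Im z \<and> \<bar>Re z\<bar> \<le> 1 * Im z}"
  have pd: "p * d \<le> p" using p d mult_left_mono[of d 1 p] by simp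
  have pd0: "0 < p * d" using p d by simp
  have "2 * 3 powr (- (1 + \<alpha> + p)) / (p * d) \<le> 2 * 1 * 3 powr (- ?s) * (1 powr (- (p * d)) / (p * d))"
    using p d pd by (auto intro!: divide_right_mono powr_mono)
  then have "ennreal (2 * 3 powr (- (1 + \<alpha> + p)) / (p * d))
      \<le> ennreal (2 * 1 * 3 powr (- ?s) * (1 powr (- (p * d)) / (p * d)))"
    by (rule ennreal_leI)
  also have "\<dots> \<le> (\<integral>\<^sup>+z. ennreal (indicator ?S z * ((cmod z + 1) powr (- ?s) * Im z powr (\<alpha> - 1))) \<partial>lborel)"
    using p \<alpha> d by (intro nn_integral_test_lower) auto
  also have "\<dots> \<le> bergman_mass p \<alpha> (bergman_test ((1 + \<alpha>) / p + d))"
  proof (subst bergman_mass_test)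
    show "(\<integral>\<^sup>+z. ennreal (indicator ?S z * ((cmod z + 1) powr (- ?s) * Im z powr (\<alpha> - 1))) \<partial>lborel)
      \<le> (\<integral>\<^sup>+z. ennreal (indicator upper_half_plane z *
        (cmod (1 - \<i> * z) powr (- ?s) * Im z powr (\<alpha> - 1))) \<partial>lborel)"
    proof (rule nn_integral_mono, rule ennreal_leI)
      fix z
      show "indicator ?S z * ((cmod z + 1) powr (- ?s) * Im z powr (\<alpha> - 1))
        \<le> indicator upper_half_plane z * (cmod (1 - \<i> * z) powr (- ?s) * Im z powr (\<alpha> - 1))"
      proof (cases "z \<in> ?S")
        case True
        then have z: "z \<in> upper_half_plane" by (simp add: mem_upper_half_plane)
        have "cmod (1 - \<i> * z) \<le> cmod z + 1"
          using norm_triangle_ineq4[of 1 "\<i> * z"] by (simp add: norm_mult)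
        then have "(cmod z + 1) powr (- ?s) \<le> cmod (1 - \<i> * z) powr (- ?s)"
          using test_base_ge_1[OF z] pd0 \<alpha> by (intro powr_mono2') auto
        then show ?thesis using True z by (simp add: mult_right_mono)
      qed simp
    qed
  qed (use p in simp)
  finally show ?thesis .
qed

text \<open>The positive factor 1 / t leaves the principal power without a branch correction, and
  t^(-b) t^(b+d) = t^d. Dilation thus only shifts the base from 1 - \<i> z to t - \<i> z and
  multiplies by t^d, which tends to 1 with d.\<close>

lemma dilate_bergman_test:
  assumes t: "0 < t"
  shows "dilate b t (bergman_test (b + d)) z = of_real (t powr d) * (of_real t - \<i> * z) powr of_real (- (b + d))"
proof -
  have "1 - \<i> * (z / of_real t) = of_real (1 / t) * (of_real t - \<i> * z)"
    using t by (simp add: field_simps)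
  then have "bergman_test (b + d) (z / of_real t)
      = of_real (1 / t) powr of_real (- (b + d)) * (of_real t - \<i> * z) powr of_real (- (b + d))"
    unfolding bergman_test_def using t by (simp only:) (rule powr_times_real_left; simp)
  also have "complex_of_real (1 / t) powr of_real (- (b + d)) = of_real ((1 / t) powr (- (b + d)))"
    using t by (subst powr_of_real) auto
  also have "(1 / t) powr (- (b + d)) = t powr (b + d)"
    using t by (subst powr_minus) (simp add: powr_divide)
  finally have "dilate b t (bergman_test (b + d)) z
      = of_real (t powr (- b) * t powr (b + d)) * (of_real t - \<i> * z) powr of_real (- (b + d))"
    by (simp add: dilate_def)
  also have "t powr (- b) * t powr (b + d) = t powr d"
    by (subst powr_add[symmetric]) simp
  finally show ?thesis .
qed

text \<open>A mean value estimate between t - \<i> z and 1 - \<i> z. Differentiation lowers the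
  exponent by one, so the difference decays like |1 - \<i> z|^(-(b+1)), uniformly in d.\<close>

lemma cmod_powr_diff_le:
  assumes z: "z \<in> upper_half_plane" and t: "0 < t" and b: "0 < b" and d: "0 < d" "d \<le> 1"
  shows "cmod ((of_real t - \<i> * z) powr of_real (- (b + d)) - (1 - \<i> * z) powr of_real (- (b + d)))
    \<le> (b + 1) * \<bar>t - 1\<bar> * min 1 t powr (- (b + 2)) * cmod (1 - \<i> * z) powr (- (b + 1))"
proof -
  let ?g = "b + d"
  let ?m = "min 1 t"
  let ?B = "(b + 1) * (?m powr (- (b + 2)) * cmod (1 - \<i> * z) powr (- (b + 1)))"
  \<comment> \<open>A horizontal ray: convex, containing both endpoints, and inside the right
    half-plane, hence away from the branch cut.\<close>
  let ?S = "(\<lambda>u::real. of_real u - \<i> * z) ` {?m..}"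
  have y: "Im z > 0" using z by (simp add: mem_upper_half_plane)
  have m: "0 < ?m" "?m \<le> 1" using t by auto
  have low: "?m * cmod (1 - \<i> * z) \<le> cmod w" and re: "0 < Re w" if w: "w \<in> ?S" for w
  proof -
    obtain u where u: "u \<ge> ?m" "w = of_real u - \<i> * z" using w by auto
    show "0 < Re w" using u m y by simp
    have "(?m * cmod (1 - \<i> * z))\<^sup>2 = (?m * (1 + Im z))\<^sup>2 + (?m * Re z)\<^sup>2"
      by (simp add: power_mult_distrib cmod_power2 flip: distrib_left)
    also have "\<dots> \<le> (u + Im z)\<^sup>2 + (Re z)\<^sup>2"
    proof (rule add_mono)
      have "?m * Im z \<le> 1 * Im z" using m y by (intro mult_right_mono) auto
      then have "?m * (1 + Im z) \<le> u + Im z" using u by (simp add: distrib_left)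
      then show "(?m * (1 + Im z))\<^sup>2 \<le> (u + Im z)\<^sup>2" using m y by (intro power_mono) auto
      have "?m\<^sup>2 \<le> 1" using m by (simp add: power_le_one)
      then show "(?m * Re z)\<^sup>2 \<le> (Re z)\<^sup>2"
        by (simp add: power_mult_distrib mult_left_le_one_le)
    qed
    also have "\<dots> = (cmod w)\<^sup>2" by (simp add: u cmod_power2)
    finally show "?m * cmod (1 - \<i> * z) \<le> cmod w" by (rule power2_le_imp_le) simp
  qed
  have "cmod ((of_real t - \<i> * z) powr of_real (- ?g) - (1 - \<i> * z) powr of_real (- ?g))
      \<le> ?B * cmod ((of_real t - \<i> * z) - (1 - \<i> * z))"
  proof (rule field_differentiable_bound[where S="?S" and f="\<lambda>w. w powr of_real (- ?g)"
        and f'="\<lambda>w. of_real (- ?g) * w powr (of_real (- ?g) - 1)"])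
    show "convex ?S"
    proof -
      have "?S = (\<lambda>w. - (\<i> * z) + w) ` (complex_of_real ` {?m..})"
        by (auto simp: image_image algebra_simps)
      moreover have "convex (complex_of_real ` {?m..})"
        by (intro convex_linear_image) (auto intro: bounded_linear.linear bounded_linear_of_real)
      ultimately show ?thesis by (simp add: convex_translation)
    qed
    show "((\<lambda>w. w powr of_real (- ?g)) has_field_derivative of_real (- ?g) * w powr (of_real (- ?g) - 1))
        (at w within ?S)" if "w \<in> ?S" for w
      using re[OF that]
      by (intro has_field_derivative_powr[THEN has_field_derivative_at_within])
         (auto simp: complex_nonpos_Reals_iff)
    show "cmod (of_real (- ?g) * w powr (of_real (- ?g) - 1)) \<le> ?B" if w: "w \<in> ?S" for w
    proof -
      have c1: "1 \<le> cmod (1 - \<i> * z)" by (rule test_base_ge_1[OF z])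
      have "cmod (w powr of_real (- ?g - 1)) = cmod w powr (- ?g - 1)"
        by (subst norm_powr_real_powr') auto
      also have "\<dots> \<le> (?m * cmod (1 - \<i> * z)) powr (- ?g - 1)"
        using low[OF w] m c1 b d by (intro powr_mono2') (auto intro!: mult_pos_pos)
      also have "\<dots> = ?m powr (- ?g - 1) * cmod (1 - \<i> * z) powr (- ?g - 1)"
        using m by (intro powr_mult)
      \<comment> \<open>\<open>?m \<le> 1\<close> while the modulus is at least 1, so d is removed
        in opposite directions: the first exponent is lowered to -(b+2), the second raised to
        -(b+1).\<close>
      also have "\<dots> \<le> ?m powr (- (b + 2)) * cmod (1 - \<i> * z) powr (- (b + 1))"
      proof (rule mult_mono)
        show "?m powr (- ?g - 1) \<le> ?m powr (- (b + 2))"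
          by (rule powr_mono') (use m d in auto)
        show "cmod (1 - \<i> * z) powr (- ?g - 1) \<le> cmod (1 - \<i> * z) powr (- (b + 1))"
          using c1 d by (intro powr_mono) auto
      qed auto
      finally have le: "cmod (w powr of_real (- ?g - 1)) \<le> \<dots>" .
      have "cmod (of_real (- ?g) * w powr (of_real (- ?g) - 1)) = ?g * cmod (w powr of_real (- ?g - 1))"
        using b d unfolding norm_mult by (simp only: norm_of_real of_real_diff of_real_1)
      also have "\<dots> \<le> ?B"
        using b d by (intro mult_mono le) auto
      finally show ?thesis .
    qed
    show "of_real t - \<i> * z \<in> ?S" by auto
    show "1 - \<i> * z \<in> ?S" by (intro image_eqI[of _ _ 1]) auto
  qed
  also have "cmod ((of_real t - \<i> * z) - (1 - \<i> * z)) = \<bar>t - 1\<bar>"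
    using norm_of_real[of "t - 1", where ?'a=complex] by simp
  finally show ?thesis by (simp add: mult_ac)
qed

subsection \<open>Lower bound for the norm\<close>

lemma bergman_mass_mono:
  assumes "\<And>z. z \<in> upper_half_plane \<Longrightarrow> cmod (f z) \<le> cmod (g z)" "0 \<le> p"
  shows "bergman_mass p \<alpha> f \<le> bergman_mass p \<alpha> g"
  unfolding bergman_mass_def
proof (rule nn_integral_mono, rule ennreal_leI)
  fix z
  show "indicator upper_half_plane z * (cmod (f z) powr p * Im z powr (\<alpha> - 1))
      \<le> indicator upper_half_plane z * (cmod (g z) powr p * Im z powr (\<alpha> - 1))"
    using assms by (cases "z \<in> upper_half_plane") (auto intro!: mult_right_mono powr_mono2)
qed

lemma holomorphic_dilate:
  assumes "f holomorphic_on upper_half_plane" "0 < t"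
  shows "dilate b t f holomorphic_on upper_half_plane"
  unfolding dilate_def[abs_def] using assms(2)
  by (intro holomorphic_on_compose_gen[OF _ assms(1), unfolded o_def] holomorphic_intros)
     (auto simp: divide_of_real_upper_half_plane)

text \<open>By isometry this bound is uniform in t. It supplies the majorant for dominated
  convergence, which the finer bound cannot, as its constant is unbounded in t.\<close>

lemma bergman_mass_dilate_diff_le:
  assumes p: "1 \<le> p" and f: "f holomorphic_on upper_half_plane" and t: "0 < t"
  shows "bergman_mass p \<alpha> (\<lambda>z. dilate ((1 + \<alpha>) / p) t f z - f z)
    \<le> ennreal (2 * 2 powr (p - 1)) * bergman_mass p \<alpha> f"
proof -
  have "bergman_mass p \<alpha> (\<lambda>z. dilate ((1 + \<alpha>) / p) t f z + (-1) * f z)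
    \<le> ennreal ((1/2) powr (1 - p)) * bergman_mass p \<alpha> (dilate ((1 + \<alpha>) / p) t f)
      + ennreal ((1 - 1/2) powr (1 - p)) * bergman_mass p \<alpha> (\<lambda>z. (-1) * f z)"
    by (rule bergman_mass_add_le) (use p f t in \<open>auto intro!: holomorphic_dilate holomorphic_intros\<close>)
  also have "bergman_mass p \<alpha> (dilate ((1 + \<alpha>) / p) t f) = bergman_mass p \<alpha> f"
    using p by (intro bergman_mass_dilate f t) simp
  also have "bergman_mass p \<alpha> (\<lambda>z. (-1) * f z) = bergman_mass p \<alpha> f"
    by (subst bergman_mass_cmult[OF f]) simp
  also have "1 - 1/2 = (1/2 :: real)" by simp
  also have "(1/2) powr (1 - p) = 2 powr (p - 1)"
    by (simp add: powr_divide powr_diff)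
  also have "ennreal (2 powr (p - 1)) * bergman_mass p \<alpha> f + ennreal (2 powr (p - 1)) * bergman_mass p \<alpha> f
      = ennreal (2 * 2 powr (p - 1)) * bergman_mass p \<alpha> f"
    by (simp only: mult_2 ennreal_plus powr_ge_zero distrib_right)
  finally show ?thesis by simp
qed

text \<open>\<open>max 1 t\<close> bounds t^d for all 0 < d \<le> 1, and the other factor is the
  constant of \<open>cmod_powr_diff_le\<close>; the product is therefore valid for all such d at
  once.\<close>

definition test_diff_const :: "real \<Rightarrow> real \<Rightarrow> real" where
  "test_diff_const b t = max 1 t * ((b + 1) * \<bar>t - 1\<bar> * min 1 t powr (- (b + 2)))"

text \<open>U_t F - F is split as (U_t F - t^d F) + (t^d - 1) F. The first part has mass bounded
  independently of d, hence negligible against the mass of F, which is of order 1 / d; the second is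
  F times a factor tending to 0.\<close>

lemma bergman_mass_dilate_test_diff_le:
  assumes p: "1 \<le> p" and \<alpha>: "0 < \<alpha>" and b: "b = (1 + \<alpha>) / p"
    and t: "0 < t" and d: "0 < d" "d \<le> 1"
  shows "bergman_mass p \<alpha> (\<lambda>z. dilate b t (bergman_test (b + d)) z - bergman_test (b + d) z)
    \<le> ennreal (2 powr (p - 1)) *
      (ennreal (test_diff_const b t powr p) * bergman_mass p \<alpha> (bergman_test (b + 1))
      + ennreal (\<bar>t powr d - 1\<bar> powr p) * bergman_mass p \<alpha> (bergman_test (b + d)))"
proof -
  let ?T = "bergman_test (b + d)"
  let ?c = "complex_of_real (t powr d)"
  define h where "h = (\<lambda>z. dilate b t ?T z + (- ?c) * ?T z)"
  have b0: "b > 0" using p \<alpha> b by simp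
  have holT: "?T holomorphic_on upper_half_plane" by (rule holomorphic_bergman_test)
  have holh: "h holomorphic_on upper_half_plane"
    unfolding h_def by (intro holomorphic_on_add holomorphic_on_mult holomorphic_on_const holomorphic_dilate holT t)
  have C0: "test_diff_const b t \<ge> 0"
    using b0 t by (auto simp: test_diff_const_def)
  have "bergman_mass p \<alpha> h \<le> bergman_mass p \<alpha> (\<lambda>z. of_real (test_diff_const b t) * bergman_test (b + 1) z)"
  proof (rule bergman_mass_mono)
    fix z assume z: "z \<in> upper_half_plane"
    let ?w = "(of_real t - \<i> * z) powr of_real (- (b + d)) - (1 - \<i> * z) powr of_real (- (b + d))"
    have "h z = ?c * ?w"
      unfolding h_def dilate_bergman_test[OF t] by (simp add: bergman_test_def right_diff_distrib)
    then have "cmod (h z) = t powr d * cmod ?w" by (simp add: norm_mult)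
    also have "\<dots> \<le> max 1 t * ((b + 1) * \<bar>t - 1\<bar> * min 1 t powr (- (b + 2)) * cmod (1 - \<i> * z) powr (- (b + 1)))"
    proof (rule mult_mono)
      show "t powr d \<le> max 1 t"
      proof (cases "t \<le> 1")
        case True
        then have "t powr d \<le> 1 powr d" using t d by (intro powr_mono2) auto
        then show ?thesis by simp
      next
        case False
        then have "t powr d \<le> t powr 1" using d by (intro powr_mono) auto
        then show ?thesis using t by simp
      qed
      show "cmod ?w \<le> (b + 1) * \<bar>t - 1\<bar> * min 1 t powr (- (b + 2)) * cmod (1 - \<i> * z) powr (- (b + 1))"
        by (rule cmod_powr_diff_le[OF z t b0 d])
    qed (use t in auto)
    also have "\<dots> = test_diff_const b t * cmod (bergman_test (b + 1) z)"
      by (simp add: test_diff_const_def cmod_bergman_test)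
    finally show "cmod (h z) \<le> cmod (of_real (test_diff_const b t) * bergman_test (b + 1) z)"
      using C0 by (simp add: norm_mult)
  qed (use p in simp)
  also have "\<dots> = ennreal (test_diff_const b t powr p) * bergman_mass p \<alpha> (bergman_test (b + 1))"
    using C0 by (subst bergman_mass_cmult[OF holomorphic_bergman_test]) simp
  finally have h: "bergman_mass p \<alpha> h \<le> \<dots>" .
  have "bergman_mass p \<alpha> (\<lambda>z. dilate b t ?T z - ?T z) = bergman_mass p \<alpha> (\<lambda>z. h z + (?c - 1) * ?T z)"
    by (rule bergman_mass_cong) (simp add: h_def algebra_simps)
  also have "\<dots> \<le> ennreal ((1/2) powr (1 - p)) * bergman_mass p \<alpha> h
      + ennreal ((1 - 1/2) powr (1 - p)) * bergman_mass p \<alpha> (\<lambda>z. (?c - 1) * ?T z)"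
    by (rule bergman_mass_add_le[OF p _ _ holh]) (auto intro!: holomorphic_intros holT)
  also have "1 - 1/2 = (1/2 :: real)" by simp
  also have "(1/2) powr (1 - p) = 2 powr (p - 1)"
    by (simp add: powr_divide powr_diff)
  also have "bergman_mass p \<alpha> (\<lambda>z. (?c - 1) * ?T z) = ennreal (\<bar>t powr d - 1\<bar> powr p) * bergman_mass p \<alpha> ?T"
    using norm_of_real[of "t powr d - 1", where ?'a=complex]
    by (subst bergman_mass_cmult[OF holT]) simp
  finally have "bergman_mass p \<alpha> (\<lambda>z. dilate b t ?T z - ?T z)
      \<le> ennreal (2 powr (p - 1)) * (bergman_mass p \<alpha> h + ennreal (\<bar>t powr d - 1\<bar> powr p) * bergman_mass p \<alpha> ?T)"
    by (simp only: distrib_left)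
  also have "\<dots> \<le> ennreal (2 powr (p - 1)) *
      (ennreal (test_diff_const b t powr p) * bergman_mass p \<alpha> (bergman_test (b + 1))
      + ennreal (\<bar>t powr d - 1\<bar> powr p) * bergman_mass p \<alpha> ?T)"
    by (intro mult_left_mono add_mono h order_refl) simp
  finally show ?thesis .
qed

section \<open>From the operator norm to an inequality between masses\<close>

lemma hausdorff_op_cmult: "hausdorff_op \<phi> (\<lambda>z. c * f z) z = c * hausdorff_op \<phi> f z"
proof -
  have "hausdorff_op \<phi> (\<lambda>z. c * f z) z
      = (LINT t:{0<..}|lebesgue. c * (f (z / of_real t) * (\<phi> t / of_real t)))"
    by (simp add: hausdorff_op_def mult.assoc)
  then show ?thesis by (simp only: hausdorff_op_def set_integral_mult_right)
qed

lemma bergman_norm_cmult: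
  assumes "0 < p"
  shows "bergman_norm p \<alpha> (\<lambda>z. c * f z) = cmod c * bergman_norm p \<alpha> f"
proof -
  let ?I = "\<lambda>f. LINT z:upper_half_plane|lborel. cmod (f z) powr p * Im z powr (\<alpha> - 1)"
  have "?I (\<lambda>z. c * f z) = (LINT z:upper_half_plane|lborel. cmod c powr p * (cmod (f z) powr p * Im z powr (\<alpha> - 1)))"
    by (simp add: norm_mult powr_mult mult.assoc)
  also have "\<dots> = cmod c powr p * ?I f" by (rule set_integral_mult_right)
  finally have "bergman_norm p \<alpha> (\<lambda>z. c * f z) = (cmod c powr p * ?I f) powr (1 / p)"
    by (simp add: bergman_norm_def)
  also have "\<dots> = (cmod c powr p) powr (1 / p) * ?I f powr (1 / p)"
    by (rule powr_mult)
  finally show ?thesis using assms by (simp add: bergman_norm_def powr_powr)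
qed

lemma bergman_space_cmult:
  assumes "f \<in> bergman_space p \<alpha>"
  shows "(\<lambda>z. c * f z) \<in> bergman_space p \<alpha>"
  using assms by (auto simp: bergman_space_iff bergman_mass_cmult ennreal_mult_less_top intro!: holomorphic_intros)

lemma hausdorff_norm_bound:
  assumes p: "0 < p" and B: "hausdorff_norm p \<alpha> \<phi> = ennreal B" "0 \<le> B"
    and f: "f \<in> bergman_space p \<alpha>" and pos: "0 < bergman_norm p \<alpha> f"
  shows "bergman_norm p \<alpha> (hausdorff_op \<phi> f) \<le> B * bergman_norm p \<alpha> f"
proof -
  let ?n = "bergman_norm p \<alpha> f"
  let ?g = "\<lambda>z. of_real (1 / ?n) * f z"
  have *: "bergman_norm p \<alpha> ?g = 1"
    using pos by (subst bergman_norm_cmult[OF p]) (simp add: norm_divide)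
  have "?g \<in> {f \<in> bergman_space p \<alpha>. bergman_norm p \<alpha> f \<le> 1}"
    using bergman_space_cmult[OF f, of "of_real (1 / ?n)"] by (simp only: mem_Collect_eq * order_refl)
  then have "ennreal (bergman_norm p \<alpha> (hausdorff_op \<phi> ?g)) \<le> hausdorff_norm p \<alpha> \<phi>"
    unfolding hausdorff_norm_def by (rule SUP_upper)
  then have "bergman_norm p \<alpha> (hausdorff_op \<phi> ?g) \<le> B" using B by simp
  also have "hausdorff_op \<phi> ?g = (\<lambda>z. of_real (1 / ?n) * hausdorff_op \<phi> f z)"
    by (rule ext) (rule hausdorff_op_cmult)
  also have "bergman_norm p \<alpha> \<dots> = bergman_norm p \<alpha> (hausdorff_op \<phi> f) / ?n"
    using pos by (subst bergman_norm_cmult[OF p]) (simp add: norm_divide)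
  finally show ?thesis using pos by (simp add: pos_divide_le_eq)
qed

text \<open>\<open>Hf\<close> lets the norm of the image be read as its mass; for an image outside
  the space \<open>bergman_norm\<close> would be 0 and bound nothing.\<close>

lemma bergman_mass_hausdorff_op_le_norm:
  assumes p: "1 \<le> p" and B: "hausdorff_norm p \<alpha> \<phi> = ennreal B" "0 \<le> B"
    and f: "f \<in> bergman_space p \<alpha>" and pos: "0 < bergman_mass p \<alpha> f"
    and Hf: "hausdorff_op \<phi> f \<in> bergman_space p \<alpha>"
  shows "bergman_mass p \<alpha> (hausdorff_op \<phi> f) \<le> ennreal (B powr p) * bergman_mass p \<alpha> f"
proof -
  let ?n = "bergman_norm p \<alpha> f"
  have p0: "p > 0" using p by simp
  have "?n \<noteq> 0" using pos bergman_mass_eq_norm[OF f p0] by auto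
  then have n: "?n > 0" using bergman_norm_nonneg[of p \<alpha> f] by linarith
  have "bergman_mass p \<alpha> (hausdorff_op \<phi> f) = ennreal (bergman_norm p \<alpha> (hausdorff_op \<phi> f) powr p)"
    by (rule bergman_mass_eq_norm[OF Hf p0])
  also have "\<dots> \<le> ennreal ((B * ?n) powr p)"
    using hausdorff_norm_bound[OF p0 B f n] p by (intro ennreal_leI powr_mono2) auto
  also have "\<dots> = ennreal (B powr p) * bergman_mass p \<alpha> f"
    using B n by (simp add: bergman_mass_eq_norm[OF f p0] powr_mult ennreal_mult)
  finally show ?thesis .
qed

text \<open>The test functions are approximate eigenvectors with eigenvalue A: the mass of the error
  is at most K^(p-1) \<open>E n\<close> times that of \<open>T n\<close>, and \<open>E n\<close>
  tends to 0.\<close>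

lemma hausdorff_norm_lower:
  fixes p \<alpha> b :: real and \<phi> :: "real \<Rightarrow> complex"
  assumes p: "1 \<le> p" and \<alpha>: "0 < \<alpha>" and b: "b = (1 + \<alpha>) / p"
    and int: "integrable lebesgue (hausdorff_density b \<phi>)"
  shows "ennreal (cmod (\<integral>t. hausdorff_density b \<phi> t \<partial>lebesgue)) \<le> hausdorff_norm p \<alpha> \<phi>"
proof -
  define \<psi> where "\<psi> = hausdorff_density b \<phi>"
  define K where "K = (\<integral>t. cmod (\<psi> t) \<partial>lebesgue)"
  define A where "A = (\<integral>t. \<psi> t \<partial>lebesgue)"
  define B where "B = enn2real (hausdorff_norm p \<alpha> \<phi>)"
  have b0: "b > 0" and p0: "p > 0" using p \<alpha> b by auto
  have "hausdorff_norm p \<alpha> \<phi> < \<infinity>"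
    using hausdorff_boundedI[OF p \<alpha> b int] by (simp add: hausdorff_bounded_def)
  then have B: "hausdorff_norm p \<alpha> \<phi> = ennreal B" by (simp add: B_def)
  have B0: "B \<ge> 0" by (simp add: B_def)
  have \<psi>int: "integrable lebesgue \<psi>" using int by (simp add: \<psi>_def)
  then have [measurable]: "\<psi> \<in> borel_measurable lebesgue" by auto
  have K0: "K \<ge> 0" by (simp add: K_def)
  define \<delta> where "\<delta> = (\<lambda>n. 1 / real (Suc n))"
  have \<delta>: "0 < \<delta> n" "\<delta> n \<le> 1" for n by (auto simp: \<delta>_def)
  define T where "T = (\<lambda>n. bergman_test (b + \<delta> n))"
  have Ts: "T n \<in> bergman_space p \<alpha>" for n
    unfolding T_def b by (rule bergman_test_in_space[OF p \<alpha> \<delta>(1)])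
  have holT: "T n holomorphic_on upper_half_plane" for n
    unfolding T_def by (rule holomorphic_bergman_test)
  define M where "M = (\<lambda>n. bergman_norm p \<alpha> (T n) powr p)"
  have massT: "bergman_mass p \<alpha> (T n) = ennreal (M n)" for n
    unfolding M_def by (rule bergman_mass_eq_norm[OF Ts p0])
  define c where "c = 2 * 3 powr (- (1 + \<alpha> + p)) / p"
  have c: "c > 0" using p by (simp add: c_def)
  have Mge: "c * real (Suc n) \<le> M n" for n
  proof -
    have "ennreal (2 * 3 powr (- (1 + \<alpha> + p)) / (p * \<delta> n)) \<le> ennreal (M n)"
      unfolding massT[symmetric] T_def b by (rule bergman_mass_test_lower[OF p \<alpha> \<delta>])
    moreover have "2 * 3 powr (- (1 + \<alpha> + p)) / (p * \<delta> n) = c * real (Suc n)"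
      by (simp add: c_def \<delta>_def)
    ultimately show ?thesis by (simp add: M_def)
  qed
  have Mpos: "M n > 0" for n
    using Mge[of n] c by (smt (verit) mult_pos_pos of_nat_0_less_iff zero_less_Suc)
  have Minf: "filterlim M at_top sequentially"
  proof (rule filterlim_at_top_mono)
    show "filterlim (\<lambda>n. c * real (Suc n)) at_top sequentially"
      using c by (intro filterlim_tendsto_pos_mult_at_top[OF tendsto_const]
        filterlim_compose[OF filterlim_real_sequentially filterlim_Suc])
  qed (use Mge in simp)
  define M1 where "M1 = bergman_norm p \<alpha> (bergman_test (b + 1)) powr p"
  have mass1: "bergman_mass p \<alpha> (bergman_test (b + 1)) = ennreal M1"
    unfolding M1_def using bergman_test_in_space[OF p \<alpha>, of 1] p0
    by (intro bergman_mass_eq_norm) (auto simp: b)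
  have M10: "M1 \<ge> 0" by (simp add: M1_def)
  \<comment> \<open>The first entry is the bound uniform in t and provides the majorant; the second
    tends to 0 for each fixed t > 0, because \<open>M n\<close> tends to infinity and t powr
    \<delta> n to 1.\<close>
  define r where "r = (\<lambda>n t. min (2 * 2 powr (p - 1))
    (2 powr (p - 1) * (test_diff_const b t powr p * M1 / M n + \<bar>t powr \<delta> n - 1\<bar> powr p)))"
  have r0: "r n t \<ge> 0" for n t
    using M10 less_imp_le[OF Mpos[of n]] by (auto simp: r_def)
  have diff: "bergman_mass p \<alpha> (\<lambda>z. dilate b t (T n) z - T n z) \<le> ennreal (r n t * M n)" if t: "t > 0" for n t
  proof -
    have 1: "bergman_mass p \<alpha> (\<lambda>z. dilate b t (T n) z - T n z) \<le> ennreal (2 * 2 powr (p - 1) * M n)"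
      using bergman_mass_dilate_diff_le[OF p holT t, of \<alpha> n] less_imp_le[OF Mpos[of n]]
      by (simp add: b[symmetric] massT ennreal_mult)
    have "bergman_mass p \<alpha> (\<lambda>z. dilate b t (T n) z - T n z)
        \<le> ennreal (2 powr (p - 1)) * (ennreal (test_diff_const b t powr p) * ennreal M1
          + ennreal (\<bar>t powr \<delta> n - 1\<bar> powr p) * ennreal (M n))"
      unfolding massT[symmetric] mass1[symmetric] T_def
      by (rule bergman_mass_dilate_test_diff_le[OF p \<alpha> b t \<delta>])
    also have "\<dots> = ennreal (2 powr (p - 1) * (test_diff_const b t powr p * M1 + \<bar>t powr \<delta> n - 1\<bar> powr p * M n))"
      using M10 less_imp_le[OF Mpos[of n]] by (subst ennreal_mult ennreal_plus | simp)+
    also have "2 powr (p - 1) * (test_diff_const b t powr p * M1 + \<bar>t powr \<delta> n - 1\<bar> powr p * M n)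
        = 2 powr (p - 1) * (test_diff_const b t powr p * M1 / M n + \<bar>t powr \<delta> n - 1\<bar> powr p) * M n"
      using Mpos[of n] by (simp add: field_simps)
    finally have 2: "bergman_mass p \<alpha> (\<lambda>z. dilate b t (T n) z - T n z)
        \<le> ennreal (2 powr (p - 1) * (test_diff_const b t powr p * M1 / M n + \<bar>t powr \<delta> n - 1\<bar> powr p) * M n)" .
    show ?thesis using 1 2 by (simp add: r_def min_def)
  qed
  have rm[measurable]: "r n \<in> borel_measurable lebesgue" for n
    unfolding r_def test_diff_const_def by (rule measurable_completion) measurable
  define E where "E = (\<lambda>n. \<integral>t. cmod (\<psi> t) * r n t \<partial>lebesgue)"
  have le_r: "cmod (\<psi> t) * r n t \<le> 2 * 2 powr (p - 1) * cmod (\<psi> t)" for n t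
    using mult_left_mono[of "r n t" "2 * 2 powr (p - 1)" "cmod (\<psi> t)"] by (simp add: r_def mult.commute)
  have rint: "integrable lebesgue (\<lambda>t. cmod (\<psi> t) * r n t)" for n
  proof (rule Bochner_Integration.integrable_bound[where f="\<lambda>t. 2 * 2 powr (p - 1) * cmod (\<psi> t)"])
    show "AE t in lebesgue. norm (cmod (\<psi> t) * r n t) \<le> norm (2 * 2 powr (p - 1) * cmod (\<psi> t))"
      using le_r r0 by (intro AE_I2) (simp add: abs_mult)
  qed (use \<psi>int in auto)
  have "E \<longlonglongrightarrow> (\<integral>t. 0 \<partial>(lebesgue :: real measure))"
    unfolding E_def
  proof (rule integral_dominated_convergence[where w="\<lambda>t. 2 * 2 powr (p - 1) * cmod (\<psi> t)"])
    show "AE t in lebesgue. (\<lambda>n. cmod (\<psi> t) * r n t) \<longlonglongrightarrow> 0"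
    proof (rule AE_I2)
      fix t :: real
      show "(\<lambda>n. cmod (\<psi> t) * r n t) \<longlonglongrightarrow> 0"
      proof (cases "t > 0")
        case False
        then show ?thesis by (simp add: \<psi>_def hausdorff_density_def)
      next
        case True
        have \<delta>0: "\<delta> \<longlonglongrightarrow> 0"
          unfolding \<delta>_def by (rule LIMSEQ_inverse_real_of_nat[unfolded inverse_eq_divide])
        have "(\<lambda>n. t powr \<delta> n) \<longlonglongrightarrow> t powr 0"
          using True by (intro tendsto_powr tendsto_const \<delta>0) auto
        then have "(\<lambda>n. \<bar>t powr \<delta> n - 1\<bar>) \<longlonglongrightarrow> \<bar>t powr 0 - 1\<bar>"
          by (rule tendsto_rabs[OF tendsto_diff[OF _ tendsto_const]])
        then have "(\<lambda>n. \<bar>t powr \<delta> n - 1\<bar>) \<longlonglongrightarrow> 0" using True by simp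
        then have "(\<lambda>n. \<bar>t powr \<delta> n - 1\<bar> powr p) \<longlonglongrightarrow> 0 powr p"
          using p0 by (intro tendsto_powr' tendsto_const) auto
        then have 1: "(\<lambda>n. \<bar>t powr \<delta> n - 1\<bar> powr p) \<longlonglongrightarrow> 0" using p0 by simp
        have 2: "(\<lambda>n. test_diff_const b t powr p * M1 / M n) \<longlonglongrightarrow> 0"
          by (rule real_tendsto_divide_at_top[OF tendsto_const Minf])
        have "(\<lambda>n. cmod (\<psi> t) * r n t) \<longlonglongrightarrow> cmod (\<psi> t) * min (2 * 2 powr (p - 1)) (2 powr (p - 1) * (0 + 0))"
          unfolding r_def by (intro tendsto_mult tendsto_min tendsto_add tendsto_const 1 2)
        then show ?thesis by (simp add: min_def)
      qed
    qed
    show "AE t in lebesgue. norm (cmod (\<psi> t) * r n t) \<le> 2 * 2 powr (p - 1) * cmod (\<psi> t)" for n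
      using le_r r0 by (intro AE_I2) (simp add: abs_mult)
  qed (use \<psi>int in auto)
  then have E: "E \<longlonglongrightarrow> 0" by simp
  have E0: "E n \<ge> 0" for n unfolding E_def using r0 by simp
  have HT: "hausdorff_op \<phi> (T n) \<in> bergman_space p \<alpha>" for n
    by (rule hausdorff_op_bergman_space[OF p \<alpha> b int Ts])
  have hol: "(\<lambda>z. hausdorff_op \<phi> (T n) z - A * T n z) holomorphic_on upper_half_plane" for n
    using HT[of n] holT[of n] by (auto simp: bergman_space_iff intro!: holomorphic_intros)
  have approx: "bergman_mass p \<alpha> (\<lambda>z. hausdorff_op \<phi> (T n) z - A * T n z)
      \<le> ennreal (K powr (p - 1) * (E n * M n))" for n
  proof -
    let ?u = "upper_part (T n)"
    \<comment> \<open>Since A is the integral of \<psi>, subtracting A \<open>T n\<close> amounts to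
      subtracting \<open>T n\<close> under the integral, and \<open>minkowski_kernel_bound\<close>
      applies to the difference kernel.\<close>
    let ?k = "\<lambda>z t. dilate b t ?u z - ?u z"
    let ?h = "\<lambda>z. \<integral>t. ?k z t * \<psi> t \<partial>lebesgue"
    have um: "?u \<in> borel_measurable borel" by (rule borel_measurable_upper_part[OF holT])
    interpret L: sigma_finite_measure "lebesgue :: real measure" by (rule lebesgue_sigma_finite)
    have "(\<lambda>(z, t). ?u z) \<in> borel_measurable (bergman_measure \<alpha> \<Otimes>\<^sub>M lebesgue)"
      unfolding case_prod_unfold using um by measurable
    then have km: "(\<lambda>(z, t). ?k z t) \<in> borel_measurable (bergman_measure \<alpha> \<Otimes>\<^sub>M lebesgue)"
      using borel_measurable_diff[OF borel_measurable_dilate_pair[OF um]]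
      by (simp add: case_prod_unfold)
    have "(\<lambda>(z, t). ?k z t * \<psi> t) \<in> borel_measurable (bergman_measure \<alpha> \<Otimes>\<^sub>M lebesgue)"
      using borel_measurable_times[OF km measurable_compose[OF measurable_snd], of \<psi>]
      by (simp add: case_prod_unfold)
    then have "?h \<in> borel_measurable (bergman_measure \<alpha>)"
      by (rule L.borel_measurable_lebesgue_integral)
    then have hm: "?h \<in> borel_measurable borel"
      by (simp add: measurable_cong_sets[OF sets_bergman_measure refl])
    have "hausdorff_op \<phi> (T n) z - A * T n z = ?h z" if z: "z \<in> upper_half_plane" for z
    proof -
      have i1: "integrable lebesgue (\<lambda>t. dilate b t ?u z * \<psi> t)"
        unfolding \<psi>_def by (rule integrable_dilate[OF p \<alpha> b int Ts z])
      have i2: "integrable lebesgue (\<lambda>t. T n z * \<psi> t)" using \<psi>int by simp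
      have "?h z = (\<integral>t. dilate b t ?u z * \<psi> t - T n z * \<psi> t \<partial>lebesgue)"
        using z by (simp add: left_diff_distrib)
      also have "\<dots> = hausdorff_op \<phi> (T n) z - T n z * A"
        using i1 i2 by (simp add: hausdorff_op_eq[OF z, of _ _ b] A_def flip: \<psi>_def)
      finally show ?thesis by (simp add: mult.commute)
    qed
    then have "bergman_mass p \<alpha> (\<lambda>z. hausdorff_op \<phi> (T n) z - A * T n z) = bergman_mass p \<alpha> ?h"
      by (rule bergman_mass_cong)
    also have "\<dots> = (\<integral>\<^sup>+z. ennreal (cmod (?h z) powr p) \<partial>bergman_measure \<alpha>)"
      by (rule nn_integral_bergman_measure[symmetric, OF hm])
    also have "\<dots> \<le> ennreal (K powr (p - 1)) * (\<integral>\<^sup>+t. ennreal (cmod (\<psi> t)) *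
        (\<integral>\<^sup>+z. ennreal (cmod (?k z t) powr p) \<partial>bergman_measure \<alpha>) \<partial>lebesgue)"
      unfolding K_def
      by (rule minkowski_kernel_bound[OF sigma_finite_bergman_measure lebesgue_sigma_finite p km \<psi>int])
    also have "\<dots> \<le> ennreal (K powr (p - 1)) * (\<integral>\<^sup>+t. ennreal (M n) * ennreal (cmod (\<psi> t) * r n t) \<partial>lebesgue)"
    proof (intro mult_left_mono nn_integral_mono)
      fix t :: real
      show "ennreal (cmod (\<psi> t)) * (\<integral>\<^sup>+z. ennreal (cmod (?k z t) powr p) \<partial>bergman_measure \<alpha>)
          \<le> ennreal (M n) * ennreal (cmod (\<psi> t) * r n t)"
      proof (cases "t > 0")
        case False
        then show ?thesis by (simp add: \<psi>_def hausdorff_density_def)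
      next
        case True
        have "(\<lambda>z. ?k z t) \<in> borel_measurable borel"
          using um unfolding dilate_def by measurable
        then have "(\<integral>\<^sup>+z. ennreal (cmod (?k z t) powr p) \<partial>bergman_measure \<alpha>) = bergman_mass p \<alpha> (\<lambda>z. ?k z t)"
          by (rule nn_integral_bergman_measure)
        also have "\<dots> = bergman_mass p \<alpha> (\<lambda>z. dilate b t (T n) z - T n z)"
          using True by (intro bergman_mass_cong) (simp add: dilate_def divide_of_real_upper_half_plane)
        also have "\<dots> \<le> ennreal (r n t * M n)" by (rule diff[OF True])
        finally have "ennreal (cmod (\<psi> t)) * (\<integral>\<^sup>+z. ennreal (cmod (?k z t) powr p) \<partial>bergman_measure \<alpha>)
            \<le> ennreal (cmod (\<psi> t)) * ennreal (r n t * M n)"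
          by (rule mult_left_mono) simp
        also have "\<dots> = ennreal (M n * (cmod (\<psi> t) * r n t))"
          by (subst ennreal_mult'[symmetric]) (simp_all add: mult_ac)
        also have "\<dots> = ennreal (M n) * ennreal (cmod (\<psi> t) * r n t)"
          using less_imp_le[OF Mpos[of n]] by (rule ennreal_mult')
        finally show ?thesis .
      qed
    qed simp
    also have "(\<integral>\<^sup>+t. ennreal (M n) * ennreal (cmod (\<psi> t) * r n t) \<partial>lebesgue)
        = ennreal (M n) * (\<integral>\<^sup>+t. ennreal (cmod (\<psi> t) * r n t) \<partial>lebesgue)"
      by (rule nn_integral_cmult) measurable
    also have "(\<integral>\<^sup>+t. ennreal (cmod (\<psi> t) * r n t) \<partial>lebesgue) = ennreal (E n)"
      unfolding E_def using r0 by (intro nn_integral_eq_integral rint) auto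
    also have "ennreal (K powr (p - 1)) * (ennreal (M n) * ennreal (E n)) = ennreal (K powr (p - 1) * (E n * M n))"
      using less_imp_le[OF Mpos[of n]] E0[of n] by (simp add: mult.commute flip: ennreal_mult)
    finally show ?thesis .
  qed
  have step: "cmod A powr p \<le> l powr (1 - p) * B powr p + (1 - l) powr (1 - p) * (K powr (p - 1) * E n)"
    if l: "0 < l" "l < 1" for l n
  proof -
    let ?D = "\<lambda>z. hausdorff_op \<phi> (T n) z - A * T n z"
    \<comment> \<open>A \<open>T n\<close> is the image minus the error. The image receives the
      weight l, whose coefficient tends to 1 as l does.\<close>
    have "bergman_mass p \<alpha> (\<lambda>z. A * T n z) = bergman_mass p \<alpha> (\<lambda>z. hausdorff_op \<phi> (T n) z + (-1) * ?D z)"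
      by (rule bergman_mass_cong) simp
    also have "\<dots> \<le> ennreal (l powr (1 - p)) * bergman_mass p \<alpha> (hausdorff_op \<phi> (T n))
        + ennreal ((1 - l) powr (1 - p)) * bergman_mass p \<alpha> (\<lambda>z. (-1) * ?D z)"
      using HT[of n] by (intro bergman_mass_add_le p l holomorphic_on_mult holomorphic_on_const hol)
        (simp add: bergman_space_iff)
    also have "bergman_mass p \<alpha> (\<lambda>z. (-1) * ?D z) = bergman_mass p \<alpha> ?D"
      by (subst bergman_mass_cmult[OF hol]) simp
    also have "ennreal (l powr (1 - p)) * bergman_mass p \<alpha> (hausdorff_op \<phi> (T n))
        + ennreal ((1 - l) powr (1 - p)) * bergman_mass p \<alpha> ?D
      \<le> ennreal (l powr (1 - p)) * (ennreal (B powr p) * ennreal (M n))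
        + ennreal ((1 - l) powr (1 - p)) * ennreal (K powr (p - 1) * (E n * M n))"
      unfolding massT[symmetric]
    proof (intro add_mono mult_left_mono)
      show "bergman_mass p \<alpha> (hausdorff_op \<phi> (T n)) \<le> ennreal (B powr p) * bergman_mass p \<alpha> (T n)"
        using Mpos[of n] by (intro bergman_mass_hausdorff_op_le_norm[OF p B B0 Ts _ HT]) (simp add: massT)
      show "bergman_mass p \<alpha> ?D \<le> ennreal (K powr (p - 1) * (E n * M n))" by (rule approx)
    qed simp_all
    also have "\<dots> = ennreal ((l powr (1 - p) * B powr p + (1 - l) powr (1 - p) * (K powr (p - 1) * E n)) * M n)"
      using less_imp_le[OF Mpos[of n]] E0[of n]
      by (simp add: distrib_right mult.assoc flip: ennreal_mult ennreal_plus)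
    finally have "ennreal (cmod A powr p * M n)
        \<le> ennreal ((l powr (1 - p) * B powr p + (1 - l) powr (1 - p) * (K powr (p - 1) * E n)) * M n)"
      by (subst (asm) bergman_mass_cmult[OF holT]) (simp add: massT ennreal_mult')
    then have "cmod A powr p * M n
        \<le> (l powr (1 - p) * B powr p + (1 - l) powr (1 - p) * (K powr (p - 1) * E n)) * M n"
      using less_imp_le[OF Mpos[of n]] E0[of n] by (subst (asm) ennreal_le_iff) auto
    then show ?thesis using Mpos[of n] by simp
  qed
  \<comment> \<open>The limit in n comes first, at fixed l: for p > 1 the coefficient (1-l)^(1-p) of
    the error blows up as l tends to 1.\<close>
  have step2: "cmod A powr p \<le> l powr (1 - p) * B powr p" if l: "0 < l" "l < 1" for l
  proof (rule LIMSEQ_le_const)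
    have "(\<lambda>n. l powr (1 - p) * B powr p + (1 - l) powr (1 - p) * (K powr (p - 1) * E n))
        \<longlonglongrightarrow> l powr (1 - p) * B powr p + (1 - l) powr (1 - p) * (K powr (p - 1) * 0)"
      by (intro tendsto_intros E)
    then show "(\<lambda>n. l powr (1 - p) * B powr p + (1 - l) powr (1 - p) * (K powr (p - 1) * E n))
        \<longlonglongrightarrow> l powr (1 - p) * B powr p" by simp
  qed (use step[OF l] in auto)
  have "cmod A powr p \<le> B powr p"
  proof (rule tendsto_lowerbound)
    have "((\<lambda>l. l powr (1 - p) * B powr p) \<longlongrightarrow> 1 powr (1 - p) * B powr p) (at_left 1)"
      by (intro tendsto_intros) auto
    then show "((\<lambda>l. l powr (1 - p) * B powr p) \<longlongrightarrow> B powr p) (at_left 1)" by simp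
    show "\<forall>\<^sub>F l in at_left 1. cmod A powr p \<le> l powr (1 - p) * B powr p"
      using eventually_at_left_real[of 0 "1::real"] by (rule eventually_mono) (auto intro: step2)
  qed simp
  then have "(cmod A powr p) powr (1 / p) \<le> (B powr p) powr (1 / p)"
    using p0 by (intro powr_mono2[of "1 / p"]) auto
  moreover have "(cmod A powr p) powr (1 / p) = cmod A" "(B powr p) powr (1 / p) = B"
    using p0 B0 by (simp_all add: powr_powr)
  ultimately have "cmod A \<le> B" by (simp only:)
  then show ?thesis unfolding B by (simp add: A_def \<psi>_def ennreal_leI)
qed

subsection \<open>Necessity for nonnegative densities\<close>

text \<open>The real part is |w|^(-g) cos (g Arg w). In the right half-plane Arg w is arctan (Im w /
  Re w), so the hypothesis gives g |Arg w| \<le> 1 \<le> pi / 3, where the cosine is at least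
  1/2.\<close>

lemma Re_powr_ge_half:
  fixes w :: complex and g :: real
  assumes w: "0 < Re w" and g: "0 \<le> g" and arg: "g * \<bar>Im w\<bar> \<le> Re w"
  shows "cmod w powr (- g) / 2 \<le> Re (w powr of_real (- g))"
proof -
  have w0: "w \<noteq> 0" using w by auto
  have ln: "Ln w = Complex (ln (cmod w)) (Arg w)"
    using w0 by (simp add: complex_eq_iff Arg_eq_Im_Ln)
  have "w powr of_real (- g) = exp (of_real (- g) * Ln w)"
    using w0 by (simp add: powr_def)
  then have "Re (w powr of_real (- g)) = exp (- g * ln (cmod w)) * cos (g * Arg w)"
    by (simp add: ln Re_exp)
  also have "exp (- g * ln (cmod w)) = cmod w powr (- g)"
    using w0 by (simp add: powr_def)
  finally have eq: "Re (w powr of_real (- g)) = cmod w powr (- g) * cos (g * Arg w)" .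
  have at: "\<bar>arctan x\<bar> \<le> \<bar>x\<bar>" for x :: real
    using arctan_le_self[of x] arctan_le_self[of "-x"] by (cases "x \<ge> 0") (auto simp: arctan_minus)
  have argle: "\<bar>Arg w\<bar> \<le> \<bar>Im w / Re w\<bar>" unfolding arg_conv_arctan[OF w] by (rule at)
  have "\<bar>g * Arg w\<bar> = g * \<bar>Arg w\<bar>" using g by (simp add: abs_mult)
  also have "\<dots> \<le> g * \<bar>Im w / Re w\<bar>" by (rule mult_left_mono[OF argle g])
  also have "\<dots> \<le> 1" using arg w by (simp add: field_simps)
  also have "\<dots> \<le> pi / 3" using pi_gt3 by simp
  finally have "cos (pi / 3) \<le> cos \<bar>g * Arg w\<bar>"
    by (intro cos_monotone_0_pi_le) auto
  then have "1 / 2 \<le> cos (g * Arg w)" by (simp add: cos_60)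
  then have "cmod w powr (- g) * (1 / 2) \<le> cmod w powr (- g) * cos (g * Arg w)"
    by (rule mult_left_mono) simp
  then show ?thesis unfolding eq by simp
qed

text \<open>For w = t - \<i> z one has Re w = t + Im z and |Im w| = |Re z|, so the aperture 1 / (b +
  1) is what \<open>Re_powr_ge_half\<close> asks for at exponents up to b + 1. The 6 is 2 from that
  lemma times 3 from t^(1/N) \<ge> 1/3.\<close>

lemma Re_dilate_test_ge:
  fixes N :: real
  assumes N: "1 \<le> N" and b: "0 < b" and t: "t \<in> {1 / N..N}"
    and z: "N \<le> Im z" "\<bar>Re z\<bar> \<le> 1 / (b + 1) * Im z"
  shows "(cmod z + N) powr (- (b + 1 / N)) / 6 \<le> Re (dilate b t (bergman_test (b + 1 / N)) z)"
proof -
  let ?d = "1 / N"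
  let ?g = "b + ?d"
  let ?w = "of_real t - \<i> * z"
  have t0: "0 < t" using N t by (auto intro: less_le_trans[of 0 "1 / N"])
  have d: "0 < ?d" "?d \<le> 1" using N by auto
  have w: "0 < Re ?w" "Im z \<le> Re ?w" using N t0 z by auto
  have "?g * \<bar>Im ?w\<bar> \<le> (b + 1) * (1 / (b + 1) * Im z)"
    using b d z(2) by (intro mult_mono) auto
  also have "\<dots> \<le> Re ?w" using b w(2) by simp
  finally have half: "cmod ?w powr (- ?g) / 2 \<le> Re (?w powr of_real (- ?g))"
    using w(1) b d by (intro Re_powr_ge_half) auto
  have "cmod ?w \<le> cmod z + N"
    using norm_triangle_ineq4[of "of_real t" "\<i> * z"] t0 t by (simp add: norm_mult)
  moreover have "0 < cmod ?w" using abs_Re_le_cmod[of ?w] w(1) by linarith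
  ultimately have le: "(cmod z + N) powr (- ?g) \<le> cmod ?w powr (- ?g)"
    using b d by (intro powr_mono2'[of "- ?g"]) linarith+
  \<comment> \<open>N^(1/N) = exp (ln N / N) \<le> e \<le> 3, so t^(1/N) \<ge> N^(-1/N) \<ge> 1/3
    for all t \<ge> 1 / N.\<close>
  have "ln N / N \<le> 1" using ln_le_minus_one[of N] N by simp
  then have "exp (ln N / N) \<le> 3" using exp_le by (meson exp_le_cancel_iff order_trans)
  then have "1 / 3 \<le> 1 / exp (ln N / N)" by (intro divide_left_mono) auto
  also have "exp (ln N / N) = N powr ?d"
    using N by (simp add: powr_def)
  also have "1 / N powr ?d = (1 / N) powr ?d"
    using N by (simp add: powr_divide)
  also have "\<dots> \<le> t powr ?d" using t N d by (intro powr_mono2) auto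
  finally have td: "1 / 3 \<le> t powr ?d" .
  have "(cmod z + N) powr (- ?g) / 6 = 1 / 3 * ((cmod z + N) powr (- ?g) / 2)" by simp
  also have "\<dots> \<le> t powr ?d * Re (?w powr of_real (- ?g))"
  proof (rule mult_mono[OF td])
    show "(cmod z + N) powr (- ?g) / 2 \<le> Re (?w powr of_real (- ?g))"
      using le half by linarith
  qed auto
  also have "\<dots> = Re (dilate b t (bergman_test ?g) z)"
    unfolding dilate_bergman_test[OF t0] by simp
  finally show ?thesis .
qed

text \<open>For t outside [1 / N, N] only the sign matters: it allows the integral over all t to be
  bounded below by its part over that interval.\<close>

lemma Re_dilate_test_nonneg:
  assumes b: "0 < b" "0 < d" "d \<le> 1" and t: "0 < t"
    and z: "0 < Im z" "\<bar>Re z\<bar> \<le> 1 / (b + 1) * Im z"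
  shows "0 \<le> Re (dilate b t (bergman_test (b + d)) z)"
proof -
  let ?w = "of_real t - \<i> * z"
  have "(b + d) * \<bar>Im ?w\<bar> \<le> (b + 1) * (1 / (b + 1) * Im z)"
    using b z(2) by (intro mult_mono) auto
  also have "\<dots> \<le> Re ?w" using b t by simp
  finally have "cmod ?w powr (- (b + d)) / 2 \<le> Re (?w powr of_real (- (b + d)))"
    using z t b by (intro Re_powr_ge_half) auto
  then have "0 \<le> Re (?w powr of_real (- (b + d)))"
    by (rule order_trans[rotated]) simp
  then show ?thesis unfolding dilate_bergman_test[OF t] by simp
qed

lemma borel_measurable_truncated_density:
  assumes "\<phi> \<in> borel_measurable (lebesgue_on {0<..})"
  shows "(\<lambda>t. ennreal (indicator {x..y::real} t * cmod (hausdorff_density b \<phi> t))) \<in> borel_measurable lebesgue"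
proof -
  have "(indicator {x..y} :: real \<Rightarrow> real) \<in> borel_measurable lebesgue"
    by (rule borel_measurable_indicator) simp
  then have "(\<lambda>t. indicator {x..y} t * cmod (hausdorff_density b \<phi> t)) \<in> borel_measurable lebesgue"
    by (rule borel_measurable_times[OF _ measurable_compose[OF
        borel_measurable_hausdorff_density[OF assms] borel_measurable_norm]])
  then show ?thesis by (rule measurable_compose[OF _ measurable_ennreal])
qed

text \<open>In the sector the image of the test function has real part at least a (|z| + N)^(-(b+d))
  / 6, with a the truncated integral. The p-th power is integrated over the sector and compared with
  B^p times the mass of the test function. \<open>D\<close> collects 6^(-p) and the constants of
  \<open>nn_integral_test_lower\<close> for c = 1 / (b + 1) and n = N, using p d \<le> p and N^(-p
  d) \<ge> 3^(-p).\<close>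

lemma truncated_density_integral_bound:
  fixes p \<alpha> b N :: real and \<phi> :: "real \<Rightarrow> complex"
  assumes p: "1 \<le> p" and \<alpha>: "0 < \<alpha>" and b: "b = (1 + \<alpha>) / p"
    and meas: "\<phi> \<in> borel_measurable (lebesgue_on {0<..})"
    and pos: "\<And>t. 0 < t \<Longrightarrow> \<phi> t \<in> \<real>\<^sub>\<ge>\<^sub>0"
    and bdd: "hausdorff_bounded p \<alpha> \<phi>" and N: "1 \<le> N"
    and B: "hausdorff_norm p \<alpha> \<phi> = ennreal B" "0 \<le> B"
  defines "D \<equiv> 6 powr (- p) * (2 * (1 / (b + 1)) * 3 powr (- (1 + \<alpha> + p)) * 3 powr (- p) / p)"
  shows "(\<integral>\<^sup>+t. ennreal (indicator {1 / N..N} t * cmod (hausdorff_density b \<phi> t)) \<partial>lebesgue)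
    \<le> ennreal ((B powr p * ((2 + 2 / \<alpha>) * (1 / \<alpha> + 1)) / D) powr (1 / p))"
proof -
  define \<psi> where "\<psi> = hausdorff_density b \<phi>"
  define d where "d = 1 / N"
  define T where "T = bergman_test (b + d)"
  define c where "c = 1 / (b + 1)"
  define S where "S = {z. N \<le> Im z \<and> \<bar>Re z\<bar> \<le> c * Im z}"
  define a where "a = (\<integral>\<^sup>+t. ennreal (indicator {1 / N..N} t * cmod (\<psi> t)) \<partial>lebesgue)"
  define C0 where "C0 = (2 + 2 / \<alpha>) * (1 / \<alpha> + 1)"
  let ?H = "hausdorff_op \<phi> T"
  have p0: "p > 0" and b0: "b > 0" using p \<alpha> b by auto
  have d: "0 < d" "d \<le> 1" using N by (auto simp: d_def)
  have c: "0 < c" "c \<le> 1" using b0 by (auto simp: c_def)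
  have [measurable]: "\<psi> \<in> borel_measurable lebesgue"
    unfolding \<psi>_def by (rule borel_measurable_hausdorff_density[OF meas])
  have \<psi>pos: "\<psi> t = of_real (cmod (\<psi> t))" for t
  proof (cases "t > 0")
    case True
    have "\<phi> t = of_real (cmod (\<phi> t))" using pos[OF True] by (auto elim!: nonneg_Reals_cases)
    then show ?thesis using True
      by (simp add: \<psi>_def hausdorff_density_def norm_mult)
  qed (simp add: \<psi>_def hausdorff_density_def)
  have Ts: "T \<in> bergman_space p \<alpha>"
    unfolding T_def b by (rule bergman_test_in_space[OF p \<alpha> d(1)])
  have HT: "?H \<in> bergman_space p \<alpha>" and wd: "hausdorff_well_defined \<phi> T"
    using bdd Ts by (auto simp: hausdorff_bounded_def)
  have SU: "z \<in> upper_half_plane" if "z \<in> S" for z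
    using that N by (auto simp: S_def mem_upper_half_plane)
  have lower: "ennreal ((cmod z + N) powr (- (b + d)) / 6) * a \<le> ennreal (Re (?H z))" if z: "z \<in> S" for z
  proof -
    let ?k = "\<lambda>t. dilate b t (upper_part T) z"
    have int: "integrable lebesgue (\<lambda>t. ?k t * \<psi> t)"
      using wd SU[OF z] by (simp add: hausdorff_well_defined_iff[of _ _ b] \<psi>_def)
    have kT: "?k t = dilate b t T z" if "t > 0" for t
      using that SU[OF z] by (simp add: dilate_def divide_of_real_upper_half_plane)
    have Re: "Re (?k t * \<psi> t) = Re (?k t) * cmod (\<psi> t)" for t
      by (subst \<psi>pos) simp
    have nn: "0 \<le> Re (?k t * \<psi> t)" for t
    proof (cases "t > 0")
      case True
      have "0 \<le> Re (dilate b t T z)" unfolding T_def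
        using z SU[OF z] by (intro Re_dilate_test_nonneg b0 d True) (auto simp: S_def c_def mem_upper_half_plane)
      then show ?thesis by (subst Re, subst kT[OF True]) (rule mult_nonneg_nonneg, simp_all)
    qed (simp add: \<psi>_def hausdorff_density_def)
    have "ennreal ((cmod z + N) powr (- (b + d)) / 6) * a
        = (\<integral>\<^sup>+t. ennreal ((cmod z + N) powr (- (b + d)) / 6) * ennreal (indicator {1 / N..N} t * cmod (\<psi> t)) \<partial>lebesgue)"
      unfolding a_def \<psi>_def
      by (rule nn_integral_cmult[symmetric, OF borel_measurable_truncated_density[OF meas]])
    also have "\<dots> \<le> (\<integral>\<^sup>+t. ennreal (Re (?k t * \<psi> t)) \<partial>lebesgue)"
    proof (rule nn_integral_mono)
      fix t :: real
      have "(cmod z + N) powr (- (b + d)) / 6 * (indicator {1 / N..N} t * cmod (\<psi> t)) \<le> Re (?k t * \<psi> t)"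
      proof (cases "t \<in> {1 / N..N}")
        case True
        then have t0: "t > 0" using N by (auto intro: less_le_trans[of 0 "1 / N"])
        have "(cmod z + N) powr (- (b + d)) / 6 \<le> Re (dilate b t T z)"
          unfolding T_def d_def
          using z by (intro Re_dilate_test_ge N b0 True) (auto simp: S_def c_def)
        then have "(cmod z + N) powr (- (b + d)) / 6 * cmod (\<psi> t) \<le> Re (dilate b t T z) * cmod (\<psi> t)"
          by (rule mult_right_mono) simp
        then show ?thesis using True by (subst Re, subst kT[OF t0]) (simp only: indicator_simps mult_1)
      qed (use nn in simp)
      then show "ennreal ((cmod z + N) powr (- (b + d)) / 6) * ennreal (indicator {1 / N..N} t * cmod (\<psi> t))
          \<le> ennreal (Re (?k t * \<psi> t))"
        by (subst ennreal_mult'[symmetric]) (auto intro!: ennreal_leI)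
    qed
    also have "\<dots> = ennreal (\<integral>t. Re (?k t * \<psi> t) \<partial>lebesgue)"
      by (rule nn_integral_eq_integral[OF integrable_Re[OF int] AE_I2[OF nn]])
    also have "(\<integral>t. Re (?k t * \<psi> t) \<partial>lebesgue) = Re (?H z)"
      unfolding hausdorff_op_eq[OF SU[OF z], of _ _ b] \<psi>_def[symmetric] by (rule integral_Re[OF int])
    finally show ?thesis .
  qed
  \<comment> \<open>One point of the sector suffices for finiteness of \<open>a\<close>: the
    defining integral exists there, and its real part dominates a positive multiple of
    \<open>a\<close>.\<close>
  have iN: "\<i> * of_real N \<in> S" using N c by (simp add: S_def)
  have "a < \<infinity>"
  proof (rule ccontr)
    assume "\<not> a < \<infinity>"
    then have "a = \<infinity>" using less_top[of a] by auto
    moreover have "0 < (cmod (\<i> * of_real N) + N) powr (- (b + d)) / 6" using N by (simp add: norm_mult)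
    ultimately show False using lower[OF iN] by (simp add: ennreal_mult_top top_unique)
  qed
  then obtain x where x: "a = ennreal x" "0 \<le> x" by (cases a) auto
  have pt: "(x / 6) powr p * (cmod z + N) powr (- (1 + \<alpha> + p * d)) \<le> cmod (?H z) powr p" if z: "z \<in> S" for z
  proof -
    \<comment> \<open>\<open>ennreal\<close> sends negative reals to 0, so a negative real part
      would force the left side of \<open>lower\<close> to be 0; the bound by the modulus is then
      trivial.\<close>
    have "0 \<le> Re (?H z) \<or> (cmod z + N) powr (- (b + d)) / 6 * x = 0"
      using lower[OF z] x by (cases "0 \<le> Re (?H z)") (auto simp: ennreal_neg ennreal_mult[symmetric])
    then have "(cmod z + N) powr (- (b + d)) / 6 * x \<le> cmod (?H z)"
    proof
      assume "0 \<le> Re (?H z)"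
      then have "(cmod z + N) powr (- (b + d)) / 6 * x \<le> Re (?H z)"
        using lower[OF z] x by (simp add: ennreal_mult[symmetric])
      then show ?thesis using complex_Re_le_cmod[of "?H z"] by linarith
    next
      assume "(cmod z + N) powr (- (b + d)) / 6 * x = 0"
      then show ?thesis by (simp only: norm_ge_zero)
    qed
    then have "((cmod z + N) powr (- (b + d)) / 6 * x) powr p \<le> cmod (?H z) powr p"
      using p0 x by (intro powr_mono2) auto
    moreover have "((cmod z + N) powr (- (b + d)) / 6 * x) powr p
        = (x / 6) powr p * ((cmod z + N) powr (- (b + d))) powr p"
    proof -
      have "(cmod z + N) powr (- (b + d)) / 6 * x = (x / 6) * (cmod z + N) powr (- (b + d))" by simp
      then show ?thesis by (simp only: powr_mult)
    qed
    moreover have "- (b + d) * p = - (1 + \<alpha> + p * d)" using p0 b by (simp add: field_simps)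
    ultimately show ?thesis by (simp only: powr_powr)
  qed
  let ?q = "2 * c * 3 powr (- (1 + \<alpha> + p * d)) * (N powr (- (p * d)) / (p * d))"
  have [measurable]: "S \<in> sets borel" unfolding S_def by measurable
  have "ennreal ((x / 6) powr p * ?q) = ennreal ((x / 6) powr p) * ennreal ?q"
    by (rule ennreal_mult') simp
  also have "\<dots> \<le> ennreal ((x / 6) powr p) * (\<integral>\<^sup>+z. ennreal (indicator S z *
      ((cmod z + N) powr (- (1 + \<alpha> + p * d)) * Im z powr (\<alpha> - 1))) \<partial>lborel)"
    unfolding S_def using p0 \<alpha> d c N by (intro mult_left_mono nn_integral_test_lower) auto
  also have "\<dots> = (\<integral>\<^sup>+z. ennreal ((x / 6) powr p) * ennreal (indicator S z *
      ((cmod z + N) powr (- (1 + \<alpha> + p * d)) * Im z powr (\<alpha> - 1))) \<partial>lborel)"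
    by (rule nn_integral_cmult[symmetric]) measurable
  also have "\<dots> \<le> bergman_mass p \<alpha> ?H"
    unfolding bergman_mass_def
  proof (rule nn_integral_mono)
    fix z :: complex
    have "(x / 6) powr p * (indicator S z * ((cmod z + N) powr (- (1 + \<alpha> + p * d)) * Im z powr (\<alpha> - 1)))
        \<le> indicator upper_half_plane z * (cmod (?H z) powr p * Im z powr (\<alpha> - 1))"
    proof (cases "z \<in> S")
      case True
      have "(x / 6) powr p * (cmod z + N) powr (- (1 + \<alpha> + p * d)) * Im z powr (\<alpha> - 1)
          \<le> cmod (?H z) powr p * Im z powr (\<alpha> - 1)"
        by (rule mult_right_mono[OF pt[OF True]]) simp
      then show ?thesis using True SU[OF True] by (simp add: mult.assoc)
    qed simp
    then show "ennreal ((x / 6) powr p) * ennreal (indicator S z *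
        ((cmod z + N) powr (- (1 + \<alpha> + p * d)) * Im z powr (\<alpha> - 1)))
      \<le> ennreal (indicator upper_half_plane z * (cmod (?H z) powr p * Im z powr (\<alpha> - 1)))"
      by (subst ennreal_mult'[symmetric]) (auto intro!: ennreal_leI)
  qed
  also have "\<dots> \<le> ennreal (B powr p) * bergman_mass p \<alpha> T"
  proof (rule bergman_mass_hausdorff_op_le_norm[OF p B Ts _ HT])
    have "0 < ennreal (2 * 3 powr (- (1 + \<alpha> + p)) / (p * d))" using p0 d by simp
    also have "\<dots> \<le> bergman_mass p \<alpha> T"
      unfolding T_def b by (rule bergman_mass_test_lower[OF p \<alpha> d])
    finally show "0 < bergman_mass p \<alpha> T" .
  qed
  also have "\<dots> \<le> ennreal (B powr p) * ennreal (C0 / d)"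
    unfolding T_def b C0_def using bergman_mass_test_upper[OF p \<alpha> d]
    by (intro mult_left_mono) simp_all
  also have "\<dots> = ennreal (B powr p * (C0 / d))" by (rule ennreal_mult'[symmetric]) simp
  finally have main: "(x / 6) powr p * ?q \<le> B powr p * (C0 / d)"
    using \<alpha> d by (subst (asm) ennreal_le_iff) (auto simp: C0_def)
  have pd: "p * d \<le> p" using p0 d mult_left_mono[of d 1 p] by simp
  have "ln N / N \<le> 1" using ln_le_minus_one[of N] N by simp
  then have "exp (ln N / N) \<le> 3" using exp_le by (meson exp_le_cancel_iff order_trans)
  moreover have "N powr d = exp (ln N / N)" using N by (simp add: powr_def d_def)
  ultimately have Nd: "N powr d \<le> 3" by simp
  have "3 powr (- p) \<le> (N powr d) powr (- p)"
    using Nd N p0 by (intro powr_mono2') auto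
  also have "\<dots> = N powr (- (p * d))" by (simp add: powr_powr mult.commute)
  finally have Nq: "3 powr (- p) \<le> N powr (- (p * d))" .
  have "2 * c * 3 powr (- (1 + \<alpha> + p)) * (3 powr (- p) / (p * d)) \<le> ?q"
    using c p0 d pd Nq by (intro mult_mono mult_left_mono divide_right_mono powr_mono) auto
  then have "(x / 6) powr p * (2 * c * 3 powr (- (1 + \<alpha> + p)) * (3 powr (- p) / (p * d))) \<le> (x / 6) powr p * ?q"
    by (rule mult_left_mono) simp
  with main have "(x / 6) powr p * (2 * c * 3 powr (- (1 + \<alpha> + p)) * (3 powr (- p) / (p * d))) \<le> B powr p * (C0 / d)"
    by linarith
  moreover have "(x / 6) powr p * (2 * c * 3 powr (- (1 + \<alpha> + p)) * (3 powr (- p) / (p * d))) = x powr p * D / d"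
    by (simp add: D_def c_def powr_divide powr_minus_divide)
  \<comment> \<open>Both sides carry the same factor 1 / d = N, so cancelling it leaves a bound free
    of N.\<close>
  ultimately have "x powr p * D / d \<le> B powr p * C0 / d" by simp
  then have "x powr p * D \<le> B powr p * C0"
    using d(1) by (simp add: divide_le_cancel)
  moreover have "D > 0" unfolding D_def using b0 p0 by simp
  ultimately have "x powr p \<le> B powr p * C0 / D" by (simp add: pos_le_divide_eq)
  then have "(x powr p) powr (1 / p) \<le> (B powr p * C0 / D) powr (1 / p)"
    using p0 by (intro powr_mono2[of "1 / p"]) auto
  moreover have "(x powr p) powr (1 / p) = x" using p0 x by (simp add: powr_powr)
  ultimately have "x \<le> (B powr p * C0 / D) powr (1 / p)" by (simp only:)
  then have "a \<le> ennreal ((B powr p * C0 / D) powr (1 / p))" unfolding x by (rule ennreal_leI)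
  then show ?thesis by (simp only: a_def \<psi>_def C0_def)
qed

text \<open>The uniform bound on [1 / N, N] passes to the half-line by monotone convergence.\<close>

lemma integrable_hausdorff_density_of_bounded:
  fixes p \<alpha> b :: real and \<phi> :: "real \<Rightarrow> complex"
  assumes p: "1 \<le> p" and \<alpha>: "0 < \<alpha>" and b: "b = (1 + \<alpha>) / p"
    and meas: "\<phi> \<in> borel_measurable (lebesgue_on {0<..})"
    and pos: "\<And>t. 0 < t \<Longrightarrow> \<phi> t \<in> \<real>\<^sub>\<ge>\<^sub>0"
    and bdd: "hausdorff_bounded p \<alpha> \<phi>"
  shows "integrable lebesgue (hausdorff_density b \<phi>)"
proof -
  define \<psi> where "\<psi> = hausdorff_density b \<phi>"
  define B where "B = enn2real (hausdorff_norm p \<alpha> \<phi>)"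
  have B: "hausdorff_norm p \<alpha> \<phi> = ennreal B" "0 \<le> B"
    using bdd by (auto simp: B_def hausdorff_bounded_def)
  have [measurable]: "\<psi> \<in> borel_measurable lebesgue"
    unfolding \<psi>_def by (rule borel_measurable_hausdorff_density[OF meas])
  \<comment> \<open>\<open>Suc n\<close> guarantees N \<ge> 1, as
    \<open>truncated_density_integral_bound\<close> requires.\<close>
  have "\<exists>C. \<forall>n::nat. (\<integral>\<^sup>+t. ennreal (indicator {1 / real (Suc n)..real (Suc n)} t * cmod (\<psi> t)) \<partial>lebesgue) \<le> ennreal C"
    unfolding \<psi>_def
    by (intro exI allI, rule truncated_density_integral_bound[OF p \<alpha> b meas pos bdd _ B]) simp_all
  then obtain C where C: "\<And>n::nat. (\<integral>\<^sup>+t. ennreal (indicator {1 / real (Suc n)..real (Suc n)} t * cmod (\<psi> t)) \<partial>lebesgue) \<le> ennreal C"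
    by blast
  let ?g = "\<lambda>n::nat. \<lambda>t. ennreal (indicator {1 / real (Suc n)..real (Suc n)} t * cmod (\<psi> t))"
  have lim: "(SUP n. ?g n t) = ennreal (cmod (\<psi> t))" for t
  proof (rule antisym)
    show "(SUP n. ?g n t) \<le> ennreal (cmod (\<psi> t))"
      by (rule SUP_least) (auto simp: indicator_def)
    show "ennreal (cmod (\<psi> t)) \<le> (SUP n. ?g n t)"
    proof (cases "t > 0")
      case True
      obtain n where n: "max t (1 / t) \<le> real n" using real_arch_simple by blast
      then have "t \<le> real (Suc n)" "1 / t \<le> real (Suc n)" by auto
      then have "t \<in> {1 / real (Suc n)..real (Suc n)}" using True by (simp add: field_simps)
      then have eq: "?g n t = ennreal (cmod (\<psi> t))" by simp
      have "?g n t \<le> (SUP n. ?g n t)" by (rule SUP_upper) simp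
      then show ?thesis unfolding eq .
    qed (simp add: \<psi>_def hausdorff_density_def)
  qed
  have inc: "incseq ?g"
  proof (rule incseq_SucI, rule le_funI, rule ennreal_leI)
    fix n :: nat and t :: real
    have "1 / real (Suc (Suc n)) \<le> 1 / real (Suc n)" by (intro divide_left_mono) auto
    then show "indicator {1 / real (Suc n)..real (Suc n)} t * cmod (\<psi> t)
      \<le> indicator {1 / real (Suc (Suc n))..real (Suc (Suc n))} t * cmod (\<psi> t)"
      by (auto simp: indicator_def)
  qed
  have "(\<integral>\<^sup>+t. ennreal (cmod (\<psi> t)) \<partial>lebesgue) = (\<integral>\<^sup>+t. (SUP n. ?g n t) \<partial>lebesgue)"
    by (simp only: lim)
  also have "\<dots> = (SUP n. \<integral>\<^sup>+t. ?g n t \<partial>lebesgue)"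
    unfolding \<psi>_def
    by (rule nn_integral_monotone_convergence_SUP[OF inc[unfolded \<psi>_def]
        borel_measurable_truncated_density[OF meas]])
  also have "\<dots> \<le> ennreal C" by (rule SUP_least) (rule C)
  finally have "(\<integral>\<^sup>+t. ennreal (cmod (\<psi> t)) \<partial>lebesgue) < \<infinity>"
    by (rule le_less_trans) simp
  then show ?thesis unfolding \<psi>_def[symmetric] by (intro integrableI_bounded) auto
qed

theorem theorem1p1:
  fixes p \<alpha> :: real and \<phi> :: "real \<Rightarrow> complex"
  assumes "1 \<le> p" and "0 < \<alpha>"
    and "\<phi> \<in> borel_measurable (lebesgue_on {0<..})"
  shows "(set_integrable lebesgue {0<..} (\<lambda>t. t powr ((1 + \<alpha>) / p - 1) * cmod (\<phi> t)) \<longrightarrow>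
            hausdorff_bounded p \<alpha> \<phi> \<and>
            ennreal (cmod (LINT t:{0<..}|lebesgue. complex_of_real (t powr ((1 + \<alpha>) / p - 1)) * \<phi> t))
              \<le> hausdorff_norm p \<alpha> \<phi> \<and>
            hausdorff_norm p \<alpha> \<phi>
              \<le> ennreal (LINT t:{0<..}|lebesgue. t powr ((1 + \<alpha>) / p - 1) * cmod (\<phi> t))) \<and>
         ((\<forall>t>0. \<phi> t \<in> \<real>\<^sub>\<ge>\<^sub>0) \<and> hausdorff_bounded p \<alpha> \<phi> \<longrightarrow>
            set_integrable lebesgue {0<..} (\<lambda>t. t powr ((1 + \<alpha>) / p - 1) * cmod (\<phi> t)))"
proof -
  define b where "b = (1 + \<alpha>) / p"
  have A: "(LINT t:{0<..}|lebesgue. complex_of_real (t powr (b - 1)) * \<phi> t)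
      = (\<integral>t. hausdorff_density b \<phi> t \<partial>lebesgue)"
    by (simp only: set_lebesgue_integral_def hausdorff_density_def)
  have K: "(LINT t:{0<..}|lebesgue. t powr (b - 1) * cmod (\<phi> t))
      = (\<integral>t. cmod (hausdorff_density b \<phi> t) \<partial>lebesgue)"
    by (simp only: set_lebesgue_integral_def cmod_hausdorff_density)
  show ?thesis
    unfolding b_def[symmetric] A K integrable_hausdorff_density_iff[OF assms(3), symmetric]
    using hausdorff_boundedI[OF assms(1,2) b_def] hausdorff_norm_le[OF assms(1,2) b_def]
      hausdorff_norm_lower[OF assms(1,2) b_def]
      integrable_hausdorff_density_of_bounded[OF assms(1,2) b_def assms(3)]
    by blast
qed

end
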